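(* In the setting described in the context (in particular $\mathcal X$ is reflexive, $\mathcal Y$ is uniformly smooth, and the stated assumptions on $\Theta$ and $F$ hold), let $\tau>1$ and $\bar\mu_0>0$ be chosen such that $$c_1:=1-\eta-\frac{1+\eta}{\tau}-\frac1{p^*}\left(\frac{\bar\mu_0}{2c_0}\right)^{p^*-1}>0 .$$ For $\delta>0$ let $y^\delta\in\mathcal Y$ satisfy $\|y^\delta-y\|\le\delta$, and let $\{(\xi_n^\delta,x_n^\delta)\}$ be produced by the two-point gradient method with the combination parameters $\{\lambda_n^\delta\}$ chosen by the DBTS algorithm started with $i_0^\delta=0$. Let $n_\delta$ be the integer determined by the discrepancy principle $$\|F(z_{n_\delta}^\delta)-y^\delta\|\le\tau\delta<\|F(z_n^\delta)-y^\delta\|,\qquad 0\le n<n_\delta .$$ If $\mathcal N(L(x^\dagger))\subset\mathcal N(L(x))$ for all $x\in B_{3\rho}(x_0)$, where $\mathcal N$ denotes the null space, then $$\lim_{\delta\to0}\|x_{n_\delta}^\delta-x^\dagger\|=0\qquad\text{and}\qquad \lim_{\delta\to0}D_{\xi_{n_\delta}^\delta}\Theta(x^\dagger,x_{n_\delta}^\delta)=0 .$$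
   Context: **Setting.** $\mathcal X$ is a reflexive Banach space and $\mathcal Y$ is a uniformly smooth Banach space; $F:\mathscr D(F)\subset\mathcal X\to\mathcal Y$ is an operator, $y\in\mathcal Y$, and the equation to be solved is $F(x)=y$. "Solution" means a solution of $F(x)=y$. $B_r(x_0)$ is the closed ball of radius $r$ around $x_0$. $\mathscr D(\Theta)=\{x:\Theta(x)<\infty\}$. For $\xi\in\partial\Theta(x)$ the Bregman distance is $D_\xi\Theta(\bar x,x)=\Theta(\bar x)-\Theta(x)-\langle\xi,\bar x-x\rangle$. Assumptions on $\Theta$: $\Theta:\mathcal X\to(-\infty,\infty]$ is proper, convex, weakly lower semi-continuous and $p$-convex with $p\ge2$: there is $c_0>0$ with $D_\xi\Theta(\bar x,x)\ge c_0\|\bar x-x\|^p$ for all $\bar x\in\mathcal X$, all $x$ with $\partial\Theta(x)\ne\emptyset$ and all $\xi\in\partial\Theta(x)$. Put $p^*=p/(p-1)$. The conjugate $\Theta^*$ is then Fréchet differentiable on $\mathcal X^*$ and $\nabla\Theta^*(\xi)=\arg\min_{z\in\mathcal X}\{\Theta(z)-\langle\xi,z\rangle\}$. Assumptions on $F$: (a) there are $\rho>0$, $x_0\in\mathcal X$, $\xi_0\in\partial\Theta(x_0)$ with $B_{3\rho}(x_0)\subset\mathscr D(F)$, and there is a solution $x^*\in\mathscr D(\Theta)$ with $D_{\xi_0}\Theta(x^*,x_0)\le c_0\rho^p$. (b) $F$ is weakly closed: if $x_n\in\mathscr D(F)$, $x_n\rightharpoonup x$ and $F(x_n)\rightharpoonup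 v$, then $x\in\mathscr D(F)$ and $F(x)=v$. (c) There are bounded linear operators $L(x):\mathcal X\to\mathcal Y$, $x\in B_{3\rho}(x_0)$, with $x\mapsto L(x)$ continuous on $B_{3\rho}(x_0)$, a number $0\le\eta<1$ with $\|F(x)-F(\bar x)-L(\bar x)(x-\bar x)\|\le\eta\|F(x)-F(\bar x)\|$ for all $x,\bar x\in B_{3\rho}(x_0)$, and $C_0>0$ with $\|L(x)\|\le C_0$ for all $x\in B_{3\rho}(x_0)$. $x^\dagger$ denotes the (unique) solution with $D_{\xi_0}\Theta(x^\dagger,x_0)=\min\{D_{\xi_0}\Theta(x,x_0):x\in\mathscr D(\Theta)\cap\mathscr D(F),\ F(x)=y\}$. For $1<s<\infty$, $J_s^{\mathcal Y}:\mathcal Y\to\mathcal Y^*$ is the (single-valued, continuous) duality mapping: $\|J_s^{\mathcal Y}(v)\|=\|v\|^{s-1}$, $\langle J_s^{\mathcal Y}(v),v\rangle=\|v\|^s$. **Two-point gradient method.** Fix $s\in(1,\infty)$, $\tau>1$, $\bar\mu_0,\bar\mu_1>0$. With $\xi_{-1}^\delta=\xi_0^\delta=\xi_0$, $x_{-1}^\delta=x_0^\delta=x_0$, for $n\ge0$: $$\zeta_n^\delta=\xi_n^\delta+\lambda_n^\delta(\xi_n^\delta-\xi_{n-1}^\delta),\quad z_n^\delta=\nabla\Theta^*(\zeta_n^\delta),\quad \xi_{n+1}^\delta=\zeta_n^\delta-\mu_n^\delta L(z_n^\delta)^*J_s^{\mathcal Y}(r_n^\delta),\quad x_{n+1}^\delta=\nabla\Theta^*(\xi_{n+1}^\delta),$$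 where $r_n^\delta=F(z_n^\delta)-y^\delta$, $\lambda_n^\delta\ge0$, and $$\mu_n^\delta=\min\left\{\frac{\bar\mu_0\|r_n^\delta\|^{p(s-1)}}{\|L(z_n^\delta)^*J_s^{\mathcal Y}(r_n^\delta)\|^p},\bar\mu_1\right\}\|r_n^\delta\|^{p-s}\ \text{ if }\|r_n^\delta\|>\tau\delta,\qquad \mu_n^\delta=0\ \text{ if }\|r_n^\delta\|\le\tau\delta .$$ A quotient with zero denominator is read as $+\infty$. $F$ and $L$ are thought of as extended arbitrarily outside $\mathscr D(F)$ and $B_{3\rho}(x_0)$, so that the scheme is formally defined. **DBTS algorithm for $\lambda_n^\delta$.** Fix $\nu>1$, $\alpha\ge3$, an integer $j_{\max}\ge1$, and a non-increasing $q:\mathbb N\to[0,\infty)$ with $\sum_{i=0}^\infty q(i)<\infty$. Let $c_1$ be as in the claim, $\gamma_1=c_1p^*(2c_0)^{p^*-1}/\nu$, $M=\frac{c_1}{\nu}\min\{\bar\mu_0/C_0^p,\bar\mu_1\}$, $\gamma_0=\frac12(2c_0)^{p^*-1}p^*M\tau^p$. Since $\xi_0^\delta=\xi_{-1}^\delta$, the value of $\lambda_0^\delta$ is irrelevant (take $\lambda_0^\delta=0$). For $n\ge1$, given $\xi_n^\delta,\xi_{n-1}^\delta$ and the integer $i_{n-1}^\delta$, put $$\beta_n(i)=\min\left\{\frac{q(i)}{\|\xi_n^\delta-\xi_{n-1}^\delta\|},\ \frac{p^*(2c_0)^{p^*}\rho^p}{4\|\xi_n^\delta-\xi_{n-1}^\delta\|^{p^*}},\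 \frac n{n+\alpha}\right\}.$$ For $j=1,\dots,j_{\max}$ do: set the trial value $\lambda=\beta_n(i_{n-1}^\delta+j)$ and compute the corresponding $\zeta=\xi_n^\delta+\lambda(\xi_n^\delta-\xi_{n-1}^\delta)$, $z=\nabla\Theta^*(\zeta)$, and step size $\mu$ (by the formula for $\mu_n^\delta$ with $z$ in place of $z_n^\delta$). - If $\|F(z)-y^\delta\|\le\tau\delta$: output $\lambda_n^\delta=0$, $i_n^\delta=i_{n-1}^\delta+j$ and stop. - Else if $(\lambda+\lambda^{p^*})\|\xi_n^\delta-\xi_{n-1}^\delta\|^{p^*}\le\gamma_1\mu\|F(z)-y^\delta\|^s$: output $\lambda_n^\delta=\lambda$, $i_n^\delta=i_{n-1}^\delta+j$ and stop. - Otherwise continue with the next $j$. If no $j\le j_{\max}$ leads to a stop, output $\lambda_n^\delta=\min\left\{\frac{\gamma_0\delta^p}{\|\xi_n^\delta-\xi_{n-1}^\delta\|^{p^*}},\frac n{n+\alpha}\right\}$ and $i_n^\delta=i_{n-1}^\delta+j_{\max}$. *)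

theory Defs
  imports "HOL-Analysis.Analysis"
begin

text \<open>The dual space of \<open>'a\<close> is the type \<open>'a \<Rightarrow>\<^sub>L real\<close>, and the adjoint \<open>A\<^sup>* f\<close> of a bounded linear
  operator \<open>A\<close>, applied to a functional \<open>f\<close>, is the composition \<open>f o\<^sub>L A\<close>.\<close>

section \<open>Geometry of Banach spaces\<close>

text \<open>Surjectivity of the canonical embedding into the bidual.\<close>

definition reflexive_space :: "'a::real_normed_vector itself \<Rightarrow> bool" where
  "reflexive_space _ \<longleftrightarrow>
     (\<forall>\<phi> :: ('a \<Rightarrow>\<^sub>L real) \<Rightarrow>\<^sub>L real. \<exists>x. \<forall>f. blinfun_apply \<phi> f = blinfun_apply f x)"

text \<open>The element \<open>0\<close> (attained for \<open>y = 0\<close>) is inserted only to give the supremum the right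
  value for the zero space, whose unit sphere is empty.\<close>

definition modulus_of_smoothness :: "'a::real_normed_vector itself \<Rightarrow> real \<Rightarrow> real" where
  "modulus_of_smoothness _ t =
     Sup (insert 0 {(norm (x + y) + norm (x - y)) / 2 - 1 | x y :: 'a. norm x = 1 \<and> norm y \<le> t})"

definition uniformly_smooth :: "'a::real_normed_vector itself \<Rightarrow> bool" where
  "uniformly_smooth T \<longleftrightarrow> ((\<lambda>t. modulus_of_smoothness T t / t) \<longlongrightarrow> 0) (at_right 0)"

definition weakly_conv :: "(nat \<Rightarrow> 'a::real_normed_vector) \<Rightarrow> 'a \<Rightarrow> bool" where
  "weakly_conv u l \<longleftrightarrow> (\<forall>f :: 'a \<Rightarrow>\<^sub>L real. (\<lambda>n. blinfun_apply f (u n)) \<longlonglongrightarrow> blinfun_apply f l)"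

text \<open>Single-valued when the dual space is strictly convex, in particular on uniformly smooth
  spaces.\<close>

definition duality_map :: "real \<Rightarrow> 'b::real_normed_vector \<Rightarrow> 'b \<Rightarrow>\<^sub>L real" where
  "duality_map s v =
     (THE j. norm j = norm v powr (s - 1) \<and> blinfun_apply j v = norm v powr s)"

section \<open>Convex analysis\<close>

definition proper_fun :: "('a \<Rightarrow> ereal) \<Rightarrow> bool" where
  "proper_fun \<Theta> \<longleftrightarrow> (\<forall>x. \<Theta> x \<noteq> -\<infinity>) \<and> (\<exists>x. \<Theta> x < \<infinity>)"

definition convex_fun :: "('a::real_vector \<Rightarrow> ereal) \<Rightarrow> bool" where
  "convex_fun \<Theta> \<longleftrightarrow>
     (\<forall>x y t. 0 < t \<and> t < 1 \<longrightarrow>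
        \<Theta> ((1 - t) *\<^sub>R x + t *\<^sub>R y) \<le> ereal (1 - t) * \<Theta> x + ereal t * \<Theta> y)"

definition weakly_lsc :: "('a::real_normed_vector \<Rightarrow> ereal) \<Rightarrow> bool" where
  "weakly_lsc \<Theta> \<longleftrightarrow> (\<forall>u l. weakly_conv u l \<longrightarrow> \<Theta> l \<le> liminf (\<lambda>n. \<Theta> (u n)))"

text \<open>For a proper \<open>\<Theta>\<close> this is empty outside the effective domain.\<close>

definition subdifferential ::
  "('a::real_normed_vector \<Rightarrow> ereal) \<Rightarrow> 'a \<Rightarrow> ('a \<Rightarrow>\<^sub>L real) set" where
  "subdifferential \<Theta> x = {\<xi>. \<forall>z. \<Theta> x + ereal (blinfun_apply \<xi> (z - x)) \<le> \<Theta> z}"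

text \<open>\<open>bregman \<Theta> \<xi> x' x\<close> is the Bregman distance from \<open>x\<close> to \<open>x'\<close>, used for
  \<open>\<xi> \<in> subdifferential \<Theta> x\<close> only, so that \<open>\<Theta> x\<close> is finite.\<close>

definition bregman ::
  "('a::real_normed_vector \<Rightarrow> ereal) \<Rightarrow> ('a \<Rightarrow>\<^sub>L real) \<Rightarrow> 'a \<Rightarrow> 'a \<Rightarrow> ereal" where
  "bregman \<Theta> \<xi> x' x = \<Theta> x' - \<Theta> x - ereal (blinfun_apply \<xi> (x' - x))"

definition p_convex :: "('a::real_normed_vector \<Rightarrow> ereal) \<Rightarrow> real \<Rightarrow> real \<Rightarrow> bool" where
  "p_convex \<Theta> p c\<^sub>0 \<longleftrightarrow>
     (\<forall>x' x. \<forall>\<xi> \<in> subdifferential \<Theta> x. ereal (c\<^sub>0 * norm (x' - x) powr p) \<le> bregman \<Theta> \<xi> x' x)"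

definition conjugate :: "('a::real_normed_vector \<Rightarrow> ereal) \<Rightarrow> ('a \<Rightarrow>\<^sub>L real) \<Rightarrow> ereal" where
  "conjugate \<Theta> \<xi> = (SUP x. ereal (blinfun_apply \<xi> x) - \<Theta> x)"

text \<open>The Frechet gradient of the conjugate, an element of the bidual, regarded as an element of
  the (reflexive) space \<open>'a\<close>.\<close>

definition grad_conjugate ::
  "('a::real_normed_vector \<Rightarrow> ereal) \<Rightarrow> ('a \<Rightarrow>\<^sub>L real) \<Rightarrow> 'a" where
  "grad_conjugate \<Theta> \<xi> =
     (THE x. ((\<lambda>\<phi>. real_of_ereal (conjugate \<Theta> \<phi>)) has_derivative (\<lambda>\<phi>. blinfun_apply \<phi> x)) (at \<xi>))"

section \<open>The two-point gradient method\<close>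

text \<open>A quotient that is read as \<open>+\<infinity>\<close> whenever the denominator vanishes.\<close>

definition quot :: "real \<Rightarrow> real \<Rightarrow> ereal" where
  "quot a b = (if b = 0 then \<infinity> else ereal (a / b))"

definition tpg_step_size ::
  "('a::real_normed_vector \<Rightarrow> 'b::real_normed_vector) \<Rightarrow> ('a \<Rightarrow> 'a \<Rightarrow>\<^sub>L 'b) \<Rightarrow>
   real \<Rightarrow> real \<Rightarrow> real \<Rightarrow> real \<Rightarrow> real \<Rightarrow> real \<Rightarrow> 'b \<Rightarrow> 'a \<Rightarrow> real" where
  "tpg_step_size F L p s \<tau> \<mu>\<^sub>0 \<mu>\<^sub>1 \<delta> yd z =
     (let r = F z - yd in
      if norm r > \<tau> * \<delta>
      then real_of_ereal
             (min (quot (\<mu>\<^sub>0 * norm r powr (p * (s - 1))) (norm (duality_map s r o\<^sub>L L z) powr p))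
                  (ereal \<mu>\<^sub>1))
           * norm r powr (p - s)
      else 0)"

text \<open>The index \<open>-1\<close> is encoded by truncated subtraction: for \<open>n = 0\<close> the term \<open>\<xi> (n - 1)\<close> is
  \<open>\<xi> 0\<close>, in accordance with \<open>\<xi>\<^sub>-\<^sub>1 = \<xi>\<^sub>0\<close>.\<close>

definition two_point_gradient ::
  "('a::real_normed_vector \<Rightarrow> ereal) \<Rightarrow> ('a \<Rightarrow> 'b::real_normed_vector) \<Rightarrow> ('a \<Rightarrow> 'a \<Rightarrow>\<^sub>L 'b) \<Rightarrow>
   real \<Rightarrow> real \<Rightarrow> real \<Rightarrow> real \<Rightarrow> real \<Rightarrow> real \<Rightarrow> 'b \<Rightarrow> 'a \<Rightarrow> ('a \<Rightarrow>\<^sub>L real) \<Rightarrow>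
   (nat \<Rightarrow> real) \<Rightarrow> (nat \<Rightarrow> 'a \<Rightarrow>\<^sub>L real) \<Rightarrow> (nat \<Rightarrow> 'a) \<Rightarrow> (nat \<Rightarrow> 'a \<Rightarrow>\<^sub>L real) \<Rightarrow> (nat \<Rightarrow> 'a) \<Rightarrow> bool" where
  "two_point_gradient \<Theta> F L p s \<tau> \<mu>\<^sub>0 \<mu>\<^sub>1 \<delta> yd x\<^sub>0 \<xi>\<^sub>0 lam \<xi> x \<zeta> z \<longleftrightarrow>
     \<xi> 0 = \<xi>\<^sub>0 \<and> x 0 = x\<^sub>0 \<and>
     (\<forall>n. \<zeta> n = \<xi> n + lam n *\<^sub>R (\<xi> n - \<xi> (n - 1)) \<and>
          z n = grad_conjugate \<Theta> (\<zeta> n) \<and>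
          \<xi> (Suc n) = \<zeta> n - tpg_step_size F L p s \<tau> \<mu>\<^sub>0 \<mu>\<^sub>1 \<delta> yd (z n) *\<^sub>R
                              (duality_map s (F (z n) - yd) o\<^sub>L L (z n)) \<and>
          x (Suc n) = grad_conjugate \<Theta> (\<xi> (Suc n)))"

text \<open>The integer determined by the discrepancy principle.\<close>

definition discrepancy_index ::
  "('a \<Rightarrow> 'b::real_normed_vector) \<Rightarrow> real \<Rightarrow> real \<Rightarrow> 'b \<Rightarrow> (nat \<Rightarrow> 'a) \<Rightarrow> nat" where
  "discrepancy_index F \<tau> \<delta> yd z =
     (THE N. norm (F (z N) - yd) \<le> \<tau> * \<delta> \<and> (\<forall>n<N. \<tau> * \<delta> < norm (F (z n) - yd)))"

section \<open>The DBTS algorithm\<close>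

text \<open>In the following, \<open>d\<close> stands for the norm of \<open>\<xi>\<^sub>n - \<xi>\<^sub>n\<^sub>-\<^sub>1\<close> and \<open>p / (p - 1)\<close> is the exponent
  conjugate to \<open>p\<close>.\<close>

definition dbts_beta ::
  "real \<Rightarrow> real \<Rightarrow> real \<Rightarrow> real \<Rightarrow> (nat \<Rightarrow> real) \<Rightarrow> nat \<Rightarrow> real \<Rightarrow> nat \<Rightarrow> real" where
  "dbts_beta p c\<^sub>0 \<rho> \<alpha> q n d i =
     (let ps = p / (p - 1) in
      real_of_ereal
        (min (quot (q i) d)
             (min (quot (ps * (2 * c\<^sub>0) powr ps * \<rho> powr p) (4 * d powr ps))
                  (ereal (real n / (real n + \<alpha>))))))"

text \<open>One run of the algorithm, for \<open>n \<ge> 1\<close>: from \<open>\<xi>\<close> (\<open>= \<xi>\<^sub>n\<close>), \<open>\<xi>'\<close> (\<open>= \<xi>\<^sub>n\<^sub>-\<^sub>1\<close>) and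
  \<open>i\<close> (\<open>= i\<^sub>n\<^sub>-\<^sub>1\<close>) it computes the pair of \<open>\<lambda>\<^sub>n\<close> and \<open>i\<^sub>n\<close>. The backtracking loop is a search for
  the first \<open>j\<close> at which one of the two stopping tests succeeds.\<close>

definition dbts_step ::
  "('a::real_normed_vector \<Rightarrow> ereal) \<Rightarrow> ('a \<Rightarrow> 'b::real_normed_vector) \<Rightarrow> ('a \<Rightarrow> 'a \<Rightarrow>\<^sub>L 'b) \<Rightarrow>
   real \<Rightarrow> real \<Rightarrow> real \<Rightarrow> real \<Rightarrow> real \<Rightarrow> real \<Rightarrow> real \<Rightarrow>
   real \<Rightarrow> real \<Rightarrow> real \<Rightarrow> (nat \<Rightarrow> real) \<Rightarrow> nat \<Rightarrow>
   real \<Rightarrow> 'b \<Rightarrow> nat \<Rightarrow> ('a \<Rightarrow>\<^sub>L real) \<Rightarrow> ('a \<Rightarrow>\<^sub>L real) \<Rightarrow> nat \<Rightarrow> real \<times> nat" where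
  "dbts_step \<Theta> F L p c\<^sub>0 s \<tau> \<mu>\<^sub>0 \<mu>\<^sub>1 \<rho> \<gamma>\<^sub>0 \<gamma>\<^sub>1 \<alpha> q jmax \<delta> yd n \<xi> \<xi>' i =
     (let ps = p / (p - 1);
          d = norm (\<xi> - \<xi>');
          trial = (\<lambda>j. dbts_beta p c\<^sub>0 \<rho> \<alpha> q n d (i + j));
          z = (\<lambda>j. grad_conjugate \<Theta> (\<xi> + trial j *\<^sub>R (\<xi> - \<xi>')));
          test1 = (\<lambda>j. norm (F (z j) - yd) \<le> \<tau> * \<delta>);
          test2 = (\<lambda>j. (trial j + trial j powr ps) * d powr ps
                        \<le> \<gamma>\<^sub>1 * tpg_step_size F L p s \<tau> \<mu>\<^sub>0 \<mu>\<^sub>1 \<delta> yd (z j) * norm (F (z j) - yd) powr s)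
      in case find (\<lambda>j. test1 j \<or> test2 j) [1..<Suc jmax] of
           Some j \<Rightarrow> (if test1 j then 0 else trial j, i + j)
         | None \<Rightarrow> (real_of_ereal (min (quot (\<gamma>\<^sub>0 * \<delta> powr p) (d powr ps))
                                       (ereal (real n / (real n + \<alpha>)))),
                    i + jmax))"

definition dbts ::
  "('a::real_normed_vector \<Rightarrow> ereal) \<Rightarrow> ('a \<Rightarrow> 'b::real_normed_vector) \<Rightarrow> ('a \<Rightarrow> 'a \<Rightarrow>\<^sub>L 'b) \<Rightarrow>
   real \<Rightarrow> real \<Rightarrow> real \<Rightarrow> real \<Rightarrow> real \<Rightarrow> real \<Rightarrow> real \<Rightarrow>
   real \<Rightarrow> real \<Rightarrow> real \<Rightarrow> (nat \<Rightarrow> real) \<Rightarrow> nat \<Rightarrow>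
   real \<Rightarrow> 'b \<Rightarrow> (nat \<Rightarrow> 'a \<Rightarrow>\<^sub>L real) \<Rightarrow> (nat \<Rightarrow> real) \<Rightarrow> (nat \<Rightarrow> nat) \<Rightarrow> bool" where
  "dbts \<Theta> F L p c\<^sub>0 s \<tau> \<mu>\<^sub>0 \<mu>\<^sub>1 \<rho> \<gamma>\<^sub>0 \<gamma>\<^sub>1 \<alpha> q jmax \<delta> yd \<xi> lam i \<longleftrightarrow>
     lam 0 = 0 \<and> i 0 = 0 \<and>
     (\<forall>n\<ge>1. (lam n, i n) =
        dbts_step \<Theta> F L p c\<^sub>0 s \<tau> \<mu>\<^sub>0 \<mu>\<^sub>1 \<rho> \<gamma>\<^sub>0 \<gamma>\<^sub>1 \<alpha> q jmax \<delta> yd n (\<xi> n) (\<xi> (n - 1)) (i (n - 1)))"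

end

(*
  The Bregman distances of the iterates to xdag decrease until the discrepancy principle stops the
  iteration, so it suffices to find, for a sequence of noise levels tending to 0, one index at which
  the distance is small. By compactness of the range of the combination parameters a subsequence of
  the noisy iterations converges, step by step, to an iteration with exact data, in which the
  residuals and the momentum terms are summable. Along the indices at which the residual attains a
  new minimum, its iterates form a Cauchy sequence with a solution u as limit. Since all xi_n - xi_0
  annihilate the null space of L xdag, which contains u - xdag, a distance bounded away from 0 would
  make the Bregman distance from x_0 to u smaller than that to xdag.

  Existence of the minimizers defining the gradient of the conjugate needs no weak compactness:
  Ekeland's principle gives subgradients near every functional, and p-convexity makes the points
  where they are attained a Cauchy sequence.
*)
theory Submission
  imports Defs
begin

section \<open>Linear functionals below sublinear ones\<close>

text \<open>The search compares residuals with thresholds, so \<open>lam\<close> need not depend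
  continuously on the data, and the limits of the parameters need not be the output of any
  noise-free search. The limit iteration is therefore described only by relations that survive a
  limit: the recursion, monotonicity of the distance, the bound of the momentum by the residual, and
  bounds on partial sums.

  The step size itself does not pass to the limit: its factor \<open>norm r powr (p - s)\<close> can
  be singular where the residual vanishes. Only its product \<open>W\<close> with the duality
  mapping is used, which is of order \<open>norm r powr (p - 1)\<close>.

  All distances are written as \<open>D a \<xi>\<close>, a continuous function of the dual variable.
  One estimate, \<open>h_upper\<close>, controls both half-steps. The constants form a budget: a
  gradient step lowers the distance by \<open>c\<^sub>1\<close> times a quantity determined by the
  residual, momentum may use up the fraction \<open>1 / \<nu>\<close> of this, and
  \<open>\<kappa>\<close> is what remains.\<close>

definition sublinear :: "('a::real_vector \<Rightarrow> real) \<Rightarrow> bool" where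
  "sublinear P \<longleftrightarrow>
     (\<forall>u v. P (u + v) \<le> P u + P v) \<and> (\<forall>t v. t \<ge> 0 \<longrightarrow> P (t *\<^sub>R v) = t * P v)"

text \<open>Rescaling by \<open>inverse t\<close> turns the one-sided scaling inequality into an
  equality, so for functionals defined as infima only the easy direction has to be checked.\<close>

lemma sublinearI:
  assumes "\<And>u v. P (u + v) \<le> P u + P v" and "\<And>v. P (0 *\<^sub>R v) = 0"
    and "\<And>t v. t > 0 \<Longrightarrow> P (t *\<^sub>R v) \<le> t * P v"
  shows "sublinear P"
  unfolding sublinear_def
proof (intro conjI allI impI)
  fix t :: real and v
  assume "t \<ge> 0"
  show "P (t *\<^sub>R v) = t * P v"
  proof (cases "t = 0")
    case False
    then have t: "t > 0" using \<open>t \<ge> 0\<close> by simp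
    have "P v = P (inverse t *\<^sub>R (t *\<^sub>R v))" using t by simp
    also have "\<dots> \<le> inverse t * P (t *\<^sub>R v)" using assms(3)[of "inverse t" "t *\<^sub>R v"] t by simp
    finally have "t * P v \<le> P (t *\<^sub>R v)" using t by (simp add: field_simps)
    with assms(3)[OF t] show ?thesis by (simp add: antisym)
  qed (use assms(2) in simp)
qed (rule assms(1))

lemma sublinear_add: "sublinear P \<Longrightarrow> P (u + v) \<le> P u + P v"
  by (simp add: sublinear_def)

lemma sublinear_scale: "sublinear P \<Longrightarrow> t \<ge> 0 \<Longrightarrow> P (t *\<^sub>R v) = t * P v"
  by (simp add: sublinear_def)

lemma sublinear_zero: "sublinear P \<Longrightarrow> P 0 = 0"
  using sublinear_scale[of P 0 0] by simp

lemma sublinear_minus: "sublinear P \<Longrightarrow> - P (- v) \<le> P v"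
  using sublinear_add[of P v "- v"] sublinear_zero[of P] by simp

lemma sublinear_norm: "sublinear norm"
  by (rule sublinearI) (auto intro: norm_triangle_ineq)

text \<open>\<open>Q v\<close> moves from \<open>v\<close> along \<open>w\<close> as far as is
  profitable, paying \<open>P w\<close> per unit. A linear functional below \<open>Q\<close> has no
  freedom at \<open>w\<close>: the bound at \<open>- w\<close> and \<open>Q v \<le> P v\<close>
  force the value \<open>P w\<close> there.\<close>

lemma sublinear_tilt:
  fixes P :: "'a::real_vector \<Rightarrow> real"
  assumes P: "sublinear P"
  obtains Q where "sublinear Q" and "\<And>v. Q v \<le> P v" and "Q (- w) \<le> - P w"
proof -
  define G where "G = (\<lambda>v t. P (v + t *\<^sub>R w) - t * P w)"
  define Q where "Q = (\<lambda>v. INF t\<in>{0..}. G v t)"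
  have low: "- P (- v) \<le> G v t" if "t \<ge> 0" for v t
    using sublinear_add[OF P, of "v + t *\<^sub>R w" "- v"] sublinear_scale[OF P that, of w]
    by (simp add: G_def)
  have bdd: "bdd_below (G v ` {0..})" for v
    by (rule bdd_belowI2[of _ "- P (- v)"]) (use low in auto)
  have upper: "Q v \<le> G v t" if "t \<ge> 0" for v t
    unfolding Q_def by (rule cINF_lower[OF bdd]) (use that in auto)
  have lower: "c \<le> Q v" if "\<And>t. t \<ge> 0 \<Longrightarrow> c \<le> G v t" for c v
    unfolding Q_def by (rule cINF_greatest) (use that in auto)
  have "sublinear Q"
  proof (rule sublinearI)
    fix u v
    have "Q (u + v) \<le> G u a + G v b" if "a \<ge> 0" "b \<ge> 0" for a b
    proof -
      have "Q (u + v) \<le> G (u + v) (a + b)" using upper that by simp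
      also have "\<dots> \<le> G u a + G v b"
        using sublinear_add[OF P, of "u + a *\<^sub>R w" "v + b *\<^sub>R w"]
        by (simp add: G_def algebra_simps)
      finally show ?thesis .
    qed
    then have "Q (u + v) - G v b \<le> Q u" if "b \<ge> 0" for b
      by (intro lower) (smt (verit) that)
    then have "Q (u + v) - Q u \<le> Q v"
      by (intro lower) (smt (verit))
    then show "Q (u + v) \<le> Q u + Q v" by simp
  next
    fix v
    have "Q 0 \<le> 0" using upper[of 0 0] sublinear_zero[OF P] by (simp add: G_def)
    moreover have "0 \<le> Q 0" using low[of _ 0] sublinear_zero[OF P] by (intro lower) simp
    ultimately show "Q (0 *\<^sub>R v) = 0" by simp
  next
    fix t :: real and v
    assume t: "t > 0"
    have "Q (t *\<^sub>R v) / t \<le> G v a" if "a \<ge> 0" for a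
    proof -
      have "Q (t *\<^sub>R v) \<le> G (t *\<^sub>R v) (t * a)" using upper that t by simp
      also have "\<dots> = t * G v a"
        using sublinear_scale[OF P, of t "v + a *\<^sub>R w"] t by (simp add: G_def algebra_simps)
      finally show ?thesis using t by (simp add: field_simps)
    qed
    from lower[OF this] show "Q (t *\<^sub>R v) \<le> t * Q v" using t by (simp add: field_simps)
  qed
  moreover have "Q v \<le> P v" for v using upper[of 0 v] by (simp add: G_def)
  moreover have "Q (- w) \<le> - P w"
    using upper[of 1 "- w"] sublinear_zero[OF P] by (simp add: G_def)
  ultimately show ?thesis using that by blast
qed

text \<open>A minimal sublinear functional is linear, because each tilt of it is again sublinear.\<close>

lemma exists_linear_below:
  fixes P :: "'a::real_vector \<Rightarrow> real"
  assumes P: "sublinear P"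
  shows "\<exists>f. linear f \<and> (\<forall>v. f v \<le> P v)"
proof -
  define A where "A = {Q. sublinear Q \<and> Q \<le> P}"
  \<comment> \<open>The order is reversed so that the maximal element delivered by Zorn's lemma is a
    minimal sublinear functional.\<close>
  define R where "R = (\<lambda>a b :: 'a \<Rightarrow> real. b \<le> a)"
  have po: "partial_order_on A (relation_of R A)"
    unfolding R_def by (rule partial_order_on_relation_ofI) auto
  have ch: "\<exists>u\<in>A. \<forall>a\<in>C. R a u" if C: "C \<in> Chains (relation_of R A)" for C
  proof (cases "C = {}")
    case True
    then show ?thesis using P by (auto simp: A_def)
  next
    case False
    have CA: "a \<in> A" if "a \<in> C" for a
      using C that by (auto simp: Chains_def relation_of_def)
    have tot: "a \<le> b \<or> b \<le> a" if "a \<in> C" "b \<in> C" for a b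
      using C that by (auto simp: Chains_def relation_of_def R_def)
    define Q where "Q = (\<lambda>v. INF a\<in>C. a v)"
    have bdd: "bdd_below ((\<lambda>a. a v) ` C)" for v
    proof (rule bdd_belowI2[of _ "- P (- v)"])
      fix a assume "a \<in> C"
      then have a: "sublinear a" "a \<le> P" using CA by (auto simp: A_def)
      then show "- P (- v) \<le> a v" using sublinear_minus[OF a(1), of v] le_funD[OF a(2), of "- v"] by simp
    qed
    have upper: "Q v \<le> a v" if "a \<in> C" for v a
      unfolding Q_def by (rule cINF_lower[OF bdd that])
    have lower: "c \<le> Q v" if "\<And>a. a \<in> C \<Longrightarrow> c \<le> a v" for c v
      unfolding Q_def by (rule cINF_greatest[OF False]) (use that in auto)
    have sub: "sublinear a" if "a \<in> C" for a using CA[OF that] by (simp add: A_def)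
    have "sublinear Q"
    proof (rule sublinearI)
      fix u v
      \<comment> \<open>Subadditivity of an infimum can fail for general families. In a chain the
        smaller one, \<open>e\<close>, of two members serves both arguments at once.\<close>
      have 1: "Q (u + v) \<le> a u + b v" if ab: "a \<in> C" "b \<in> C" for a b
      proof -
        obtain e where e: "e \<in> C" "e \<le> a" "e \<le> b" using tot[OF ab] ab by blast
        have "Q (u + v) \<le> e u + e v"
          using upper[OF e(1)] sublinear_add[OF sub[OF e(1)]] order_trans by blast
        then show ?thesis using le_funD[OF e(2), of u] le_funD[OF e(3), of v] by simp
      qed
      have "Q (u + v) - b v \<le> Q u" if "b \<in> C" for b
        by (rule lower) (use 1 that in \<open>smt (verit)\<close>)
      then have "Q (u + v) - Q u \<le> Q v" by (intro lower) (smt (verit))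
      then show "Q (u + v) \<le> Q u + Q v" by simp
    next
      fix v :: 'a
      obtain a where a: "a \<in> C" using False by blast
      have "Q 0 \<le> 0" using upper[OF a, of 0] sublinear_zero[OF sub[OF a]] by simp
      moreover have "0 \<le> Q 0" by (rule lower) (simp add: sub sublinear_zero)
      ultimately show "Q (0 *\<^sub>R v) = 0" by simp
    next
      fix t :: real and v :: 'a
      assume t: "t > 0"
      have "Q (t *\<^sub>R v) / t \<le> Q v"
      proof (rule lower)
        fix a assume a: "a \<in> C"
        have "Q (t *\<^sub>R v) \<le> t * a v" using upper[OF a] sublinear_scale[OF sub[OF a]] t
          by (metis less_eq_real_def)
        then show "Q (t *\<^sub>R v) / t \<le> a v" using t by (simp add: field_simps)
      qed
      then show "Q (t *\<^sub>R v) \<le> t * Q v" using t by (simp add: field_simps)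
    qed
    moreover have "Q \<le> P"
    proof (rule le_funI)
      fix v obtain a where a: "a \<in> C" using False by blast
      then have "a \<le> P" using CA by (simp add: A_def)
      then show "Q v \<le> P v" using upper[OF a, of v] le_funD[of a P v] by simp
    qed
    ultimately have "Q \<in> A" by (simp add: A_def)
    then show ?thesis using upper unfolding R_def le_fun_def by blast
  qed
  obtain f where f: "f \<in> A" and min: "\<And>a. a \<in> A \<Longrightarrow> a \<le> f \<Longrightarrow> a = f"
    using predicate_Zorn[OF po ch] unfolding R_def by blast
  have sf: "sublinear f" and fP: "f \<le> P" using f by (auto simp: A_def)
  have neg: "f (- w) = - f w" for w
  proof -
    obtain Q where Q: "sublinear Q" "\<And>v. Q v \<le> f v" "Q (- w) \<le> - f w"
      using sublinear_tilt[OF sf] by blast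
    have "Q \<le> f" using Q(2) by (rule le_funI)
    moreover from this have "Q \<in> A" using Q(1) fP unfolding A_def by auto
    ultimately have "Q = f" using min by blast
    then show ?thesis using Q(3) sublinear_minus[OF sf, of w] by simp
  qed
  have add: "f (u + v) = f u + f v" for u v
    using sublinear_add[OF sf, of u v] sublinear_add[OF sf, of "- u" "- v"] neg[of "u + v"]
      neg[of u] neg[of v] by simp
  have "f (t *\<^sub>R v) = t *\<^sub>R f v" for t v
  proof (cases "t \<ge> 0")
    case False
    then have "f (- (t *\<^sub>R v)) = - t * f v" using sublinear_scale[OF sf, of "- t" v] by simp
    then show ?thesis using neg[of "t *\<^sub>R v"] by simp
  qed (use sublinear_scale[OF sf] in simp)
  then have "linear f" using add by (intro linearI)
  then show ?thesis using fP by (auto simp: le_fun_def)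
qed

lemma exists_blinfun_below:
  fixes P :: "'a::real_normed_vector \<Rightarrow> real"
  assumes P: "sublinear P" and K: "\<And>v. P v \<le> K * norm v" and "K \<ge> 0"
  shows "\<exists>f :: 'a \<Rightarrow>\<^sub>L real. (\<forall>v. blinfun_apply f v \<le> P v) \<and> norm f \<le> K"
proof -
  obtain f where f: "linear f" and le: "\<And>v. f v \<le> P v"
    using exists_linear_below[OF P] by blast
  have bound: "norm (f v) \<le> K * norm v" for v
    using le[of v] le[of "- v"] K[of v] K[of "- v"] linear_neg[OF f, of v] by (simp add: abs_le_iff)
  have "bounded_linear f"
    by (rule bounded_linear_intro[of f K])
       (use bound linear_add[OF f] linear_scale[OF f] in \<open>auto simp: mult.commute\<close>)
  then have app: "blinfun_apply (Blinfun f) = f" by (rule bounded_linear_Blinfun_apply)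
  have "norm (Blinfun f) \<le> K"
    by (rule norm_blinfun_bound[OF \<open>K \<ge> 0\<close>]) (use bound app in simp)
  then show ?thesis using le app by (intro exI[of _ "Blinfun f"]) simp
qed

text \<open>Every functional below the norm tilted along \<open>w\<close> must take the value
  \<open>norm w\<close> at \<open>w\<close>.\<close>

lemma exists_norming_functional:
  fixes w :: "'a::real_normed_vector"
  shows "\<exists>f :: 'a \<Rightarrow>\<^sub>L real. norm f \<le> 1 \<and> blinfun_apply f w = norm w"
proof -
  obtain Q where Q: "sublinear Q" "\<And>v. Q v \<le> norm v" "Q (- w) \<le> - norm w"
    using sublinear_tilt[OF sublinear_norm[where 'a = 'a], of w] by blast
  obtain f :: "'a \<Rightarrow>\<^sub>L real" where f: "\<And>v. blinfun_apply f v \<le> Q v" "norm f \<le> 1"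
    using exists_blinfun_below[OF Q(1), of 1] Q(2) by auto
  have "norm w \<le> blinfun_apply f w"
    using f(1)[of "- w"] Q(3) by (simp add: blinfun.minus_right)
  moreover have "blinfun_apply f w \<le> norm w"
    using order_trans[OF f(1) Q(2)] .
  ultimately show ?thesis using f(2) by auto
qed

lemma blinfun_separates:
  fixes u v :: "'a::real_normed_vector"
  assumes "\<And>f :: 'a \<Rightarrow>\<^sub>L real. blinfun_apply f u = blinfun_apply f v"
  shows "u = v"
proof -
  obtain f :: "'a \<Rightarrow>\<^sub>L real" where "blinfun_apply f (u - v) = norm (u - v)"
    using exists_norming_functional by blast
  then show ?thesis using assms[of f] by (simp add: blinfun.diff_right)
qed

section \<open>Duality mappings\<close>

lemma modulus_of_smoothness_upper:
  fixes x h :: "'a::real_normed_vector"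
  assumes "norm x = 1" and "norm h \<le> t"
  shows "norm (x + h) + norm (x - h) \<le> 2 + 2 * modulus_of_smoothness TYPE('a) t"
proof -
  let ?S = "{(norm (x + y) + norm (x - y)) / 2 - 1 | x y :: 'a. norm x = 1 \<and> norm y \<le> t}"
  \<comment> \<open>A real \<open>Sup\<close> says something only about a bounded set; here the
    triangle inequality supplies the bound \<open>t\<close>.\<close>
  have "bdd_above (insert 0 ?S)"
  proof (rule bdd_aboveI[of _ t])
    fix r assume "r \<in> insert 0 ?S"
    moreover have "0 \<le> t" using assms(2) norm_ge_zero order_trans by blast
    moreover have "(norm (x + y) + norm (x - y)) / 2 - 1 \<le> t" if "norm x = 1" "norm y \<le> t" for x y :: 'a
      using norm_triangle_ineq[of x y] norm_triangle_ineq4[of x y] that by (simp add: field_simps)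
    ultimately show "r \<le> t" by auto
  qed
  then have "(norm (x + h) + norm (x - h)) / 2 - 1 \<le> modulus_of_smoothness TYPE('a) t"
    unfolding modulus_of_smoothness_def by (rule cSup_upper[rotated]) (use assms in auto)
  then show ?thesis by (simp add: field_simps)
qed

text \<open>Evaluate \<open>f\<close> at \<open>x + h\<close> and \<open>g\<close> at
  \<open>x - h\<close>. The sum is at most \<open>norm (x + h) + norm (x - h)\<close>, which the
  modulus bounds, and what is left over is \<open>(f - g) h\<close> and the defect
  \<open>g (y - x)\<close>. With \<open>x = y\<close> this gives uniqueness of norming functionals,
  in general their continuity in the point.\<close>

lemma norming_functional_dist:
  fixes x y :: "'a::real_normed_vector"
  assumes "norm x = 1" "norm y = 1" and "norm f \<le> 1" "blinfun_apply f x = 1"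
    and "norm g \<le> 1" "blinfun_apply g y = 1" and t: "t > 0"
  shows "norm (f - g :: 'a \<Rightarrow>\<^sub>L real) \<le> (norm (x - y) + 2 * modulus_of_smoothness TYPE('a) t) / t"
    (is "_ \<le> ?B / t")
proof -
  have app_le: "blinfun_apply k v \<le> norm v" if "norm k \<le> 1" for k :: "'a \<Rightarrow>\<^sub>L real" and v
    using norm_blinfun[of k v] mult_right_mono[OF that norm_ge_zero[of v]] by simp
  have le: "blinfun_apply (f - g) h \<le> ?B" if "norm h \<le> t" for h
  proof -
    have "blinfun_apply f (x + h) + blinfun_apply g (x - h) \<le> norm (x + h) + norm (x - h)"
      using app_le[OF assms(3)] app_le[OF assms(5)] add_mono by blast
    also have "\<dots> \<le> 2 + 2 * modulus_of_smoothness TYPE('a) t"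
      using modulus_of_smoothness_upper[OF assms(1) that] .
    finally have "1 + blinfun_apply f h + blinfun_apply g x - blinfun_apply g h
        \<le> 2 + 2 * modulus_of_smoothness TYPE('a) t"
      using assms(4) by (simp add: blinfun.add_right blinfun.diff_right)
    moreover have "blinfun_apply g (y - x) \<le> norm (x - y)"
      using app_le[OF assms(5), of "y - x"] by (simp add: norm_minus_commute)
    ultimately show ?thesis using assms(6) by (simp add: blinfun.diff_left blinfun.diff_right)
  qed
  have B0: "0 \<le> ?B" using le[of 0] t by (simp add: blinfun.zero_right)
  show ?thesis
  proof (rule norm_blinfun_bound)
    show "0 \<le> ?B / t" using B0 t by simp
    fix v :: 'a
    show "norm (blinfun_apply (f - g) v) \<le> ?B / t * norm v"
    proof (cases "v = 0")
      case False
      then have n: "norm v > 0" by simp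
      let ?h = "(t / norm v) *\<^sub>R v"
      have h: "norm ?h \<le> t" using n t by simp
      have "blinfun_apply (f - g) ?h = t / norm v * blinfun_apply (f - g) v"
        by (simp add: blinfun.scaleR_right)
      moreover have "blinfun_apply (f - g) (- ?h) = - (t / norm v * blinfun_apply (f - g) v)"
        by (simp add: blinfun.scaleR_right blinfun.minus_right)
      ultimately have "\<bar>t / norm v * blinfun_apply (f - g) v\<bar> \<le> ?B"
        using le[OF h] le[of "- ?h"] h by (simp add: abs_le_iff)
      then have "t / norm v * \<bar>blinfun_apply (f - g) v\<bar> \<le> ?B"
        using n t by (simp add: abs_mult)
      then show ?thesis using n t by (simp add: field_simps)
    qed simp
  qed
qed

lemma uniformly_smooth_small:
  assumes "uniformly_smooth TYPE('a::real_normed_vector)" and "e > 0"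
  obtains t where "t > 0" and "2 * modulus_of_smoothness TYPE('a) t / t < e"
proof -
  have "((\<lambda>t. modulus_of_smoothness TYPE('a) t / t) \<longlongrightarrow> 0) (at_right 0)"
    using assms(1) by (simp add: uniformly_smooth_def)
  then have "eventually (\<lambda>t. modulus_of_smoothness TYPE('a) t / t < e / 2) (at_right 0)"
    by (rule order_tendstoD) (use assms(2) in simp)
  then have "eventually (\<lambda>t. modulus_of_smoothness TYPE('a) t / t < e / 2 \<and> t > 0) (at_right 0)"
    using eventually_at_right_less[of "0::real"] by (rule eventually_conj)
  then obtain t :: real where "modulus_of_smoothness TYPE('a) t / t < e / 2" "t > 0"
    using eventually_happens'[OF trivial_limit_at_right_real] by blast
  then show ?thesis using that[of t] by (simp add: mult.commute)
qed

lemma norming_functional_unique: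
  fixes x :: "'a::real_normed_vector"
  assumes us: "uniformly_smooth TYPE('a)" and "norm x = 1"
    and "norm f \<le> 1" "blinfun_apply f x = 1" and "norm g \<le> 1" "blinfun_apply g x = 1"
  shows "f = (g :: 'a \<Rightarrow>\<^sub>L real)"
proof (rule ccontr)
  assume "f \<noteq> g"
  then obtain t where "t > 0" "2 * modulus_of_smoothness TYPE('a) t / t < norm (f - g)"
    using uniformly_smooth_small[OF us, of "norm (f - g)"] by auto
  then show False using norming_functional_dist[OF assms(2,2,3,4,5,6), of t] by simp
qed

context
  fixes s :: real
  assumes us: "uniformly_smooth TYPE('a::real_normed_vector)" and s: "s > 1"
begin

text \<open>This justifies the \<open>THE\<close> in \<open>duality_map\<close>: for
  \<open>v \<noteq> 0\<close> a candidate divided by \<open>norm v powr (s - 1)\<close> is a norming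
  functional of the normalised \<open>v\<close>, and smoothness leaves only one of these.\<close>

lemma duality_map_characterization:
  fixes v :: 'a
  shows "norm (duality_map s v) = norm v powr (s - 1) \<and>
         blinfun_apply (duality_map s v) v = norm v powr s"
proof -
  let ?P = "\<lambda>j :: 'a \<Rightarrow>\<^sub>L real. norm j = norm v powr (s - 1) \<and> blinfun_apply j v = norm v powr s"
  have "\<exists>!j. ?P j"
  proof (cases "v = 0")
    case True
    then show ?thesis using s by (intro ex1I[of _ 0]) auto
  next
    case False
    then have n: "norm v > 0" by simp
    define c where "c = norm v powr (s - 1)"
    have c: "c > 0" using n by (simp add: c_def)
    have cs: "norm v powr s = c * norm v"
      using n by (simp add: c_def powr_diff)
    obtain f :: "'a \<Rightarrow>\<^sub>L real" where f: "norm f \<le> 1" "blinfun_apply f v = norm v"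
      using exists_norming_functional by blast
    have "norm v \<le> norm f * norm v" using norm_blinfun[of f v] f(2) by simp
    then have f1: "norm f = 1" using f(1) n by simp
    show ?thesis
    proof (rule ex1I[of _ "c *\<^sub>R f"])
      show "?P (c *\<^sub>R f)" using f1 f(2) c cs by (simp add: c_def scaleR_blinfun.rep_eq)
    next
      fix j assume j: "?P j"
      let ?x = "(1 / norm v) *\<^sub>R v"
      have "(1 / c) *\<^sub>R j = f"
      proof (rule norming_functional_unique[OF us, of ?x])
        show "norm ((1 / c) *\<^sub>R j) \<le> 1" using j c by (simp add: c_def)
        show "blinfun_apply ((1 / c) *\<^sub>R j) ?x = 1"
          using j c cs n by (simp add: scaleR_blinfun.rep_eq blinfun.scaleR_right)
        show "blinfun_apply f ?x = 1" using f n by (simp add: blinfun.scaleR_right)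
      qed (use f n in auto)
      then show "j = c *\<^sub>R f" using c by auto
    qed
  qed
  then show ?thesis unfolding duality_map_def by (rule theI')
qed

lemma norm_duality_map: "norm (duality_map s (v::'a)) = norm v powr (s - 1)"
  and duality_map_self: "blinfun_apply (duality_map s (v::'a)) v = norm v powr s"
  using duality_map_characterization by auto

text \<open>Away from 0 the mapping is a continuous power of the norm times the norming functional
  of the normalised vector, so only the latter needs an argument. At 0 the normalisation breaks
  down; that limit is treated in \<open>tendsto_W\<close>.\<close>

lemma tendsto_duality_map:
  fixes v :: "'c \<Rightarrow> 'a"
  assumes v: "(v \<longlongrightarrow> l) Fl" and "l \<noteq> 0"
  shows "((\<lambda>k. duality_map s (v k)) \<longlongrightarrow> duality_map s l) Fl"
proof -
  define x where "x = (\<lambda>u::'a. (1 / norm u) *\<^sub>R u)"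
  define f where "f = (\<lambda>u::'a. (1 / norm u powr (s - 1)) *\<^sub>R duality_map s u)"
  have x1: "norm (x u) = 1" if "u \<noteq> 0" for u using that by (simp add: x_def)
  have f1: "norm (f u) \<le> 1" if "u \<noteq> 0" for u
    using that by (simp add: f_def norm_duality_map)
  have fx: "blinfun_apply (f u) (x u) = 1" if "u \<noteq> 0" for u
    using that by (simp add: f_def x_def scaleR_blinfun.rep_eq blinfun.scaleR_right duality_map_self
        powr_diff)
  have ev: "eventually (\<lambda>k. v k \<noteq> 0) Fl"
    using tendsto_imp_eventually_ne[OF v \<open>l \<noteq> 0\<close>] .
  have xl: "((\<lambda>k. x (v k)) \<longlongrightarrow> x l) Fl"
    unfolding x_def using \<open>l \<noteq> 0\<close> by (intro tendsto_intros v) auto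
  have fl: "((\<lambda>k. f (v k)) \<longlongrightarrow> f l) Fl"
  proof (rule tendstoI)
    fix e :: real assume e: "e > 0"
    \<comment> \<open>\<open>t\<close> is fixed first, by the modulus term alone; then the points
      have to be closer than a multiple of this \<open>t\<close>, since it divides their
      distance.\<close>
    obtain t where t: "t > 0" "2 * modulus_of_smoothness TYPE('a) t / t < e / 2"
      using uniformly_smooth_small[OF us, of "e / 2"] e by auto
    have "eventually (\<lambda>k. dist (x (v k)) (x l) < e / 2 * t) Fl"
      using tendstoD[OF xl, of "e / 2 * t"] e t by simp
    with ev show "eventually (\<lambda>k. dist (f (v k)) (f l) < e) Fl"
    proof eventually_elim
      case (elim k)
      have "norm (f (v k) - f l) \<le> (norm (x (v k) - x l) + 2 * modulus_of_smoothness TYPE('a) t) / t"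
        using norming_functional_dist[OF x1 x1 f1 fx f1 fx t(1)] elim(1) \<open>l \<noteq> 0\<close> by simp
      also have "\<dots> = norm (x (v k) - x l) / t + 2 * modulus_of_smoothness TYPE('a) t / t"
        by (simp add: add_divide_distrib)
      also have "\<dots> < e / 2 + e / 2"
        using elim(2) t by (intro add_strict_mono) (auto simp: dist_norm field_simps)
      finally show ?case by (simp add: dist_norm)
    qed
  qed
  have eq: "duality_map s u = norm u powr (s - 1) *\<^sub>R f u" if "u \<noteq> 0" for u
    using that by (simp add: f_def)
  have "((\<lambda>k. norm (v k) powr (s - 1) *\<^sub>R f (v k)) \<longlongrightarrow> norm l powr (s - 1) *\<^sub>R f l) Fl"
    using \<open>l \<noteq> 0\<close> by (intro tendsto_intros v fl) auto
  moreover have "eventually (\<lambda>k. norm (v k) powr (s - 1) *\<^sub>R f (v k) = duality_map s (v k)) Fl"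
    using ev by eventually_elim (simp add: eq)
  ultimately show ?thesis using eq[OF \<open>l \<noteq> 0\<close>] by (simp add: tendsto_cong)
qed

end

section \<open>Subgradients near almost minimizers\<close>

text \<open>\<open>S x\<close> collects the points that improve on \<open>x\<close> by at least
  \<open>e\<close> times their distance. Choosing nearly optimal points in these nested sets gives a
  Cauchy sequence, and its limit admits no further improvement. Lower semicontinuity enters as
  closedness of sublevel sets.\<close>

lemma ekeland_minimizer:
  fixes f :: "'a::complete_space \<Rightarrow> real"
  assumes "a \<in> A" and lb: "\<And>u. u \<in> A \<Longrightarrow> m \<le> f u" and e: "e > 0"
    and lsc: "\<And>u l c. u \<longlonglongrightarrow> l \<Longrightarrow> (\<And>n. u n \<in> A) \<Longrightarrow> (\<And>n. f (u n) \<le> c) \<Longrightarrow> l \<in> A \<and> f l \<le> c"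
  shows "\<exists>x\<in>A. \<forall>u\<in>A. f x \<le> f u + e * dist u x"
proof -
  define S where "S = (\<lambda>x. {u \<in> A. f u + e * dist u x \<le> f x})"
  have S_refl: "x \<in> S x" if "x \<in> A" for x using that by (simp add: S_def)
  have S_trans: "w \<in> S x" if "u \<in> S x" "w \<in> S u" for u w x
  proof -
    have "e * dist w x \<le> e * (dist w u + dist u x)"
      using e by (intro mult_left_mono dist_triangle) simp
    then have "e * dist w x \<le> e * dist w u + e * dist u x" by (simp only: distrib_left)
    then show ?thesis using that by (auto simp: S_def)
  qed
  have step: "\<exists>u. u \<in> A \<and> u \<in> S x \<and> (\<forall>w\<in>S x. f u \<le> f w + (1/2) ^ n)" if "x \<in> A" for x and n :: nat
  proof -
    have bdd: "bdd_below (f ` S x)" by (rule bdd_belowI2[of _ m]) (use lb in \<open>auto simp: S_def\<close>)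
    have lt: "Inf (f ` S x) < Inf (f ` S x) + (1/2) ^ n" by simp
    have ne: "f ` S x \<noteq> {}" using S_refl[OF that] by auto
    obtain b where "b \<in> f ` S x" "b < Inf (f ` S x) + (1/2) ^ n"
      using cInf_lessD[OF ne lt] by blast
    then obtain u where u: "u \<in> S x" "f u < Inf (f ` S x) + (1/2) ^ n" by blast
    have "Inf (f ` S x) \<le> f w" if "w \<in> S x" for w
      by (rule cInf_lower[OF _ bdd]) (use that in simp)
    then have "\<forall>w\<in>S x. f u \<le> f w + (1/2) ^ n" using u(2) by fastforce
    moreover have "u \<in> A" using u(1) by (simp add: S_def)
    ultimately show ?thesis using u(1) by blast
  qed
  obtain X where X: "\<And>n::nat. X n \<in> A"
    and XS: "\<And>n. X (Suc n) \<in> S (X n) \<and> (\<forall>w\<in>S (X n). f (X (Suc n)) \<le> f w + (1/2) ^ n)"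
  proof -
    have "\<exists>X. \<forall>n. X n \<in> A \<and> (X (Suc n) \<in> S (X n) \<and> (\<forall>w\<in>S (X n). f (X (Suc n)) \<le> f w + (1/2) ^ n))"
      by (rule dependent_nat_choice) (use assms(1) step in auto)
    then show ?thesis using that by blast
  qed
  have nest: "X (n + k) \<in> S (X n)" for n k
    by (induction k) (use S_refl[OF X] XS S_trans in auto)
  have near: "e * dist (X k) (X n) \<le> f (X n) - f (X k)" if "n \<le> k" for n k
    using nest[of n "k - n"] that by (simp add: S_def)
  have "decseq (\<lambda>n. f (X n))"
  proof (rule decseq_SucI)
    fix n show "f (X (Suc n)) \<le> f (X n)"
      using near[of n "Suc n"] mult_nonneg_nonneg[OF less_imp_le[OF e] zero_le_dist[of "X (Suc n)" "X n"]] by simp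
  qed
  then have "convergent (\<lambda>n. f (X n))"
    by (rule decseq_convergent[of _ m]) (use lb[OF X] in \<open>auto simp: convergent_def\<close>)
  then have cf: "Cauchy (\<lambda>n. f (X n))" by (rule convergent_Cauchy)
  have "Cauchy X"
  proof (rule CauchyI')
    fix r :: real assume "r > 0"
    then obtain N where N: "\<And>n k. n \<ge> N \<Longrightarrow> k \<ge> N \<Longrightarrow> dist (f (X n)) (f (X k)) < e * r"
      using metric_CauchyD[OF cf, of "e * r"] e by auto
    have "dist (X n) (X k) < r" if "n \<ge> N" "n < k" for n k
    proof -
      have "e * dist (X k) (X n) < e * r"
        using near[of n k] N[of n k] that by (auto simp: dist_real_def)
      then show ?thesis using e by (simp add: dist_commute)
    qed
    then show "\<exists>M. \<forall>m\<ge>M. \<forall>n>m. dist (X m) (X n) < r" by blast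
  qed
  then obtain x where x: "X \<longlonglongrightarrow> x" using Cauchy_convergent convergent_def by blast
  have xS: "x \<in> S (X n)" for n
  proof -
    \<comment> \<open>The slack \<open>r\<close> is needed because the distances from
      \<open>X n\<close> to later points only tend to the distance to \<open>x\<close>, while
      \<open>lsc\<close> wants a constant bound along the sequence.\<close>
    have *: "x \<in> A \<and> f x \<le> f (X n) - e * dist x (X n) + r" if "r > 0" for r
    proof -
      have "(\<lambda>k. e * dist (X k) (X n)) \<longlonglongrightarrow> e * dist x (X n)" by (intro tendsto_intros x)
      then have "eventually (\<lambda>k. e * dist x (X n) - r < e * dist (X k) (X n)) sequentially"
        by (rule order_tendstoD) (use that in simp)
      then obtain N where N: "\<And>k. k \<ge> N \<Longrightarrow> e * dist x (X n) - r < e * dist (X k) (X n)"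
        by (auto simp: eventually_sequentially)
      have "(\<lambda>k. X (k + (n + N))) \<longlonglongrightarrow> x" by (rule LIMSEQ_ignore_initial_segment[OF x])
      then show ?thesis
      proof (rule lsc)
        fix k
        show "f (X (k + (n + N))) \<le> f (X n) - e * dist x (X n) + r"
          using N[of "k + (n + N)"] near[of n "k + (n + N)"] by simp
      qed (rule X)
    qed
    then have "f x \<le> f (X n) - e * dist x (X n)" using field_le_epsilon by blast
    then show ?thesis using *[of 1] by (simp add: S_def)
  qed
  have "f x \<le> f u + e * dist u x" if u: "u \<in> A" for u
  proof (rule ccontr)
    assume neg: "\<not> ?thesis"
    \<comment> \<open>A point violating the claim lies in \<open>S x\<close>, hence by transitivity
      in every \<open>S (X n)\<close>. There it competes with the near minimizers, which forces
      \<open>f x \<le> f u\<close>.\<close>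
    then have uS: "u \<in> S (X n)" for n using S_trans[OF xS, of u n] u by (simp add: S_def)
    have "f x \<le> f u + (1/2) ^ n" for n
    proof -
      have "f x \<le> f (X (Suc n))" using xS[of "Suc n"] mult_nonneg_nonneg[OF less_imp_le[OF e] zero_le_dist[of x "X (Suc n)"]] by (simp add: S_def)
      also have "\<dots> \<le> f u + (1/2) ^ n" using XS uS by blast
      finally show ?thesis .
    qed
    moreover have "(\<lambda>n. f u + (1/2::real) ^ n) \<longlonglongrightarrow> f u + 0"
      by (intro tendsto_intros LIMSEQ_power_zero) auto
    ultimately have "f x \<le> f u + 0" by (intro LIMSEQ_le_const) auto
    then show False using neg mult_nonneg_nonneg[OF less_imp_le[OF e] zero_le_dist[of u x]] by simp
  qed
  moreover have "x \<in> A" using xS[of 0] by (simp add: S_def)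
  ultimately show ?thesis by blast
qed

text \<open>\<open>P\<close> is the infimal convolution of the cone of increments of
  \<open>f\<close> at \<open>x\<close> with \<open>e * norm\<close>. A linear functional below it
  has norm at most \<open>e\<close> (take \<open>u = x\<close>) and is a subgradient (take
  \<open>t = 1\<close>, \<open>v = u - x\<close>). The minimality of \<open>x\<close> is what keeps
  \<open>P\<close> above \<open>- e * norm\<close>, hence finite.\<close>

lemma small_subgradient:
  fixes f :: "'a::real_normed_vector \<Rightarrow> real"
  assumes f: "convex_on A f" and x: "x \<in> A" and e: "e \<ge> 0"
    and min: "\<And>u. u \<in> A \<Longrightarrow> f x \<le> f u + e * norm (u - x)"
  obtains \<phi> :: "'a \<Rightarrow>\<^sub>L real" where "norm \<phi> \<le> e" and "\<And>u. u \<in> A \<Longrightarrow> f x + blinfun_apply \<phi> (u - x) \<le> f u"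
proof -
  have conv: "f (a *\<^sub>R u + b *\<^sub>R w) \<le> a * f u + b * f w"
    if "u \<in> A" "w \<in> A" "0 \<le> a" "0 \<le> b" "a + b = 1" for u w a b
    using f that by (simp add: convex_on_def)
  define T where "T = {(t::real, u). t > 0 \<and> u \<in> A}"
  define G where "G = (\<lambda>v (t, u). t * (f u - f x) + e * norm (v - t *\<^sub>R (u - x)))"
  define P where "P = (\<lambda>v. INF r\<in>T. G v r)"
  have low: "- (e * norm v) \<le> G v r" if rT: "r \<in> T" for v r
  proof -
    obtain t u where r: "r = (t, u)" "t > 0" "u \<in> A" using rT unfolding T_def by blast
    have "t * (f x - f u) \<le> t * (e * norm (u - x))"
      using min[OF r(3)] r(2) by (intro mult_left_mono) auto
    moreover have "e * norm (t *\<^sub>R (u - x)) \<le> e * (norm v + norm (v - t *\<^sub>R (u - x)))"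
      using e norm_triangle_ineq4[of v "v - t *\<^sub>R (u - x)"] by (intro mult_left_mono) auto
    moreover have "norm (t *\<^sub>R (u - x)) = t * norm (u - x)" using r(2) by simp
    ultimately show ?thesis using r(1) unfolding G_def by (simp only: prod.case) (simp add: algebra_simps)
  qed
  have bdd: "bdd_below (G v ` T)" for v
    by (rule bdd_belowI2[of _ "- (e * norm v)"]) (rule low)
  have ne: "T \<noteq> {}" using x by (auto simp: T_def intro!: exI[of _ 1])
  have upper: "P v \<le> G v (t, u)" if "t > 0" "u \<in> A" for v t u
    unfolding P_def by (rule cINF_lower[OF bdd]) (use that in \<open>simp add: T_def\<close>)
  have lower: "c \<le> P v" if "\<And>t u. t > 0 \<Longrightarrow> u \<in> A \<Longrightarrow> c \<le> G v (t, u)" for c v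
    unfolding P_def by (rule cINF_greatest[OF ne]) (use that in \<open>auto simp: T_def\<close>)
  have Pe: "P v \<le> e * norm v" for v using upper[of 1 x v] x by (simp add: G_def)
  have "sublinear P"
  proof (rule sublinearI)
    fix v w
    have 1: "P (v + w) \<le> G v (a, u) + G w (b, u')"
      if ab: "a > 0" "b > 0" and uu: "u \<in> A" "u' \<in> A" for a b u u'
    proof -
      \<comment> \<open>The average with weights \<open>a\<close> and \<open>b\<close> makes the
        cone directions add up: \<open>(a + b) *\<^sub>R (c - x)\<close> is the sum of
        \<open>a *\<^sub>R (u - x)\<close> and \<open>b *\<^sub>R (u' - x)\<close>.\<close>
      define c where "c = (a / (a + b)) *\<^sub>R u + (b / (a + b)) *\<^sub>R u'"
      have s1: "a / (a + b) + b / (a + b) = 1" using ab by (simp flip: add_divide_distrib)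
      have cA: "c \<in> A" unfolding c_def
        using f uu ab s1 by (intro convexD) (auto simp: convex_on_def)
      have "f c \<le> a / (a + b) * f u + b / (a + b) * f u'"
        unfolding c_def by (rule conv[OF uu _ _ s1]) (use ab in auto)
      then have "f c \<le> (a * f u + b * f u') / (a + b)" by (simp add: add_divide_distrib)
      then have fc: "(a + b) * f c \<le> a * f u + b * f u'"
        using ab by (simp add: pos_le_divide_eq mult.commute)
      have "(a + b) *\<^sub>R c = a *\<^sub>R u + b *\<^sub>R u'"
        using ab by (simp add: c_def scaleR_add_right)
      then have "v + w - (a + b) *\<^sub>R (c - x) = (v - a *\<^sub>R (u - x)) + (w - b *\<^sub>R (u' - x))"
        by (simp add: algebra_simps)
      then have "norm (v + w - (a + b) *\<^sub>R (c - x)) \<le> norm (v - a *\<^sub>R (u - x)) + norm (w - b *\<^sub>R (u' - x))"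
        by (metis norm_triangle_ineq)
      then have "e * norm (v + w - (a + b) *\<^sub>R (c - x))
          \<le> e * norm (v - a *\<^sub>R (u - x)) + e * norm (w - b *\<^sub>R (u' - x))"
        using e by (simp flip: distrib_left add: mult_left_mono)
      then have "G (v + w) (a + b, c) \<le> G v (a, u) + G w (b, u')"
        using fc by (simp add: G_def algebra_simps)
      then show ?thesis using upper[of "a + b" c "v + w"] ab cA by simp
    qed
    have "P (v + w) - G w (b, u') \<le> P v" if "b > 0" "u' \<in> A" for b u'
      by (rule lower) (use 1 that in \<open>smt (verit)\<close>)
    then have "P (v + w) - P v \<le> P w" by (intro lower) (smt (verit))
    then show "P (v + w) \<le> P v + P w" by simp
  next
    fix v :: 'a
    have "0 \<le> P 0" using low[of _ 0] by (intro lower) (auto simp: T_def)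
    then show "P (0 *\<^sub>R v) = 0" using Pe[of 0] by simp
  next
    fix t :: real and v :: 'a
    assume t: "t > 0"
    have "P (t *\<^sub>R v) / t \<le> P v"
    proof (rule lower)
      fix a u assume a: "(a::real) > 0" "u \<in> A"
      have "norm (t *\<^sub>R v - (t * a) *\<^sub>R (u - x)) = t * norm (v - a *\<^sub>R (u - x))"
        using t by (simp flip: scaleR_scaleR scaleR_diff_right)
      then have "P (t *\<^sub>R v) \<le> t * G v (a, u)"
        using upper[of "t * a" u "t *\<^sub>R v"] a t by (simp add: G_def algebra_simps)
      then show "P (t *\<^sub>R v) / t \<le> G v (a, u)" using t by (simp add: field_simps)
    qed
    then show "P (t *\<^sub>R v) \<le> t * P v" using t by (simp add: field_simps)
  qed
  then obtain \<phi> :: "'a \<Rightarrow>\<^sub>L real" where \<phi>: "\<And>v. blinfun_apply \<phi> v \<le> P v" "norm \<phi> \<le> e"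
    using exists_blinfun_below[of P e] Pe e by blast
  have "f x + blinfun_apply \<phi> (u - x) \<le> f u" if "u \<in> A" for u
    using \<phi>(1)[of "u - x"] upper[of 1 u "u - x"] that by (simp add: G_def)
  then show ?thesis using that \<phi>(2) by blast
qed

section \<open>The conjugate of a p-convex functional\<close>

locale p_convex_functional =
  fixes \<Theta> :: "'a::banach \<Rightarrow> ereal" and p ps c\<^sub>0 :: real and x\<^sub>0 :: 'a and \<xi>\<^sub>0 :: "'a \<Rightarrow>\<^sub>L real"
  assumes p: "p \<ge> 2" and ps: "ps = p / (p - 1)" and c0: "c\<^sub>0 > 0"
    and proper: "proper_fun \<Theta>" and conv: "convex_fun \<Theta>" and wlsc: "weakly_lsc \<Theta>"
    and pconv: "p_convex \<Theta> p c\<^sub>0" and xi0: "\<xi>\<^sub>0 \<in> subdifferential \<Theta> x\<^sub>0"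
begin

text \<open>Real arithmetic replaces \<open>ereal\<close> on the effective domain. Outside it
  \<open>\<theta>\<close> takes the default value 0, so facts about \<open>\<theta>\<close> carry
  membership in \<open>dom\<Theta>\<close>.\<close>

definition \<theta> :: "'a \<Rightarrow> real" where "\<theta> u = real_of_ereal (\<Theta> u)"
definition dom\<Theta> :: "'a set" where "dom\<Theta> = {u. \<Theta> u < \<infinity>}"

lemma ps_facts: "ps > 1" "ps \<le> 2" "1 / (p - 1) = ps - 1" "p * (ps - 1) = ps" "(p - 1) * (ps - 1) = 1"
  "(p - 1) * ps = p"
  using p by (auto simp: ps field_simps)

lemma \<Theta>_real: "u \<in> dom\<Theta> \<Longrightarrow> \<Theta> u = ereal (\<theta> u)"
  using proper unfolding proper_fun_def dom\<Theta>_def \<theta>_def by (cases "\<Theta> u") auto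

lemma \<Theta>_top: "u \<notin> dom\<Theta> \<Longrightarrow> \<Theta> u = \<infinity>"
  by (simp add: dom\<Theta>_def)

lemma subdifferential_iff:
  "\<xi> \<in> subdifferential \<Theta> u \<longleftrightarrow> u \<in> dom\<Theta> \<and> (\<forall>a\<in>dom\<Theta>. \<theta> u + blinfun_apply \<xi> (a - u) \<le> \<theta> a)"
    (is "?L \<longleftrightarrow> ?R")
proof
  assume L: ?L
  obtain a where a: "a \<in> dom\<Theta>" using proper by (auto simp: proper_fun_def dom\<Theta>_def)
  then have "\<Theta> u + ereal (blinfun_apply \<xi> (a - u)) < \<infinity>"
    using L \<Theta>_real[OF a] by (auto simp: subdifferential_def intro: le_less_trans)
  then have u: "u \<in> dom\<Theta>" by (cases "\<Theta> u") (auto simp: dom\<Theta>_def)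
  have "\<theta> u + blinfun_apply \<xi> (a - u) \<le> \<theta> a" if "a \<in> dom\<Theta>" for a
  proof -
    have "\<Theta> u + ereal (blinfun_apply \<xi> (a - u)) \<le> \<Theta> a" using L by (simp add: subdifferential_def)
    then show ?thesis using \<Theta>_real[OF that] \<Theta>_real[OF u] by simp
  qed
  then show ?R using u by blast
next
  assume R: ?R
  have "\<Theta> u + ereal (blinfun_apply \<xi> (a - u)) \<le> \<Theta> a" for a
    using R \<Theta>_real[of u] \<Theta>_real[of a] \<Theta>_top[of a] by (cases "a \<in> dom\<Theta>") auto
  then show ?L by (simp add: subdifferential_def)
qed

lemma bregman_real:
  assumes "a \<in> dom\<Theta>" "u \<in> dom\<Theta>"
  shows "bregman \<Theta> \<xi> a u = ereal (\<theta> a - \<theta> u - blinfun_apply \<xi> (a - u))"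
  using \<Theta>_real[OF assms(1)] \<Theta>_real[OF assms(2)] by (simp add: bregman_def)

lemma bregman_lower:
  assumes "\<xi> \<in> subdifferential \<Theta> u" "a \<in> dom\<Theta>"
  shows "c\<^sub>0 * norm (a - u) powr p \<le> \<theta> a - \<theta> u - blinfun_apply \<xi> (a - u)"
proof -
  have "ereal (c\<^sub>0 * norm (a - u) powr p) \<le> bregman \<Theta> \<xi> a u"
    using pconv assms(1) by (simp add: p_convex_def)
  then show ?thesis using bregman_real[OF assms(2), of u \<xi>] assms(1)[unfolded subdifferential_iff] by simp
qed

text \<open>Norm convergence implies weak convergence, so weak lower semicontinuity applies to the
  strongly convergent sequences that occur here.\<close>

lemma lsc:
  assumes "u \<longlonglongrightarrow> l" and "eventually (\<lambda>n. u n \<in> dom\<Theta> \<and> \<theta> (u n) \<le> c) sequentially"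
  shows "l \<in> dom\<Theta> \<and> \<theta> l \<le> c"
proof -
  have "weakly_conv u l" unfolding weakly_conv_def
    using assms(1) by (auto intro: blinfun.tendsto)
  then have "\<Theta> l \<le> liminf (\<lambda>n. \<Theta> (u n))" using wlsc by (simp add: weakly_lsc_def)
  also have "\<dots> \<le> ereal c"
  proof -
    have "eventually (\<lambda>n. \<Theta> (u n) \<le> ereal c) sequentially"
      using assms(2) by eventually_elim (simp add: \<Theta>_real)
    then have "liminf (\<lambda>n. \<Theta> (u n)) \<le> liminf (\<lambda>n. ereal c)" by (rule Liminf_mono)
    then show ?thesis by (simp add: Liminf_const)
  qed
  finally have le: "\<Theta> l \<le> ereal c" .
  then have "l \<in> dom\<Theta>" by (auto simp: dom\<Theta>_def intro: le_less_trans)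
  then show ?thesis using le \<Theta>_real by simp
qed

lemma convex_on_\<theta>: "convex_on dom\<Theta> \<theta>"
proof -
  have *: "u *\<^sub>R a + v *\<^sub>R b \<in> dom\<Theta> \<and> \<theta> (u *\<^sub>R a + v *\<^sub>R b) \<le> u * \<theta> a + v * \<theta> b"
    if ab: "a \<in> dom\<Theta>" "b \<in> dom\<Theta>" and uv: "u \<ge> 0" "v \<ge> 0" "u + v = 1" for a b u v
  proof (cases "u = 0 \<or> v = 0")
    case True
    then show ?thesis using uv ab by auto
  next
    case False
    then have v: "0 < v" "v < 1" "u = 1 - v" using uv by auto
    then have "\<Theta> (u *\<^sub>R a + v *\<^sub>R b) \<le> ereal u * \<Theta> a + ereal v * \<Theta> b"
      using conv unfolding convex_fun_def by blast
    then have le: "\<Theta> (u *\<^sub>R a + v *\<^sub>R b) \<le> ereal (u * \<theta> a + v * \<theta> b)"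
      using \<Theta>_real ab by simp
    then have "u *\<^sub>R a + v *\<^sub>R b \<in> dom\<Theta>" by (auto simp: dom\<Theta>_def intro: le_less_trans)
    then show ?thesis using le \<Theta>_real by simp
  qed
  then show ?thesis by (auto simp: convex_on_def convex_def)
qed

text \<open>Adding the two p-convexity inequalities cancels the values of \<open>\<theta>\<close>
  and leaves strong monotonicity, \<open>2 * c\<^sub>0 * norm (u - u') powr p\<close> on the left.
  Dividing by the distance gives the Hoelder exponent \<open>1 / (p - 1) = ps - 1\<close>; equal
  functionals force equal points.\<close>

lemma subgradient_dist:
  assumes "\<xi> \<in> subdifferential \<Theta> u" "\<xi>' \<in> subdifferential \<Theta> u'"
  shows "norm (u - u') \<le> (norm (\<xi> - \<xi>') / (2 * c\<^sub>0)) powr (ps - 1)"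
proof (cases "u = u'")
  case False
  then have n: "norm (u - u') > 0" by simp
  have "u \<in> dom\<Theta>" "u' \<in> dom\<Theta>" using assms by (auto simp: subdifferential_iff)
  then have "2 * c\<^sub>0 * norm (u - u') powr p \<le> blinfun_apply (\<xi> - \<xi>') (u - u')"
    using bregman_lower[OF assms(1), of u'] bregman_lower[OF assms(2), of u]
    by (simp add: norm_minus_commute blinfun.diff_left blinfun.diff_right)
  also have "\<dots> \<le> norm (\<xi> - \<xi>') * norm (u - u')"
    using norm_blinfun[of "\<xi> - \<xi>'" "u - u'"] by simp
  finally have "2 * c\<^sub>0 * (norm (u - u') powr (p - 1) * norm (u - u')) \<le> norm (\<xi> - \<xi>') * norm (u - u')"
    using n by (simp add: powr_diff)
  then have "norm (u - u') powr (p - 1) \<le> norm (\<xi> - \<xi>') / (2 * c\<^sub>0)"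
    using n c0 by (simp add: field_simps)
  then have "(norm (u - u') powr (p - 1)) powr (ps - 1) \<le> (norm (\<xi> - \<xi>') / (2 * c\<^sub>0)) powr (ps - 1)"
    by (rule powr_mono2[rotated 2]) (use ps_facts in auto)
  then show ?thesis using n by (simp add: powr_powr ps_facts)
qed simp

lemma ex_subgradient: "\<exists>u. \<xi> \<in> subdifferential \<Theta> u"
proof -
  define f where "f = (\<lambda>a. \<theta> a - blinfun_apply \<xi> a)"
  have x0: "x\<^sub>0 \<in> dom\<Theta>" using xi0 by (simp add: subdifferential_iff)
  define K where "K = norm (\<xi>\<^sub>0 - \<xi>)"
  \<comment> \<open>The functional \<open>\<xi>\<^sub>0\<close> gives growth of order
    \<open>p\<close>. Where the distance \<open>t\<close> is below 1 the linear term costs at most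
    \<open>K\<close>; beyond that \<open>t\<^sup>2 \<le> t powr p\<close>, and completing the square
    costs \<open>K\<^sup>2 / (4 * c\<^sub>0)\<close>.\<close>
  have lb: "f x\<^sub>0 - K - K\<^sup>2 / (4 * c\<^sub>0) \<le> f a" if "a \<in> dom\<Theta>" for a
  proof -
    define t where "t = norm (a - x\<^sub>0)"
    have "- K * t \<le> blinfun_apply (\<xi>\<^sub>0 - \<xi>) (a - x\<^sub>0)"
      using norm_blinfun[of "\<xi>\<^sub>0 - \<xi>" "a - x\<^sub>0"] by (simp add: K_def t_def)
    then have 1: "f x\<^sub>0 + (c\<^sub>0 * t powr p - K * t) \<le> f a"
      using bregman_lower[OF xi0 that]
      by (simp add: f_def t_def blinfun.diff_left blinfun.diff_right)
    have "- K - K\<^sup>2 / (4 * c\<^sub>0) \<le> c\<^sub>0 * t powr p - K * t"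
    proof (cases "t \<ge> 1")
      case True
      then have "t\<^sup>2 \<le> t powr p" using p powr_mono[of 2 p t] by (simp add: powr_numeral)
      then have "c\<^sub>0 * t\<^sup>2 \<le> c\<^sub>0 * t powr p" using c0 by simp
      moreover have "- (K\<^sup>2 / (4 * c\<^sub>0)) \<le> c\<^sub>0 * t\<^sup>2 - K * t"
      proof -
        have "0 \<le> (2 * c\<^sub>0 * t - K)\<^sup>2 / (4 * c\<^sub>0)" using c0 by simp
        also have "\<dots> = c\<^sub>0 * t\<^sup>2 - K * t + K\<^sup>2 / (4 * c\<^sub>0)"
          using c0 by (simp add: power2_eq_square field_simps)
        finally show ?thesis by simp
      qed
      moreover have "K \<ge> 0" by (simp add: K_def)
      ultimately show ?thesis by linarith
    next
      case False
      then have "K * t \<le> K * 1" by (intro mult_left_mono) (auto simp: K_def)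
      moreover have "0 \<le> c\<^sub>0 * t powr p" "0 \<le> K\<^sup>2 / (4 * c\<^sub>0)" using c0 by auto
      ultimately show ?thesis by linarith
    qed
    then show ?thesis using 1 by linarith
  qed
  have f_lsc: "l \<in> dom\<Theta> \<and> f l \<le> c"
    if u: "u \<longlonglongrightarrow> l" "\<And>n. u n \<in> dom\<Theta>" and le: "\<And>n. f (u n) \<le> c" for u l c
  proof -
    have *: "l \<in> dom\<Theta> \<and> \<theta> l \<le> c + blinfun_apply \<xi> l + e" if "e > 0" for e
    proof (rule lsc[OF u(1)])
      have "(\<lambda>n. blinfun_apply \<xi> (u n)) \<longlonglongrightarrow> blinfun_apply \<xi> l" using u(1) by (rule blinfun.tendsto[OF tendsto_const])
      then have "eventually (\<lambda>n. blinfun_apply \<xi> (u n) < blinfun_apply \<xi> l + e) sequentially"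
        by (rule order_tendstoD) (use that in simp)
      then show "eventually (\<lambda>n. u n \<in> dom\<Theta> \<and> \<theta> (u n) \<le> c + blinfun_apply \<xi> l + e) sequentially"
        by eventually_elim (use u(2) le in \<open>smt (verit) f_def\<close>)
    qed
    then have "\<theta> l \<le> c + blinfun_apply \<xi> l" using field_le_epsilon by blast
    then show ?thesis using *[of 1] by (simp add: f_def)
  qed
  have f_conv: "convex_on dom\<Theta> f"
    using convex_on_\<theta> unfolding convex_on_def f_def
    by (auto simp: blinfun.add_right blinfun.scaleR_right algebra_simps)
  have "\<exists>u \<phi>. \<phi> \<in> subdifferential \<Theta> u \<and> norm (\<phi> - \<xi>) \<le> 1 / real (Suc n)" for n
  proof -
    have e: "1 / real (Suc n) > 0" by simp
    have "\<exists>u\<in>dom\<Theta>. \<forall>a\<in>dom\<Theta>. f u \<le> f a + 1 / real (Suc n) * dist a u"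
      by (rule ekeland_minimizer[OF x0 lb e]) (use f_lsc in blast)+
    then obtain u where u: "u \<in> dom\<Theta>"
      "\<And>a. a \<in> dom\<Theta> \<Longrightarrow> f u \<le> f a + 1 / real (Suc n) * dist a u" by blast
    obtain \<phi> :: "'a \<Rightarrow>\<^sub>L real" where \<phi>: "norm \<phi> \<le> 1 / real (Suc n)"
      "\<And>a. a \<in> dom\<Theta> \<Longrightarrow> f u + blinfun_apply \<phi> (a - u) \<le> f a"
      using small_subgradient[OF f_conv u(1), of "1 / real (Suc n)"] u(2) by (auto simp: dist_norm)
    have "\<xi> + \<phi> \<in> subdifferential \<Theta> u"
      using u(1) \<phi>(2) by (auto simp: subdifferential_iff f_def blinfun.add_left blinfun.diff_right algebra_simps)
    then show ?thesis using \<phi>(1) by (intro exI[of _ u] exI[of _ "\<xi> + \<phi>"]) simp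
  qed
  then obtain U \<phi> where U: "\<And>n. \<phi> n \<in> subdifferential \<Theta> (U n)"
    and \<phi>: "\<And>n. norm (\<phi> n - \<xi>) \<le> 1 / real (Suc n)" by metis
  have \<phi>_lim: "\<phi> \<longlonglongrightarrow> \<xi>"
  proof (rule LIM_zero_cancel, rule Lim_null_comparison)
    show "eventually (\<lambda>n. norm (\<phi> n - \<xi>) \<le> inverse (real (Suc n))) sequentially"
      using \<phi> by (simp add: inverse_eq_divide)
  qed (rule LIMSEQ_inverse_real_of_nat)
  have "Cauchy U"
  proof (rule metric_CauchyI)
    fix e :: real assume e: "e > 0"
    \<comment> \<open>Chosen so that the Hoelder bound of \<open>subgradient_dist\<close> at
      \<open>r\<close> equals exactly \<open>e\<close>.\<close>
    define r where "r = 2 * c\<^sub>0 * e powr (p - 1)"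
    have r: "r > 0" using e c0 by (simp add: r_def)
    then obtain N where N: "\<And>m n. m \<ge> N \<Longrightarrow> n \<ge> N \<Longrightarrow> dist (\<phi> m) (\<phi> n) < r"
      using metric_CauchyD[OF LIMSEQ_imp_Cauchy[OF \<phi>_lim] r] by blast
    have "dist (U m) (U n) < e" if "m \<ge> N" "n \<ge> N" for m n
    proof -
      have "norm (U m - U n) \<le> (norm (\<phi> m - \<phi> n) / (2 * c\<^sub>0)) powr (ps - 1)"
        using subgradient_dist[OF U U] .
      also have "\<dots> < (r / (2 * c\<^sub>0)) powr (ps - 1)"
        by (rule powr_less_mono2) (use N[OF that] c0 ps_facts in \<open>auto simp: dist_norm divide_strict_right_mono\<close>)
      also have "\<dots> = e" using c0 e by (simp add: r_def powr_powr ps_facts)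
      finally show ?thesis by (simp add: dist_norm)
    qed
    then show "\<exists>M. \<forall>m\<ge>M. \<forall>n\<ge>M. dist (U m) (U n) < e" by blast
  qed
  then obtain u where u: "U \<longlonglongrightarrow> u" using Cauchy_convergent convergent_def by blast
  have *: "u \<in> dom\<Theta> \<and> \<theta> u \<le> \<theta> a - blinfun_apply \<xi> (a - u) + e" if a: "a \<in> dom\<Theta>" and e: "e > 0" for a e
  proof (rule lsc[OF u])
    have "(\<lambda>n. \<theta> a - blinfun_apply (\<phi> n) (a - U n)) \<longlonglongrightarrow> \<theta> a - blinfun_apply \<xi> (a - u)"
      by (intro tendsto_intros \<phi>_lim u blinfun.tendsto)
    then have "eventually (\<lambda>n. \<theta> a - blinfun_apply (\<phi> n) (a - U n) < \<theta> a - blinfun_apply \<xi> (a - u) + e) sequentially"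
      by (rule order_tendstoD) (use e in simp)
    then show "eventually (\<lambda>n. U n \<in> dom\<Theta> \<and> \<theta> (U n) \<le> \<theta> a - blinfun_apply \<xi> (a - u) + e) sequentially"
    proof eventually_elim
      case (elim n)
      have "U n \<in> dom\<Theta> \<and> \<theta> (U n) + blinfun_apply (\<phi> n) (a - U n) \<le> \<theta> a"
        using U[of n] a by (simp add: subdifferential_iff)
      then show ?case using elim by simp
    qed
  qed
  then have "\<theta> u \<le> \<theta> a - blinfun_apply \<xi> (a - u)" if "a \<in> dom\<Theta>" for a
    using that field_le_epsilon by blast
  moreover have "u \<in> dom\<Theta>" using *[OF x0, of 1] by simp
  ultimately have "\<xi> \<in> subdifferential \<Theta> u" by (simp add: subdifferential_iff le_diff_eq)
  then show ?thesis ..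
qed

section \<open>The conjugate, its gradient, and the Bregman distance in the dual variable\<close>

definition g :: "('a \<Rightarrow>\<^sub>L real) \<Rightarrow> 'a" where "g \<xi> = (SOME u. \<xi> \<in> subdifferential \<Theta> u)"
text \<open>\<open>g\<close> inverts the subdifferential map, and \<open>h\<close> is the conjugate
  evaluated where its supremum is attained; \<open>conjugate_eq\<close> and
  \<open>grad_conjugate_eq\<close> identify both with the defined objects.\<close>

definition h :: "('a \<Rightarrow>\<^sub>L real) \<Rightarrow> real" where "h \<xi> = blinfun_apply \<xi> (g \<xi>) - \<theta> (g \<xi>)"

lemma g_subgradient: "\<xi> \<in> subdifferential \<Theta> (g \<xi>)"
  unfolding g_def using ex_subgradient by (rule someI_ex)

lemma g_dom: "g \<xi> \<in> dom\<Theta>"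
  using g_subgradient by (simp add: subdifferential_iff)

lemma g_dist: "norm (g \<xi> - g \<xi>') \<le> (norm (\<xi> - \<xi>') / (2 * c\<^sub>0)) powr (ps - 1)"
  using subgradient_dist[OF g_subgradient g_subgradient] .

lemma g_unique: "\<xi> \<in> subdifferential \<Theta> u \<Longrightarrow> g \<xi> = u"
  using subgradient_dist[OF g_subgradient, of \<xi> u \<xi>] by simp

lemma h_ge: "a \<in> dom\<Theta> \<Longrightarrow> blinfun_apply \<xi> a - \<theta> a \<le> h \<xi>"
  using g_subgradient[of \<xi>] unfolding h_def subdifferential_iff by (auto simp: blinfun.diff_right)

lemma conjugate_eq: "conjugate \<Theta> \<xi> = ereal (h \<xi>)"
  unfolding conjugate_def
proof (rule SUP_eqI)
  fix a
  show "ereal (blinfun_apply \<xi> a) - \<Theta> a \<le> ereal (h \<xi>)"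
    using h_ge[of a \<xi>] \<Theta>_real[of a] \<Theta>_top[of a] by (cases "a \<in> dom\<Theta>") auto
next
  fix b assume "\<And>a. a \<in> UNIV \<Longrightarrow> ereal (blinfun_apply \<xi> a) - \<Theta> a \<le> b"
  from this[of "g \<xi>"] show "ereal (h \<xi>) \<le> b" by (simp add: \<Theta>_real[OF g_dom] h_def)
qed

lemma h_lower: "h \<xi> + blinfun_apply (\<xi>' - \<xi>) (g \<xi>) \<le> h \<xi>'"
  using h_ge[OF g_dom, of \<xi>' \<xi>] by (simp add: h_def[of \<xi>] blinfun.diff_left)

lemma tendsto_g:
  assumes "(u \<longlongrightarrow> l) Fl"
  shows "((\<lambda>k. g (u k)) \<longlongrightarrow> g l) Fl"
proof (rule LIM_zero_cancel, rule Lim_null_comparison)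
  show "eventually (\<lambda>k. norm (g (u k) - g l) \<le> (norm (u k - l) / (2 * c\<^sub>0)) powr (ps - 1)) Fl"
    using g_dist by simp
  have "((\<lambda>k. norm (u k - l) / (2 * c\<^sub>0)) \<longlongrightarrow> norm (l - l) / (2 * c\<^sub>0)) Fl"
    by (intro tendsto_intros assms) (use c0 in auto)
  then have "((\<lambda>k. norm (u k - l) / (2 * c\<^sub>0)) \<longlongrightarrow> 0) Fl" by simp
  then show "((\<lambda>k. (norm (u k - l) / (2 * c\<^sub>0)) powr (ps - 1)) \<longlongrightarrow> 0) Fl"
    by (rule tendsto_zero_powrI[OF _ tendsto_const]) (use ps_facts c0 in auto)
qed

text \<open>The subgradient inequality, used at both ends, traps the remainder between 0 and
  \<open>norm (\<phi> - \<xi>) * norm (g \<phi> - g \<xi>)\<close>, and \<open>g\<close> is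
  continuous.\<close>

lemma h_has_derivative: "(h has_derivative (\<lambda>\<phi>. blinfun_apply \<phi> (g \<xi>))) (at \<xi>)"
  unfolding has_derivative_at2
proof (intro conjI)
  show "bounded_linear (\<lambda>\<phi>. blinfun_apply \<phi> (g \<xi>))"
    by simp
  have "((\<lambda>\<phi>. norm (g \<phi> - g \<xi>)) \<longlongrightarrow> norm (g \<xi> - g \<xi>)) (at \<xi>)"
    by (intro tendsto_intros tendsto_g)
  then have lim: "((\<lambda>\<phi>. norm (g \<phi> - g \<xi>)) \<longlongrightarrow> 0) (at \<xi>)" by simp
  show "((\<lambda>\<phi>. (1 / norm (\<phi> - \<xi>)) *\<^sub>R (h \<phi> - (h \<xi> + blinfun_apply (\<phi> - \<xi>) (g \<xi>)))) \<longlongrightarrow> 0) (at \<xi>)"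
  proof (rule Lim_null_comparison[OF _ lim], rule always_eventually, rule allI)
    fix \<phi>
    have "h \<phi> - (h \<xi> + blinfun_apply (\<phi> - \<xi>) (g \<xi>)) \<le> blinfun_apply (\<phi> - \<xi>) (g \<phi> - g \<xi>)"
      using h_lower[of \<phi> \<xi>] by (simp add: blinfun.diff_left blinfun.diff_right)
    also have "\<dots> \<le> norm (\<phi> - \<xi>) * norm (g \<phi> - g \<xi>)"
      using norm_blinfun[of "\<phi> - \<xi>" "g \<phi> - g \<xi>"] by simp
    finally have "\<bar>h \<phi> - (h \<xi> + blinfun_apply (\<phi> - \<xi>) (g \<xi>))\<bar> \<le> norm (\<phi> - \<xi>) * norm (g \<phi> - g \<xi>)"
      using h_lower[of \<xi> \<phi>] by simp
    then show "norm ((1 / norm (\<phi> - \<xi>)) *\<^sub>R (h \<phi> - (h \<xi> + blinfun_apply (\<phi> - \<xi>) (g \<xi>)))) \<le> norm (g \<phi> - g \<xi>)"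
      by (cases "\<phi> = \<xi>") (auto simp: field_simps)
  qed
qed

lemma grad_conjugate_eq: "grad_conjugate \<Theta> \<xi> = g \<xi>"
proof -
  have eq: "(\<lambda>\<phi>. real_of_ereal (conjugate \<Theta> \<phi>)) = h" by (simp add: conjugate_eq fun_eq_iff)
  show ?thesis unfolding grad_conjugate_def eq
  proof (rule the_equality)
    fix u assume "(h has_derivative (\<lambda>\<phi>. blinfun_apply \<phi> u)) (at \<xi>)"
    then have "(\<lambda>\<phi> :: 'a \<Rightarrow>\<^sub>L real. blinfun_apply \<phi> u) = (\<lambda>\<phi>. blinfun_apply \<phi> (g \<xi>))"
      by (rule has_derivative_unique[OF _ h_has_derivative])
    from fun_cong[OF this] show "u = g \<xi>" by (rule blinfun_separates)
  qed (rule h_has_derivative)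
qed

text \<open>This is the Hoelder estimate for the gradient \<open>g\<close>, integrated along the
  segment from \<open>\<xi>\<close> to \<open>\<xi>'\<close>.\<close>

lemma h_upper:
  "h \<xi>' \<le> h \<xi> + blinfun_apply (\<xi>' - \<xi>) (g \<xi>) + norm (\<xi>' - \<xi>) powr ps / (ps * (2 * c\<^sub>0) powr (ps - 1))"
proof -
  define e where "e = \<xi>' - \<xi>"
  define K where "K = norm e powr ps / (ps * (2 * c\<^sub>0) powr (ps - 1))"
  \<comment> \<open>Instead of integrating, the gap between the two sides is shown to have
    nonpositive derivative. \<open>K\<close> is chosen so that the derivative of
    \<open>K * t powr ps\<close> is the Hoelder bound at
    \<open>\<xi> + t *\<^sub>R e\<close>.\<close>
  define f where "f = (\<lambda>t. h (\<xi> + t *\<^sub>R e) - t * blinfun_apply e (g \<xi>) - K * t powr ps)"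
  have hd: "((\<lambda>t. h (\<xi> + t *\<^sub>R e)) has_field_derivative blinfun_apply e (g (\<xi> + t *\<^sub>R e))) (at t within S)" for t S
  proof -
    have "((\<lambda>t. \<xi> + t *\<^sub>R e) has_derivative (\<lambda>t. t *\<^sub>R e)) (at t within S)"
      by (auto intro!: derivative_eq_intros)
    from has_derivative_compose[OF this h_has_derivative]
    show ?thesis unfolding has_field_derivative_def
      by (simp add: scaleR_blinfun.rep_eq mult.commute[of _ "blinfun_apply e _"])
  qed
  have deriv: "\<exists>d. (f has_field_derivative d) (at t) \<and> d \<le> 0" if t: "0 < t" "t < 1" for t
  proof -
    define d where "d = blinfun_apply e (g (\<xi> + t *\<^sub>R e)) - blinfun_apply e (g \<xi>) - K * (ps * t powr (ps - 1))"
    have "(f has_field_derivative d) (at t)"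
      unfolding f_def d_def using t by (auto intro!: derivative_eq_intros hd simp: field_simps)
    moreover have "d \<le> 0"
    proof -
      have "blinfun_apply e (g (\<xi> + t *\<^sub>R e) - g \<xi>) \<le> norm e * norm (g (\<xi> + t *\<^sub>R e) - g \<xi>)"
        using norm_blinfun[of e "g (\<xi> + t *\<^sub>R e) - g \<xi>"] by simp
      also have "\<dots> \<le> norm e * (t * norm e / (2 * c\<^sub>0)) powr (ps - 1)"
        using g_dist[of "\<xi> + t *\<^sub>R e" \<xi>] t by (intro mult_left_mono) auto
      also have "\<dots> = K * (ps * t powr (ps - 1))"
      proof (cases "e = 0")
        case False
        then have "norm e * norm e powr (ps - 1) = norm e powr ps" by (simp add: powr_diff)
        then show ?thesis using t c0 ps_facts
          by (simp add: K_def powr_mult powr_divide field_simps)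
      qed (simp add: K_def)
      finally show ?thesis by (simp add: d_def blinfun.diff_right)
    qed
    ultimately show ?thesis by blast
  qed
  have "continuous_on {0..1} f"
  proof -
    have "continuous_on {0..1} (\<lambda>t. h (\<xi> + t *\<^sub>R e))"
      using hd by (intro DERIV_continuous_on) auto
    then show ?thesis unfolding f_def
      by (intro continuous_intros continuous_on_powr') (use ps_facts in auto)
  qed
  then obtain l t where "0 < t" "t < 1" "DERIV f t :> l" "f 1 - f 0 = (1 - 0) * l"
    using MVT[of 0 1 f] deriv real_differentiable_def by (metis zero_less_one)
  then have "f 1 \<le> f 0" using deriv DERIV_unique by fastforce
  then show ?thesis using ps_facts by (simp add: f_def e_def K_def)
qed

lemma isCont_h: "isCont h \<xi>"
  using h_has_derivative has_derivative_continuous by blast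

text \<open>This is the Fenchel form of the Bregman distance: the base point \<open>g \<xi>\<close>
  is hidden in \<open>h\<close>, so continuity in \<open>\<xi>\<close> is immediate and differences
  in either argument are easy to expand.\<close>

definition D :: "'a \<Rightarrow> ('a \<Rightarrow>\<^sub>L real) \<Rightarrow> real" where
  "D a \<xi> = \<theta> a + h \<xi> - blinfun_apply \<xi> a"

lemma D_eq: "D a \<xi> = \<theta> a - \<theta> (g \<xi>) - blinfun_apply \<xi> (a - g \<xi>)"
  by (simp add: D_def h_def blinfun.diff_right)

lemma bregman_eq_D: "a \<in> dom\<Theta> \<Longrightarrow> bregman \<Theta> \<xi> a (g \<xi>) = ereal (D a \<xi>)"
  by (simp add: bregman_real[OF _ g_dom] D_eq)

lemma D_lower: "a \<in> dom\<Theta> \<Longrightarrow> c\<^sub>0 * norm (a - g \<xi>) powr p \<le> D a \<xi>"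
  using bregman_lower[OF g_subgradient] by (simp add: D_eq)

lemma D_nonneg: "a \<in> dom\<Theta> \<Longrightarrow> 0 \<le> D a \<xi>"
  by (rule order_trans[OF _ D_lower]) (use c0 in auto)

lemma tendsto_D: "(u \<longlongrightarrow> l) Fl \<Longrightarrow> ((\<lambda>k. D a (u k)) \<longlongrightarrow> D a l) Fl"
  unfolding D_def by (intro tendsto_intros isCont_tendsto_compose[OF isCont_h] blinfun.tendsto)

lemma g_x0: "g \<xi>\<^sub>0 = x\<^sub>0"
  by (rule g_unique[OF xi0])

end

section \<open>Monotonicity of the noisy iteration\<close>

text \<open>The truncated quotient becomes a single fraction whose denominator is never 0. This
  removes the infinite case and makes the step size visibly continuous where the residual is
  nonzero.\<close>

lemma real_of_ereal_min_quot:
  assumes "a > 0" "b \<ge> 0" "c > 0"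
  shows "real_of_ereal (min (quot a b) (ereal c)) = a / max b (a / c)"
proof (cases "b = 0")
  case True
  then show ?thesis using assms by (simp add: quot_def max_def)
next
  case False
  then have b: "b > 0" using assms by simp
  have "min (a / b) c = a / max b (a / c)"
  proof (cases "b \<le> a / c")
    case True
    then have "c \<le> a / b" using b assms by (simp add: field_simps)
    then show ?thesis using True assms by (simp add: max_absorb2)
  next
    case False
    then have "a / b \<le> c" using b assms by (simp add: field_simps)
    then show ?thesis using False by (simp add: max_absorb1)
  qed
  moreover have "real_of_ereal (min (quot a b) (ereal c)) = min (a / b) c"
    using b by (simp add: quot_def min_def)
  ultimately show ?thesis by simp
qed

locale tpg_problem = p_convex_functional \<Theta> p ps c\<^sub>0 x\<^sub>0 \<xi>\<^sub>0
  for \<Theta> :: "'a::banach \<Rightarrow> ereal" and p ps c\<^sub>0 :: real and x\<^sub>0 :: 'a and \<xi>\<^sub>0 :: "'a \<Rightarrow>\<^sub>L real" +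
  fixes F :: "'a \<Rightarrow> 'b::banach" and DF :: "'a set" and L :: "'a \<Rightarrow> 'a \<Rightarrow>\<^sub>L 'b"
    and y :: 'b and xdag :: 'a and \<rho> \<eta> C\<^sub>0 s \<tau> \<mu>\<^sub>0 \<mu>\<^sub>1 \<nu> \<alpha> c\<^sub>1 \<gamma>\<^sub>0 \<gamma>\<^sub>1 M :: real
    and q :: "nat \<Rightarrow> real" and jmax :: nat
  assumes us: "uniformly_smooth TYPE('b)"
    and rho: "\<rho> > 0" and ball: "cball x\<^sub>0 (3 * \<rho>) \<subseteq> DF"
    and L_cont: "continuous_on (cball x\<^sub>0 (3 * \<rho>)) L"
    and eta: "0 \<le> \<eta>" "\<eta> < 1"
    and tcc: "\<And>a b. a \<in> cball x\<^sub>0 (3 * \<rho>) \<Longrightarrow> b \<in> cball x\<^sub>0 (3 * \<rho>) \<Longrightarrow>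
           norm (F a - F b - blinfun_apply (L b) (a - b)) \<le> \<eta> * norm (F a - F b)"
    and C0: "C\<^sub>0 > 0" and L_bound: "\<And>a. a \<in> cball x\<^sub>0 (3 * \<rho>) \<Longrightarrow> norm (L a) \<le> C\<^sub>0"
    and xdag_dom: "xdag \<in> dom\<Theta>" and F_xdag: "F xdag = y"
    and xdag_le: "D xdag \<xi>\<^sub>0 \<le> c\<^sub>0 * \<rho> powr p"
    and xdag_min: "\<And>a. a \<in> dom\<Theta> \<Longrightarrow> a \<in> DF \<Longrightarrow> F a = y \<Longrightarrow> D xdag \<xi>\<^sub>0 \<le> D a \<xi>\<^sub>0"
    and s: "s > 1" and tau: "\<tau> > 1" and mu: "\<mu>\<^sub>0 > 0" "\<mu>\<^sub>1 > 0"
    and c1_def: "c\<^sub>1 = 1 - \<eta> - (1 + \<eta>) / \<tau> - 1 / ps * (\<mu>\<^sub>0 / (2 * c\<^sub>0)) powr (ps - 1)"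
    and c1: "c\<^sub>1 > 0" and nu: "\<nu> > 1" and alpha: "\<alpha> \<ge> 3" and jmax: "jmax \<ge> 1"
    and q: "\<And>k. q k \<ge> 0" "summable q"
    and gamma1: "\<gamma>\<^sub>1 = c\<^sub>1 * ps * (2 * c\<^sub>0) powr (ps - 1) / \<nu>"
    and M: "M = c\<^sub>1 / \<nu> * min (\<mu>\<^sub>0 / C\<^sub>0 powr p) \<mu>\<^sub>1"
    and gamma0: "\<gamma>\<^sub>0 = 1 / 2 * (2 * c\<^sub>0) powr (ps - 1) * ps * M * \<tau> powr p"
    and null: "\<And>a v. a \<in> cball x\<^sub>0 (3 * \<rho>) \<Longrightarrow> blinfun_apply (L xdag) v = 0 \<Longrightarrow> blinfun_apply (L a) v = 0"
begin

abbreviation B :: "'a set" where "B \<equiv> cball x\<^sub>0 (3 * \<rho>)"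
abbreviation \<Phi> :: "('a \<Rightarrow>\<^sub>L real) \<Rightarrow> real" where "\<Phi> \<equiv> D xdag"
abbreviation J :: "'b \<Rightarrow> 'b \<Rightarrow>\<^sub>L real" where "J \<equiv> duality_map s"

text \<open>\<open>K0\<close> is the denominator in \<open>h_upper\<close>, \<open>m\<close> a lower
  bound for the normalised step size \<open>\<sigma>\<close>, and \<open>\<kappa>\<close> the part
  of the decrease \<open>c\<^sub>1\<close> left after momentum has consumed the fraction
  \<open>1 / \<nu>\<close>.\<close>

definition K0 :: real where "K0 = ps * (2 * c\<^sub>0) powr (ps - 1)"
definition m :: real where "m = min (\<mu>\<^sub>0 / C\<^sub>0 powr p) \<mu>\<^sub>1"
definition \<kappa> :: real where "\<kappa> = (1 - 1 / \<nu>) * c\<^sub>1"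

lemma K0_pos: "K0 > 0" using ps_facts c0 by (simp add: K0_def)
lemma m_pos: "m > 0" using mu C0 by (simp add: m_def)
lemma \<kappa>_pos: "\<kappa> > 0" using nu c1 by (simp add: \<kappa>_def)
lemma \<gamma>1_K0: "\<gamma>\<^sub>1 = c\<^sub>1 / \<nu> * K0" by (simp add: gamma1 K0_def)
text \<open>The origin of \<open>\<gamma>\<^sub>0\<close>: while the residual exceeds
  \<open>\<tau> * \<delta>\<close>, the bound \<open>2 * \<gamma>\<^sub>0 * \<delta> powr p\<close>
  is at most \<open>\<gamma>\<^sub>1 * m * norm r powr p\<close>, so the fallback value of
  \<open>lam\<close> obeys the same inequality as an accepted trial.\<close>

lemma \<gamma>0_K0: "2 * \<gamma>\<^sub>0 = \<gamma>\<^sub>1 * m * \<tau> powr p" by (simp add: gamma0 M m_def \<gamma>1_K0 K0_def)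
lemma \<gamma>1_pos: "\<gamma>\<^sub>1 > 0" using K0_pos c1 nu by (simp add: \<gamma>1_K0)
lemma \<gamma>0_pos: "\<gamma>\<^sub>0 > 0" using \<gamma>0_K0 \<gamma>1_pos m_pos tau by (smt (verit) mult_pos_pos powr_gt_zero)

section \<open>Consequences of the tangential cone condition\<close>

lemma L_le:
  assumes "a \<in> B" "b \<in> B"
  shows "norm (blinfun_apply (L b) (a - b)) \<le> (1 + \<eta>) * norm (F a - F b)"
proof -
  have "norm (blinfun_apply (L b) (a - b))
      \<le> norm (F a - F b) + norm (F a - F b - blinfun_apply (L b) (a - b))"
    using norm_triangle_ineq4[of "F a - F b" "F a - F b - blinfun_apply (L b) (a - b)"] by simp
  then show ?thesis using tcc[OF assms] by (simp add: algebra_simps)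
qed

lemma F_lipschitz:
  assumes "a \<in> B" "b \<in> B"
  shows "norm (F a - F b) \<le> C\<^sub>0 / (1 - \<eta>) * norm (a - b)"
proof -
  have "norm (F a - F b)
      \<le> norm (blinfun_apply (L b) (a - b)) + norm (F a - F b - blinfun_apply (L b) (a - b))"
    using norm_triangle_ineq[of "blinfun_apply (L b) (a - b)" "F a - F b - blinfun_apply (L b) (a - b)"]
    by simp
  also have "\<dots> \<le> C\<^sub>0 * norm (a - b) + \<eta> * norm (F a - F b)"
  proof (rule add_mono[OF _ tcc[OF assms]])
    have "norm (blinfun_apply (L b) (a - b)) \<le> norm (L b) * norm (a - b)" by (rule norm_blinfun)
    also have "\<dots> \<le> C\<^sub>0 * norm (a - b)" using L_bound[OF assms(2)] by (rule mult_right_mono) simp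
    finally show "norm (blinfun_apply (L b) (a - b)) \<le> C\<^sub>0 * norm (a - b)" .
  qed
  finally show ?thesis using eta by (simp add: field_simps)
qed

lemma tendsto_F:
  assumes u: "(u \<longlongrightarrow> l) Fl" and uB: "eventually (\<lambda>k. u k \<in> B) Fl" and "l \<in> B"
  shows "((\<lambda>k. F (u k)) \<longlongrightarrow> F l) Fl"
proof (rule LIM_zero_cancel, rule Lim_null_comparison)
  show "eventually (\<lambda>k. norm (F (u k) - F l) \<le> C\<^sub>0 / (1 - \<eta>) * norm (u k - l)) Fl"
    using uB by eventually_elim (rule F_lipschitz[OF _ \<open>l \<in> B\<close>])
  have "((\<lambda>k. C\<^sub>0 / (1 - \<eta>) * norm (u k - l)) \<longlongrightarrow> C\<^sub>0 / (1 - \<eta>) * norm (l - l)) Fl"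
    by (intro tendsto_intros u)
  then show "((\<lambda>k. C\<^sub>0 / (1 - \<eta>) * norm (u k - l)) \<longlongrightarrow> 0) Fl" by simp
qed

lemma xdag_near: "norm (xdag - x\<^sub>0) \<le> \<rho>"
proof -
  have "c\<^sub>0 * norm (xdag - x\<^sub>0) powr p \<le> c\<^sub>0 * \<rho> powr p"
    using D_lower[OF xdag_dom, of \<xi>\<^sub>0] xdag_le by (simp add: g_x0)
  then have le: "norm (xdag - x\<^sub>0) powr p \<le> \<rho> powr p" using c0 by simp
  show ?thesis
  proof (rule ccontr)
    assume "\<not> ?thesis"
    then have "\<rho> powr p < norm (xdag - x\<^sub>0) powr p"
      using rho p by (intro powr_less_mono2) auto
    then show False using le by simp
  qed
qed

lemma xdag_B: "xdag \<in> B"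
  using xdag_near rho by (simp add: dist_norm norm_minus_commute)

text \<open>Since \<open>2 \<le> 2 powr p\<close>, the hypothesis puts \<open>g \<xi>\<close> within
  \<open>2 * \<rho>\<close> of \<open>xdag\<close>, which is within \<open>\<rho>\<close> of
  \<open>x\<^sub>0\<close>. Of the two copies of \<open>c\<^sub>0 * \<rho> powr p\<close>, one is
  for the iterate and one for the momentum.\<close>

lemma g_in_B:
  assumes "\<Phi> \<xi> \<le> 2 * (c\<^sub>0 * \<rho> powr p)"
  shows "g \<xi> \<in> B"
proof -
  have "c\<^sub>0 * norm (xdag - g \<xi>) powr p \<le> c\<^sub>0 * (2 * \<rho> powr p)"
    using D_lower[OF xdag_dom, of \<xi>] assms by simp
  then have "norm (xdag - g \<xi>) powr p \<le> 2 * \<rho> powr p" using c0 by simp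
  also have "\<dots> \<le> 2 powr p * \<rho> powr p"
    using p powr_mono[of 1 p 2] by (intro mult_right_mono) auto
  also have "\<dots> = (2 * \<rho>) powr p" using rho by (simp add: powr_mult)
  finally have le: "norm (xdag - g \<xi>) powr p \<le> (2 * \<rho>) powr p" .
  have "norm (xdag - g \<xi>) \<le> 2 * \<rho>"
  proof (rule ccontr)
    assume "\<not> ?thesis"
    then have "(2 * \<rho>) powr p < norm (xdag - g \<xi>) powr p"
      using rho p by (intro powr_less_mono2) auto
    then show False using le by simp
  qed
  then have "dist x\<^sub>0 (g \<xi>) \<le> \<rho> + 2 * \<rho>"
    using xdag_near norm_triangle_ineq[of "x\<^sub>0 - xdag" "xdag - g \<xi>"]
    by (simp add: dist_norm norm_minus_commute)
  then show ?thesis by simp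
qed

text \<open>A solution \<open>u\<close> differs from \<open>xdag\<close> by an element of the null space of \<open>L xdag\<close>, so
  replacing \<open>\<xi>\<close> by \<open>\<xi>\<^sub>0\<close> does not change the Bregman comparison of \<open>u\<close> and \<open>xdag\<close>.\<close>

lemma solution_D_le_0:
  assumes u: "g \<xi> \<in> B" "F (g \<xi>) = y"
    and ann: "\<And>v. blinfun_apply (L xdag) v = 0 \<Longrightarrow> blinfun_apply (\<xi> - \<xi>\<^sub>0) v = 0"
  shows "\<Phi> \<xi> \<le> 0"
proof -
  have "norm (blinfun_apply (L xdag) (g \<xi> - xdag)) \<le> 0"
    using L_le[OF u(1) xdag_B] u(2) F_xdag by simp
  then have "blinfun_apply (\<xi> - \<xi>\<^sub>0) (g \<xi> - xdag) = 0" by (intro ann) simp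
  then have "\<Phi> \<xi> = \<Phi> \<xi>\<^sub>0 - D (g \<xi>) \<xi>\<^sub>0"
    by (simp add: D_def h_def[of \<xi>] blinfun.diff_left blinfun.diff_right)
  moreover have "\<Phi> \<xi>\<^sub>0 \<le> D (g \<xi>) \<xi>\<^sub>0"
    using u ball g_dom by (intro xdag_min) auto
  ultimately show ?thesis by simp
qed

section \<open>Step sizes and the decrease in one step\<close>

definition \<sigma> :: "'b \<Rightarrow> 'a \<Rightarrow> real" where
  "\<sigma> r z = \<mu>\<^sub>0 * norm r powr (p * (s - 1)) /
     max (norm (J r o\<^sub>L L z) powr p) (\<mu>\<^sub>0 * norm r powr (p * (s - 1)) / \<mu>\<^sub>1)"

text \<open>The update is \<open>W r z o\<^sub>L L z\<close>. Step size and duality mapping are kept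
  together because the power of \<open>norm r\<close> in the step size may blow up at 0, while the
  product tends to 0 with \<open>r\<close>.\<close>

definition W :: "'b \<Rightarrow> 'a \<Rightarrow> 'b \<Rightarrow>\<^sub>L real" where
  "W r z = (\<sigma> r z * norm r powr (p - s)) *\<^sub>R J r"

lemma tpg_step_size_eq:
  assumes "norm (F z - v) > \<tau> * \<delta>" "\<delta> > 0"
  shows "tpg_step_size F L p s \<tau> \<mu>\<^sub>0 \<mu>\<^sub>1 \<delta> v z = \<sigma> (F z - v) z * norm (F z - v) powr (p - s)"
proof -
  have "0 < \<tau> * \<delta>" using tau assms(2) by simp
  then have "norm (F z - v) > 0" using assms(1) by linarith
  then show ?thesis
    using assms(1) mu unfolding tpg_step_size_def Let_def \<sigma>_def
    by (subst real_of_ereal_min_quot) auto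
qed

context
  fixes r :: 'b and z :: 'a
  assumes r: "r \<noteq> 0" and z: "z \<in> B"
begin

text \<open>The lower bound \<open>m\<close> holds because \<open>norm (J r o\<^sub>L L z)\<close>
  is at most \<open>C\<^sub>0 * norm r powr (s - 1)\<close>. The last bound is the purpose of the
  adaptive quotient; \<open>norm_W_L\<close> rests on it.\<close>

lemma \<sigma>_bounds:
  shows "0 \<le> \<sigma> r z" and "\<sigma> r z \<le> \<mu>\<^sub>1" and "m \<le> \<sigma> r z"
    and "\<sigma> r z * norm (J r o\<^sub>L L z) powr p \<le> \<mu>\<^sub>0 * norm r powr (p * (s - 1))"
proof -
  define a where "a = \<mu>\<^sub>0 * norm r powr (p * (s - 1))"
  define b where "b = norm (J r o\<^sub>L L z) powr p"
  have a: "a > 0" using r mu by (simp add: a_def)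
  have b: "b \<ge> 0" by (simp add: b_def)
  have sg: "\<sigma> r z = a / max b (a / \<mu>\<^sub>1)" by (simp add: \<sigma>_def a_def b_def)
  have mx: "max b (a / \<mu>\<^sub>1) > 0" using a mu by (simp add: less_max_iff_disj)
  show "0 \<le> \<sigma> r z" using a mx by (simp add: sg)
  have "a / max b (a / \<mu>\<^sub>1) \<le> a / (a / \<mu>\<^sub>1)"
    using a mu by (intro divide_left_mono) (auto simp: less_max_iff_disj)
  then show "\<sigma> r z \<le> \<mu>\<^sub>1" using a mu by (simp add: sg)
  have "\<sigma> r z * b \<le> \<sigma> r z * max b (a / \<mu>\<^sub>1)"
    using \<open>0 \<le> \<sigma> r z\<close> by (intro mult_left_mono) auto
  also have "\<dots> = a" using mx by (simp add: sg)
  finally show "\<sigma> r z * norm (J r o\<^sub>L L z) powr p \<le> \<mu>\<^sub>0 * norm r powr (p * (s - 1))"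
    by (simp add: a_def b_def)
  have "norm (J r o\<^sub>L L z) \<le> norm (J r) * norm (L z)" by (rule norm_blinfun_compose)
  also have "\<dots> \<le> norm r powr (s - 1) * C\<^sub>0"
    using L_bound[OF z] by (simp add: norm_duality_map[OF us s] mult_left_mono)
  finally have "b \<le> (norm r powr (s - 1) * C\<^sub>0) powr p"
    unfolding b_def using p by (intro powr_mono2) auto
  also have "\<dots> = norm r powr (p * (s - 1)) * C\<^sub>0 powr p"
    using C0 by (simp add: powr_mult powr_powr mult.commute)
  finally have bC: "b \<le> norm r powr (p * (s - 1)) * C\<^sub>0 powr p" .
  have "m * max b (a / \<mu>\<^sub>1) \<le> a"
  proof (cases "b \<le> a / \<mu>\<^sub>1")
    case True
    then have "m * max b (a / \<mu>\<^sub>1) = m * (a / \<mu>\<^sub>1)" by simp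
    also have "\<dots> \<le> \<mu>\<^sub>1 * (a / \<mu>\<^sub>1)"
      using a mu by (intro mult_right_mono) (auto simp: m_def)
    finally show ?thesis using mu by simp
  next
    case False
    then have "m * max b (a / \<mu>\<^sub>1) = m * b" by simp
    also have "\<dots> \<le> (\<mu>\<^sub>0 / C\<^sub>0 powr p) * (norm r powr (p * (s - 1)) * C\<^sub>0 powr p)"
      using bC b m_pos mu by (intro mult_mono) (auto simp: m_def)
    also have "\<dots> = a" using C0 by (simp add: a_def)
    finally show ?thesis .
  qed
  then show "m \<le> \<sigma> r z" using mx by (simp add: sg pos_le_divide_eq)
qed

lemma norm_W: "norm (W r z) * norm r = \<sigma> r z * norm r powr p"
proof -
  have "norm (W r z) * norm r
      = \<sigma> r z * (norm r powr (p - s) * norm r powr (s - 1) * norm r powr 1)"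
    using \<sigma>_bounds(1) r by (simp add: W_def norm_duality_map[OF us s])
  also have "norm r powr (p - s) * norm r powr (s - 1) * norm r powr 1
      = norm r powr (p - s + (s - 1) + 1)" by (simp only: powr_add)
  also have "\<dots> = norm r powr p" by simp
  finally show ?thesis .
qed

lemma W_bounds:
  shows "m * norm r powr p \<le> norm (W r z) * norm r"
    and "norm (W r z) * norm r \<le> \<mu>\<^sub>1 * norm r powr p"
  unfolding norm_W by (auto intro!: mult_right_mono \<sigma>_bounds)

text \<open>Since \<open>p * (ps - 1) = ps\<close>, the left side equals
  \<open>\<mu> * (\<mu> * \<beta> powr p) powr (ps - 1)\<close>. The quotient in the step size
  bounds the inner product, and \<open>(p - 1) * (ps - 1) = 1\<close> turns that bound into
  \<open>norm r powr s\<close>.\<close>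

lemma norm_W_L:
  "norm (W r z o\<^sub>L L z) powr ps \<le> \<mu>\<^sub>0 powr (ps - 1) * (norm (W r z) * norm r)"
proof -
  define \<beta> where "\<beta> = norm (J r o\<^sub>L L z)"
  define \<mu> where "\<mu> = \<sigma> r z * norm r powr (p - s)"
  have mu0: "\<mu> \<ge> 0" using \<sigma>_bounds(1) by (simp add: \<mu>_def)
  have \<beta>: "\<beta> \<ge> 0" by (simp add: \<beta>_def)
  have "W r z o\<^sub>L L z = \<mu> *\<^sub>R (J r o\<^sub>L L z)"
    by (rule blinfun_eqI) (simp add: W_def \<mu>_def scaleR_blinfun.rep_eq)
  then have eq: "norm (W r z o\<^sub>L L z) = \<mu> * \<beta>" using mu0 by (simp add: \<beta>_def)
  have WW: "norm (W r z) * norm r = \<mu> * norm r powr s"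
  proof -
    have "norm r powr (p - s) * norm r powr s = norm r powr p" by (simp flip: powr_add)
    then show ?thesis by (simp add: norm_W \<mu>_def)
  qed
  have "\<mu> powr ps * \<beta> powr ps = \<mu> * (\<mu> * \<beta> powr p) powr (ps - 1)"
  proof (cases "\<mu> = 0")
    case False
    then have "\<mu> powr ps = \<mu> * \<mu> powr (ps - 1)" using mu0 by (simp add: powr_diff)
    then show ?thesis using mu0 by (simp add: powr_mult powr_powr ps_facts)
  qed simp
  also have "\<dots> \<le> \<mu> * (\<mu>\<^sub>0 * norm r powr (s * (p - 1))) powr (ps - 1)"
  proof (intro mult_left_mono powr_mono2)
    have "\<mu> * \<beta> powr p = \<sigma> r z * \<beta> powr p * norm r powr (p - s)" by (simp add: \<mu>_def)
    also have "\<dots> \<le> \<mu>\<^sub>0 * norm r powr (p * (s - 1)) * norm r powr (p - s)"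
      using \<sigma>_bounds(4) by (intro mult_right_mono) (auto simp: \<beta>_def)
    also have "\<dots> = \<mu>\<^sub>0 * norm r powr (p * (s - 1) + (p - s))" by (simp add: powr_add)
    also have "p * (s - 1) + (p - s) = s * (p - 1)" by (simp add: algebra_simps)
    finally show "\<mu> * \<beta> powr p \<le> \<mu>\<^sub>0 * norm r powr (s * (p - 1))" .
  qed (use mu0 ps_facts in auto)
  also have "\<dots> = \<mu>\<^sub>0 powr (ps - 1) * (\<mu> * norm r powr s)"
    using mu by (simp add: powr_mult powr_powr ps_facts mult.assoc)
  finally show ?thesis using mu0 \<beta> by (simp add: eq WW powr_mult)
qed

end

text \<open>In \<open>h_upper\<close> for the increment \<open>- w\<close>, the remainder costs the
  last summand of \<open>c\<^sub>1\<close> by \<open>norm_W_L\<close>. The linear term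
  \<open>w (xdag - z)\<close> yields the other summands: the cone condition costs
  \<open>\<eta>\<close>, the noise, being below \<open>norm r / \<tau>\<close>, costs
  \<open>(1 + \<eta>) / \<tau>\<close>.\<close>

lemma gradient_step_decrease:
  assumes z: "g \<zeta> \<in> B" and v: "norm (v - y) \<le> \<delta>" "\<delta> > 0" and r: "norm (F (g \<zeta>) - v) > \<tau> * \<delta>"
  shows "\<Phi> (\<zeta> - (W (F (g \<zeta>) - v) (g \<zeta>) o\<^sub>L L (g \<zeta>)))
    \<le> \<Phi> \<zeta> - c\<^sub>1 * (norm (W (F (g \<zeta>) - v) (g \<zeta>)) * norm (F (g \<zeta>) - v))"
proof -
  define z where "z = g \<zeta>"
  define r where "r = F z - v"
  define w where "w = W r z o\<^sub>L L z"
  define \<mu> where "\<mu> = \<sigma> r z * norm r powr (p - s)"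
  define R where "R = norm r"
  have zB: "z \<in> B" using assms(1) by (simp add: z_def)
  have "0 < \<tau> * \<delta>" using tau v by simp
  then have R: "R > \<tau> * \<delta>" "R > 0" using assms(4) by (auto simp: r_def z_def R_def)
  then have r0: "r \<noteq> 0" by (auto simp: R_def)
  have mu0: "\<mu> \<ge> 0" using \<sigma>_bounds(1)[OF r0 zB] by (simp add: \<mu>_def)
  have a: "norm (W r z) * R = \<mu> * R powr s"
  proof -
    have "R powr (p - s) * R powr s = R powr p" by (simp flip: powr_add)
    then show ?thesis using norm_W[OF r0 zB] by (simp add: \<mu>_def R_def)
  qed
  have "\<Phi> (\<zeta> - w) - \<Phi> \<zeta> \<le> blinfun_apply w (xdag - z) + norm w powr ps / K0"
    using h_upper[of "\<zeta> - w" \<zeta>]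
    by (simp add: D_def K0_def z_def blinfun.diff_left blinfun.diff_right blinfun.minus_left)
  moreover have "norm w powr ps / K0 \<le> 1 / ps * (\<mu>\<^sub>0 / (2 * c\<^sub>0)) powr (ps - 1) * (\<mu> * R powr s)"
  proof -
    have "norm w powr ps \<le> \<mu>\<^sub>0 powr (ps - 1) * (\<mu> * R powr s)"
      using norm_W_L[OF r0 zB] by (simp only: w_def R_def[symmetric] a)
    then have "norm w powr ps / K0 \<le> \<mu>\<^sub>0 powr (ps - 1) * (\<mu> * R powr s) / K0"
      using K0_pos by (intro divide_right_mono) auto
    also have "\<dots> = 1 / ps * (\<mu>\<^sub>0 / (2 * c\<^sub>0)) powr (ps - 1) * (\<mu> * R powr s)"
      using mu c0 by (simp add: K0_def powr_divide)
    finally show ?thesis .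
  qed
  moreover have "blinfun_apply w (xdag - z) \<le> - (1 - \<eta> - (1 + \<eta>) / \<tau>) * (\<mu> * R powr s)"
  proof -
    \<comment> \<open>\<open>e\<close> is, up to sign, the linearisation error at \<open>z\<close>
      plus the data error \<open>v - y\<close>, because \<open>F xdag = y\<close>.\<close>
    define e where "e = r + blinfun_apply (L z) (xdag - z)"
    have "norm e \<le> norm (F xdag - F z - blinfun_apply (L z) (xdag - z)) + norm (v - y)"
      using norm_triangle_ineq4[of "F z - y + blinfun_apply (L z) (xdag - z)" "v - y"]
      norm_minus_commute[of "F z - y" "- blinfun_apply (L z) (xdag - z)"]
      by (simp add: e_def r_def F_xdag norm_minus_commute algebra_simps)
    also have "\<dots> \<le> \<eta> * norm (F xdag - F z) + \<delta>"
      using tcc[OF xdag_B zB] v(1) by (rule add_mono)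
    also have "\<dots> \<le> \<eta> * (R + \<delta>) + \<delta>"
    proof -
      have "norm (F xdag - F z) \<le> R + \<delta>"
        using norm_triangle_ineq[of "F z - v" "v - y"] v(1)
        by (simp add: R_def r_def F_xdag norm_minus_commute)
      then show ?thesis using eta by (simp add: mult_left_mono)
    qed
    also have "\<dots> = \<eta> * R + (1 + \<eta>) * \<delta>" by (simp add: algebra_simps)
    also have "\<dots> \<le> \<eta> * R + (1 + \<eta>) * (R / \<tau>)"
      using R tau eta by (intro add_left_mono mult_left_mono) (auto simp: field_simps)
    finally have ne: "norm e \<le> (\<eta> + (1 + \<eta>) / \<tau>) * R" by (simp add: algebra_simps)
    have "blinfun_apply (J r) (blinfun_apply (L z) (xdag - z)) = blinfun_apply (J r) e - R powr s"
      by (simp add: e_def blinfun.add_right duality_map_self[OF us s] R_def)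
    also have "blinfun_apply (J r) e \<le> R powr (s - 1) * norm e"
      using norm_blinfun[of "J r" e] by (simp add: norm_duality_map[OF us s] R_def)
    also have "R powr (s - 1) * norm e \<le> R powr (s - 1) * ((\<eta> + (1 + \<eta>) / \<tau>) * R)"
      using ne by (rule mult_left_mono) simp
    also have "\<dots> = (\<eta> + (1 + \<eta>) / \<tau>) * R powr s" using R by (simp add: powr_diff)
    finally have "blinfun_apply (J r) (blinfun_apply (L z) (xdag - z))
        \<le> - (1 - \<eta> - (1 + \<eta>) / \<tau>) * R powr s" by (simp add: algebra_simps)
    then have "\<mu> * blinfun_apply (J r) (blinfun_apply (L z) (xdag - z))
        \<le> \<mu> * (- (1 - \<eta> - (1 + \<eta>) / \<tau>) * R powr s)" using mu0 by (rule mult_left_mono)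
    moreover have "blinfun_apply w (xdag - z) = \<mu> * blinfun_apply (J r) (blinfun_apply (L z) (xdag - z))"
      by (simp add: w_def W_def \<mu>_def scaleR_blinfun.rep_eq)
    ultimately show ?thesis by (simp add: algebra_simps)
  qed
  ultimately have "\<Phi> (\<zeta> - w) - \<Phi> \<zeta> \<le> - (c\<^sub>1 * (\<mu> * R powr s))"
    unfolding c1_def by (simp add: algebra_simps)
  then show ?thesis using a by (simp add: w_def r_def z_def R_def)
qed

text \<open>\<open>h_upper\<close> is used twice: forwards along \<open>t *\<^sub>R e\<close>, which
  costs \<open>t powr ps\<close>, and backwards from \<open>\<xi>\<close> to \<open>\<xi>'\<close>,
  which replaces the derivative term by a difference of distances and costs \<open>t\<close>. This
  is where the factor \<open>t + t powr ps\<close> of the stopping test comes from.\<close>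

lemma momentum_step:
  assumes "t \<ge> 0"
  shows "\<Phi> (\<xi> + t *\<^sub>R (\<xi> - \<xi>'))
    \<le> \<Phi> \<xi> + t * (\<Phi> \<xi> - \<Phi> \<xi>') + (t + t powr ps) * norm (\<xi> - \<xi>') powr ps / K0"
proof -
  define e where "e = \<xi> - \<xi>'"
  have 1: "h (\<xi> + t *\<^sub>R e) \<le> h \<xi> + t * blinfun_apply e (g \<xi>) + t powr ps * norm e powr ps / K0"
    using h_upper[of "\<xi> + t *\<^sub>R e" \<xi>] assms by (simp add: K0_def powr_mult scaleR_blinfun.rep_eq)
  have "h \<xi>' \<le> h \<xi> - blinfun_apply e (g \<xi>) + norm e powr ps / K0"
    using h_upper[of \<xi>' \<xi>] by (simp add: K0_def e_def norm_minus_commute blinfun.diff_left)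
  then have "t * h \<xi>' \<le> t * (h \<xi> - blinfun_apply e (g \<xi>) + norm e powr ps / K0)"
    using assms by (rule mult_left_mono)
  then show ?thesis using 1
    by (simp add: D_def e_def blinfun.diff_left blinfun.add_left scaleR_blinfun.rep_eq algebra_simps
        add_divide_distrib)
qed

end

section \<open>The backtracking search\<close>

lemma real_of_ereal_min_bounds:
  fixes A :: ereal and c :: real
  assumes "0 \<le> A" "0 \<le> c"
  shows "0 \<le> real_of_ereal (min A (ereal c))" "real_of_ereal (min A (ereal c)) \<le> c"
    "real_of_ereal (min A (ereal c)) \<le> A"
proof -
  have "0 \<le> real_of_ereal (min A (ereal c)) \<and> real_of_ereal (min A (ereal c)) \<le> c \<and>
      ereal (real_of_ereal (min A (ereal c))) \<le> A"
    using assms by (cases A) (auto simp: min_def)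
  then show "0 \<le> real_of_ereal (min A (ereal c))" "real_of_ereal (min A (ereal c)) \<le> c"
    "ereal (real_of_ereal (min A (ereal c))) \<le> A" by auto
qed

lemma quot_nonneg: "0 \<le> a \<Longrightarrow> 0 \<le> b \<Longrightarrow> 0 \<le> quot a b"
  by (simp add: quot_def)

text \<open>Multiplied out, the convention for a zero denominator disappears: the product is then 0.
  Two equal consecutive iterates thus need no separate treatment later.\<close>

lemma le_quot_imp_mult_le: "0 \<le> a \<Longrightarrow> 0 \<le> b \<Longrightarrow> ereal t \<le> quot a b \<Longrightarrow> t * b \<le> a"
  by (cases "b = 0") (auto simp: quot_def field_simps split: if_splits)

lemma dbts_beta_bounds:
  fixes i n :: nat and \<rho> :: real
  assumes q: "\<And>k. 0 \<le> q k" and al: "\<alpha> \<ge> 3" and d: "d \<ge> 0" and pp: "p > 1" and c: "c\<^sub>0 > 0"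
  defines "t \<equiv> dbts_beta p c\<^sub>0 \<rho> \<alpha> q n d i"
  shows "0 \<le> t" "t \<le> 1" "t * d \<le> q i"
    "t * (4 * d powr (p / (p - 1))) \<le> p / (p - 1) * (2 * c\<^sub>0) powr (p / (p - 1)) * \<rho> powr p"
proof -
  define ps where "ps = p / (p - 1)"
  define A where "A = quot (q i) d"
  define b where "b = ps * (2 * c\<^sub>0) powr ps * \<rho> powr p"
  define C where "C = quot b (4 * d powr ps)"
  define e where "e = real n / (real n + \<alpha>)"
  have ps: "ps > 0" using pp by (simp add: ps_def)
  have b: "0 \<le> b" using ps by (simp add: b_def)
  have e: "0 \<le> e" "e \<le> 1" using al by (auto simp: e_def)
  have A: "0 \<le> A" unfolding A_def by (rule quot_nonneg) (use q d in auto)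
  have C: "0 \<le> C" unfolding C_def by (rule quot_nonneg) (use b in auto)
  have t: "t = real_of_ereal (min (min A C) (ereal e))"
    by (simp add: t_def dbts_beta_def Let_def A_def C_def b_def e_def ps_def min.assoc)
  have AC: "0 \<le> min A C" using A C by simp
  show "0 \<le> t" unfolding t by (rule real_of_ereal_min_bounds(1)[OF AC e(1)])
  show "t \<le> 1" unfolding t using real_of_ereal_min_bounds(2)[OF AC e(1)] e(2) by linarith
  have "ereal t \<le> min A C" unfolding t by (rule real_of_ereal_min_bounds(3)[OF AC e(1)])
  then have "ereal t \<le> A" "ereal t \<le> C" by auto
  show "t * d \<le> q i"
    by (rule le_quot_imp_mult_le[OF q d]) (use \<open>ereal t \<le> A\<close> in \<open>simp add: A_def\<close>)
  have "t * (4 * d powr ps) \<le> b"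
    by (rule le_quot_imp_mult_le[OF b]) (use \<open>ereal t \<le> C\<close> in \<open>simp_all add: C_def\<close>)
  then show "t * (4 * d powr (p / (p - 1))) \<le> p / (p - 1) * (2 * c\<^sub>0) powr (p / (p - 1)) * \<rho> powr p"
    by (simp add: ps_def b_def)
qed

lemma powr_le_self: "0 \<le> t \<Longrightarrow> t \<le> 1 \<Longrightarrow> 1 \<le> r \<Longrightarrow> t powr r \<le> (t::real)"
  using powr_mono'[of 1 r t] by simp

context tpg_problem
begin

text \<open>What the limit argument needs to know about the iteration up to the stopping index \<open>N\<close>, for
  data \<open>v\<close> with noise level \<open>\<delta>\<close>. The bound \<open>err\<close> accounts for the steps in which the search
  fails; their momentum is not controlled by \<open>q\<close>, but it vanishes with \<open>\<delta>\<close>.\<close>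

definition err :: "real \<Rightarrow> real" where "err \<delta> = (2 * \<gamma>\<^sub>0 * \<delta> powr p) powr (1 / ps)"

definition noisy_run ::
  "real \<Rightarrow> 'b \<Rightarrow> nat \<Rightarrow> (nat \<Rightarrow> 'a \<Rightarrow>\<^sub>L real) \<Rightarrow> (nat \<Rightarrow> 'a \<Rightarrow>\<^sub>L real) \<Rightarrow> (nat \<Rightarrow> real) \<Rightarrow> bool" where
  "noisy_run \<delta> v N \<xi> \<zeta> lam \<longleftrightarrow>
    \<xi> 0 = \<xi>\<^sub>0 \<and> (\<forall>n. 0 \<le> lam n \<and> lam n \<le> 1) \<and> (\<forall>n. \<zeta> n = \<xi> n + lam n *\<^sub>R (\<xi> n - \<xi> (n - 1))) \<and>
    (\<forall>n\<le>N. g (\<xi> n) \<in> B \<and> g (\<zeta> n) \<in> B) \<and>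
    (\<forall>n<N. \<tau> * \<delta> < norm (F (g (\<zeta> n)) - v)) \<and> norm (F (g (\<zeta> N)) - v) \<le> \<tau> * \<delta> \<and>
    (\<forall>n<N. \<xi> (Suc n) = \<zeta> n - (W (F (g (\<zeta> n)) - v) (g (\<zeta> n)) o\<^sub>L L (g (\<zeta> n)))) \<and>
    (\<forall>n<N. (lam n * norm (\<xi> n - \<xi> (n - 1))) powr ps
        \<le> \<gamma>\<^sub>1 * (norm (W (F (g (\<zeta> n)) - v) (g (\<zeta> n))) * norm (F (g (\<zeta> n)) - v))) \<and>
    (\<forall>n<N. \<Phi> (\<xi> (Suc n)) \<le> \<Phi> (\<xi> n)) \<and>
    (\<forall>n\<le>N. \<kappa> * (\<Sum>k<n. norm (W (F (g (\<zeta> k)) - v) (g (\<zeta> k))) * norm (F (g (\<zeta> k)) - v)) \<le> \<Phi> \<xi>\<^sub>0) \<and>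
    (\<forall>n. (\<Sum>k<n. lam k * norm (\<xi> k - \<xi> (k - 1))) \<le> suminf q + real n * err \<delta>) \<and>
    lam N * norm (\<xi> N - \<xi> (N - 1)) \<le> err \<delta>"

end

text \<open>\<open>small\<close> holds for all sufficiently small \<delta>. It keeps the momentum of
  a failed search below \<open>c\<^sub>0 * \<rho> powr p\<close>, as the second entry of
  \<open>dbts_beta\<close> does for an accepted trial.\<close>

locale tpg_run = tpg_problem \<Theta> p ps c\<^sub>0 x\<^sub>0 \<xi>\<^sub>0 F DF L y xdag \<rho> \<eta> C\<^sub>0 s \<tau> \<mu>\<^sub>0 \<mu>\<^sub>1 \<nu> \<alpha> c\<^sub>1 \<gamma>\<^sub>0 \<gamma>\<^sub>1 M q jmax
  for \<Theta> :: "'a::banach \<Rightarrow> ereal" and p ps c\<^sub>0 :: real and x\<^sub>0 :: 'a and \<xi>\<^sub>0 :: "'a \<Rightarrow>\<^sub>L real"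
    and F :: "'a \<Rightarrow> 'b::banach" and DF :: "'a set" and L :: "'a \<Rightarrow> 'a \<Rightarrow>\<^sub>L 'b"
    and y :: 'b and xdag :: 'a and \<rho> \<eta> C\<^sub>0 s \<tau> \<mu>\<^sub>0 \<mu>\<^sub>1 \<nu> \<alpha> c\<^sub>1 \<gamma>\<^sub>0 \<gamma>\<^sub>1 M :: real
    and q :: "nat \<Rightarrow> real" and jmax :: nat +
  fixes \<delta> :: real and v :: 'b and \<xi> \<zeta> :: "nat \<Rightarrow> 'a \<Rightarrow>\<^sub>L real" and x z :: "nat \<Rightarrow> 'a"
    and lam :: "nat \<Rightarrow> real" and i :: "nat \<Rightarrow> nat"
  assumes delta: "\<delta> > 0" and v: "norm (v - y) \<le> \<delta>"
    and small: "2 * \<gamma>\<^sub>0 * \<delta> powr p \<le> c\<^sub>0 * \<rho> powr p * K0"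
    and tpg: "two_point_gradient \<Theta> F L p s \<tau> \<mu>\<^sub>0 \<mu>\<^sub>1 \<delta> v x\<^sub>0 \<xi>\<^sub>0 lam \<xi> x \<zeta> z"
    and dbts: "dbts \<Theta> F L p c\<^sub>0 s \<tau> \<mu>\<^sub>0 \<mu>\<^sub>1 \<rho> \<gamma>\<^sub>0 \<gamma>\<^sub>1 \<alpha> q jmax \<delta> v \<xi> lam i"
begin

abbreviation d :: "nat \<Rightarrow> real" where "d n \<equiv> norm (\<xi> n - \<xi> (n - 1))"
abbreviation r :: "nat \<Rightarrow> 'b" where "r n \<equiv> F (z n) - v"
abbreviation \<mu> :: "nat \<Rightarrow> real" where "\<mu> n \<equiv> tpg_step_size F L p s \<tau> \<mu>\<^sub>0 \<mu>\<^sub>1 \<delta> v (z n)"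

lemma xi_0: "\<xi> 0 = \<xi>\<^sub>0" and x_0: "x 0 = x\<^sub>0"
  and zeta: "\<zeta> n = \<xi> n + lam n *\<^sub>R (\<xi> n - \<xi> (n - 1))" and z_eq: "z n = g (\<zeta> n)"
  and xi_Suc: "\<xi> (Suc n) = \<zeta> n - \<mu> n *\<^sub>R (J (r n) o\<^sub>L L (z n))" and x_Suc: "x (Suc n) = g (\<xi> (Suc n))"
  using tpg unfolding two_point_gradient_def grad_conjugate_eq by auto

lemma x_eq: "x n = g (\<xi> n)"
  by (cases n) (simp_all add: x_0 xi_0 g_x0 x_Suc)

text \<open>The three origins of \<open>lam n\<close>: zero, at the start or after the first test; a
  trial accepted by the second test; the fallback after a failed search. After the start, the
  counter \<open>i\<close> advances in each of them.\<close>

lemma dbts_cases: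
  obtains "lam n = 0" "n = 0 \<or> i (n - 1) < i n"
  | "lam n * d n \<le> q (i n)" "i (n - 1) < i n" "0 \<le> lam n" "lam n \<le> 1"
    "lam n * (4 * d n powr ps) \<le> ps * (2 * c\<^sub>0) powr ps * \<rho> powr p"
    "\<tau> * \<delta> < norm (r n)" "(lam n + lam n powr ps) * d n powr ps \<le> \<gamma>\<^sub>1 * \<mu> n * norm (r n) powr s"
  | "i (n - 1) < i n" "0 \<le> lam n" "lam n \<le> 1" "lam n * d n powr ps \<le> \<gamma>\<^sub>0 * \<delta> powr p"
proof (cases "n = 0")
  case True
  then show ?thesis using dbts that(1) by (auto simp: dbts_def)
next
  case False
  define trial where "trial = (\<lambda>j. dbts_beta p c\<^sub>0 \<rho> \<alpha> q n (d n) (i (n - 1) + j))"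
  define zz where "zz = (\<lambda>j. g (\<xi> n + trial j *\<^sub>R (\<xi> n - \<xi> (n - 1))))"
  define test1 where "test1 = (\<lambda>j. norm (F (zz j) - v) \<le> \<tau> * \<delta>)"
  define test2 where "test2 = (\<lambda>j. (trial j + trial j powr ps) * d n powr ps
      \<le> \<gamma>\<^sub>1 * tpg_step_size F L p s \<tau> \<mu>\<^sub>0 \<mu>\<^sub>1 \<delta> v (zz j) * norm (F (zz j) - v) powr s)"
  have step: "(lam n, i n) =
     (case find (\<lambda>j. test1 j \<or> test2 j) [1..<Suc jmax] of
        Some j \<Rightarrow> (if test1 j then 0 else trial j, i (n - 1) + j)
      | None \<Rightarrow> (real_of_ereal (min (quot (\<gamma>\<^sub>0 * \<delta> powr p) (d n powr ps))
                    (ereal (real n / (real n + \<alpha>)))), i (n - 1) + jmax))"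
    using dbts False unfolding dbts_def dbts_step_def Let_def grad_conjugate_eq
      test1_def test2_def zz_def trial_def ps[symmetric] by simp
  show ?thesis
  proof (cases "find (\<lambda>j. test1 j \<or> test2 j) [1..<Suc jmax]")
    case None
    define e where "e = real n / (real n + \<alpha>)"
    have e: "0 \<le> e" "e \<le> 1" using alpha by (auto simp: e_def)
    have lam: "lam n = real_of_ereal (min (quot (\<gamma>\<^sub>0 * \<delta> powr p) (d n powr ps)) (ereal e))"
      and i: "i n = i (n - 1) + jmax" using step None by (auto simp: e_def)
    have Q: "0 \<le> quot (\<gamma>\<^sub>0 * \<delta> powr p) (d n powr ps)"
      using \<gamma>0_pos by (intro quot_nonneg) auto
    show ?thesis
    proof (rule that(3))
      show "i (n - 1) < i n" using i jmax by simp
      show "0 \<le> lam n" unfolding lam by (rule real_of_ereal_min_bounds(1)[OF Q e(1)])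
      show "lam n \<le> 1" unfolding lam using real_of_ereal_min_bounds(2)[OF Q e(1)] e(2) by linarith
      show "lam n * d n powr ps \<le> \<gamma>\<^sub>0 * \<delta> powr p"
        unfolding lam using \<gamma>0_pos
        by (intro le_quot_imp_mult_le real_of_ereal_min_bounds(3)[OF Q e(1)]) auto
    qed
  next
    case (Some j)
    then have j: "test1 j \<or> test2 j" "1 \<le> j"
      by (auto simp: find_Some_iff simp del: upt_Suc)
    have lam: "lam n = (if test1 j then 0 else trial j)" and i: "i n = i (n - 1) + j"
      using step Some by auto
    show ?thesis
    proof (cases "test1 j")
      case True
      then show ?thesis using that(1) lam i j(2) by simp
    next
      case False
      then have lam: "lam n = trial j" and t2: "test2 j" using lam j(1) by auto
      \<comment> \<open>The accepted trial point is the point that the iteration then uses, so the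
        tests speak about the actual residual.\<close>
      have zz: "zz j = z n" by (simp add: zz_def z_eq zeta lam)
      have t: "lam n = dbts_beta p c\<^sub>0 \<rho> \<alpha> q n (d n) (i n)" by (simp add: lam trial_def i)
      have pp: "p > 1" using p by simp
      note bb = dbts_beta_bounds[where q = q, OF q(1) alpha norm_ge_zero[of "\<xi> n - \<xi> (n - 1)"] pp c0,
          where \<rho> = \<rho> and n = n and i = "i n", folded t ps]
      show ?thesis
        by (rule that(2))
          (use bb False t2 j(2) i in \<open>simp_all add: test1_def test2_def zz lam[symmetric]\<close>)
    qed
  qed
qed

section \<open>Bounds for the momentum term\<close>

lemma lam_bounds: "0 \<le> lam n" "lam n \<le> 1"
  by (rule dbts_cases[of n]; simp)+

lemma lam_powr_le: "(lam n + lam n powr ps) * d n powr ps \<le> 2 * (lam n * d n powr ps)"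
proof -
  have "lam n powr ps \<le> lam n" using lam_bounds ps_facts by (intro powr_le_self) auto
  then have "(lam n + lam n powr ps) * d n powr ps \<le> (2 * lam n) * d n powr ps"
    by (intro mult_right_mono) auto
  then show ?thesis by simp
qed

lemma momentum_powr_le:
  "(lam n * d n) powr ps \<le> (lam n + lam n powr ps) * d n powr ps"
  using lam_bounds[of n] by (simp add: powr_mult algebra_simps)

text \<open>The second entry of \<open>dbts_beta\<close>, multiplied out, is
  \<open>2 * (c\<^sub>0 * \<rho> powr p * K0)\<close>, and its factor 4 pays for
  \<open>lam + lam powr ps \<le> 2 * lam\<close>. For the fallback, \<open>small\<close> gives the
  same.\<close>

lemma momentum_small: "(lam n + lam n powr ps) * d n powr ps / K0 \<le> c\<^sub>0 * \<rho> powr p"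
proof -
  have "(lam n + lam n powr ps) * d n powr ps \<le> c\<^sub>0 * \<rho> powr p * K0"
  proof (rule dbts_cases[of n])
    assume "lam n * (4 * d n powr ps) \<le> ps * (2 * c\<^sub>0) powr ps * \<rho> powr p"
    moreover have "ps * (2 * c\<^sub>0) powr ps * \<rho> powr p = 2 * (c\<^sub>0 * \<rho> powr p * K0)"
      using c0 by (simp add: K0_def powr_diff)
    moreover have "lam n * (4 * d n powr ps) = 4 * (lam n * d n powr ps)" by simp
    ultimately show ?thesis using lam_powr_le[of n] by linarith
  next
    assume "lam n * d n powr ps \<le> \<gamma>\<^sub>0 * \<delta> powr p"
    then show ?thesis using lam_powr_le[of n] small by simp
  next
    assume "lam n = 0"
    then show ?thesis using c0 K0_pos by simp
  qed
  then show ?thesis using K0_pos by (simp add: pos_divide_le_eq)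
qed

lemma err_pos: "err \<delta> \<ge> 0"
  by (simp add: err_def)

lemma le_err:
  assumes "lam n * d n powr ps \<le> \<gamma>\<^sub>0 * \<delta> powr p"
  shows "lam n * d n \<le> err \<delta>"
proof -
  have le: "(lam n * d n) powr ps \<le> 2 * \<gamma>\<^sub>0 * \<delta> powr p"
    using momentum_powr_le[of n] lam_powr_le[of n] assms by simp
  then have "((lam n * d n) powr ps) powr (1 / ps) \<le> err \<delta>"
    unfolding err_def by (rule powr_mono2[rotated 2]) (use ps_facts in auto)
  then show ?thesis using ps_facts lam_bounds[of n] by (simp add: powr_powr)
qed

lemma momentum_le: "lam n * d n \<le> q (i n) + err \<delta>"
  by (rule dbts_cases[of n]) (use q(1)[of "i n"] err_pos le_err[of n] in auto)

text \<open>At the stopping index an accepted trial is impossible, since it would have failed the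
  first test; only zero or the fallback remains.\<close>

lemma momentum_le_err: "norm (r n) \<le> \<tau> * \<delta> \<Longrightarrow> lam n * d n \<le> err \<delta>"
  by (rule dbts_cases[of n]) (use err_pos le_err[of n] in auto)

lemma strict_mono_i: "strict_mono i"
proof (rule strict_mono_Suc_iff[THEN iffD2], rule allI)
  fix n show "i n < i (Suc n)" by (rule dbts_cases[of "Suc n"]) auto
qed

text \<open>As \<open>i\<close> is strictly increasing, the values \<open>q (i k)\<close> are
  distinct terms of the summable sequence \<open>q\<close>. Each failed search adds at most
  \<open>err \<delta>\<close>.\<close>

lemma momentum_sum: "(\<Sum>k<n. lam k * d k) \<le> suminf q + real n * err \<delta>"
proof -
  have "(\<Sum>k<n. lam k * d k) \<le> (\<Sum>k<n. q (i k) + err \<delta>)"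
    by (rule sum_mono) (rule momentum_le)
  also have "\<dots> = sum q (i ` {..<n}) + real n * err \<delta>"
    using strict_mono_imp_inj_on[OF strict_mono_i] inj_on_subset[of i UNIV "{..<n}"]
    by (subst sum.reindex) (auto simp: sum.distrib)
  also have "sum q (i ` {..<n}) \<le> suminf q"
    by (rule sum_le_suminf[OF q(2)]) (use q(1) in auto)
  finally show ?thesis by simp
qed

lemma step_W:
  assumes "\<tau> * \<delta> < norm (r n)"
  shows "\<mu> n *\<^sub>R (J (r n) o\<^sub>L L (z n)) = W (r n) (z n) o\<^sub>L L (z n)"
  by (rule blinfun_eqI) (simp add: W_def tpg_step_size_eq[OF assms delta] scaleR_blinfun.rep_eq)

lemma step_W_norm:
  assumes "\<tau> * \<delta> < norm (r n)" "z n \<in> B"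
  shows "\<mu> n * norm (r n) powr s = norm (W (r n) (z n)) * norm (r n)"
proof -
  have "0 < \<tau> * \<delta>" using tau delta by simp
  then have r0: "r n \<noteq> 0" using assms(1) by auto
  have "norm (r n) powr (p - s) * norm (r n) powr s = norm (r n) powr p" by (simp flip: powr_add)
  then show ?thesis using norm_W[OF r0 assms(2)] by (simp add: tpg_step_size_eq[OF assms(1) delta])
qed

text \<open>For an accepted trial this is the second test; for the fallback it follows from
  \<open>\<gamma>0_K0\<close> and the lower bound on \<open>W\<close>.\<close>

lemma momentum_descent:
  assumes rn: "\<tau> * \<delta> < norm (r n)" and "z n \<in> B"
  shows "(lam n + lam n powr ps) * d n powr ps \<le> \<gamma>\<^sub>1 * (norm (W (r n) (z n)) * norm (r n))"
proof -
  have td: "0 < \<tau> * \<delta>" using tau delta by simp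
  then have r0: "r n \<noteq> 0" using assms(1) by auto
  show ?thesis
  proof (rule dbts_cases[of n])
    assume "(lam n + lam n powr ps) * d n powr ps \<le> \<gamma>\<^sub>1 * \<mu> n * norm (r n) powr s"
    then show ?thesis using step_W_norm[OF assms] by (simp add: mult.assoc)
  next
    assume "lam n * d n powr ps \<le> \<gamma>\<^sub>0 * \<delta> powr p"
    then have "(lam n + lam n powr ps) * d n powr ps \<le> (2 * \<gamma>\<^sub>0) * \<delta> powr p"
      using lam_powr_le[of n] by simp
    also have "\<dots> = \<gamma>\<^sub>1 * (m * (\<tau> * \<delta>) powr p)"
      using tau delta by (simp add: \<gamma>0_K0 powr_mult)
    also have "\<dots> \<le> \<gamma>\<^sub>1 * (m * norm (r n) powr p)"
      using td rn \<gamma>1_pos m_pos p by (intro mult_left_mono powr_mono2) auto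
    also have "\<dots> \<le> \<gamma>\<^sub>1 * (norm (W (r n) (z n)) * norm (r n))"
      using W_bounds(1)[OF r0 assms(2)] \<gamma>1_pos by (intro mult_left_mono) auto
    finally show ?thesis .
  next
    assume "lam n = 0"
    then show ?thesis using \<gamma>1_pos by simp
  qed
qed

text \<open>Monotonicity up to \<open>n\<close> makes the difference term in
  \<open>momentum_step\<close> nonpositive. What remains of the momentum raises the distance by at
  most the fraction \<open>1 / \<nu>\<close> of what the gradient step then removes. Membership of
  \<open>z n\<close> in the ball must be carried along because the next decrease rests on
  it.\<close>

lemma invariants:
  assumes "\<And>k. k < n \<Longrightarrow> \<tau> * \<delta> < norm (r k)"
  shows "\<Phi> (\<xi> n) \<le> \<Phi> (\<xi> (n - 1)) \<and> x n \<in> B \<and> z n \<in> B \<and>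
    \<Phi> (\<xi> n) + \<kappa> * (\<Sum>k<n. norm (W (r k) (z k)) * norm (r k)) \<le> \<Phi> \<xi>\<^sub>0"
  using assms
proof (induction n)
  case 0
  have "0 \<le> c\<^sub>0 * \<rho> powr p" using c0 by simp
  then have "\<Phi> \<xi>\<^sub>0 \<le> 2 * (c\<^sub>0 * \<rho> powr p)" using xdag_le by linarith
  moreover have "\<zeta> 0 = \<xi>\<^sub>0" by (simp add: zeta xi_0)
  ultimately show ?case using g_in_B by (simp add: x_eq z_eq xi_0)
next
  case (Suc n)
  let ?a = "norm (W (r n) (z n)) * norm (r n)"
  have IH: "\<Phi> (\<xi> n) \<le> \<Phi> (\<xi> (n - 1))" "z n \<in> B"
    "\<Phi> (\<xi> n) + \<kappa> * (\<Sum>k<n. norm (W (r k) (z k)) * norm (r k)) \<le> \<Phi> \<xi>\<^sub>0"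
    using Suc.IH Suc.prems by auto
  have rn: "\<tau> * \<delta> < norm (r n)" using Suc.prems by simp
  have lam0: "lam n * (\<Phi> (\<xi> n) - \<Phi> (\<xi> (n - 1))) \<le> 0"
    using IH(1) lam_bounds by (simp add: mult_nonneg_nonpos)
  have "\<Phi> (\<zeta> n) \<le> \<Phi> (\<xi> n) + (lam n + lam n powr ps) * d n powr ps / K0"
    using momentum_step[OF lam_bounds(1), of "\<xi> n" n "\<xi> (n - 1)"] lam0 by (simp add: zeta)
  also have "\<dots> \<le> \<Phi> (\<xi> n) + c\<^sub>1 / \<nu> * ?a"
  proof -
    have "(lam n + lam n powr ps) * d n powr ps / K0 \<le> \<gamma>\<^sub>1 * ?a / K0"
      using momentum_descent[OF rn IH(2)] K0_pos by (intro divide_right_mono) auto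
    then show ?thesis using K0_pos by (simp add: \<gamma>1_K0)
  qed
  finally have 1: "\<Phi> (\<zeta> n) \<le> \<Phi> (\<xi> n) + c\<^sub>1 / \<nu> * ?a" .
  have "\<Phi> (\<xi> (Suc n)) \<le> \<Phi> (\<zeta> n) - c\<^sub>1 * ?a"
    using gradient_step_decrease[OF _ v delta, of "\<zeta> n"] IH(2) rn
    by (simp add: xi_Suc step_W[OF rn] z_eq[symmetric])
  with 1 have dec: "\<Phi> (\<xi> (Suc n)) \<le> \<Phi> (\<xi> n) - \<kappa> * ?a"
    by (simp add: \<kappa>_def algebra_simps)
  moreover have "0 \<le> \<kappa> * ?a" using \<kappa>_pos by simp
  ultimately have mono: "\<Phi> (\<xi> (Suc n)) \<le> \<Phi> (\<xi> n)" by simp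
  have tot: "\<Phi> (\<xi> (Suc n)) + \<kappa> * (\<Sum>k<Suc n. norm (W (r k) (z k)) * norm (r k)) \<le> \<Phi> \<xi>\<^sub>0"
    using dec IH(3) by (simp add: algebra_simps)
  have "0 \<le> \<kappa> * (\<Sum>k<Suc n. norm (W (r k) (z k)) * norm (r k))"
    using \<kappa>_pos by (intro mult_nonneg_nonneg sum_nonneg) auto
  then have le: "\<Phi> (\<xi> (Suc n)) \<le> c\<^sub>0 * \<rho> powr p" using tot xdag_le by linarith
  have "0 \<le> c\<^sub>0 * \<rho> powr p" using c0 by simp
  then have xB: "x (Suc n) \<in> B" unfolding x_eq using le by (intro g_in_B) linarith
  have "lam (Suc n) * (\<Phi> (\<xi> (Suc n)) - \<Phi> (\<xi> n)) \<le> 0"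
    using mono lam_bounds by (simp add: mult_nonneg_nonpos)
  then have "\<Phi> (\<zeta> (Suc n)) \<le> \<Phi> (\<xi> (Suc n)) + c\<^sub>0 * \<rho> powr p"
    using momentum_step[OF lam_bounds(1), of "\<xi> (Suc n)" "Suc n" "\<xi> n"] momentum_small[of "Suc n"]
    by (simp add: zeta)
  then have "z (Suc n) \<in> B" unfolding z_eq using le by (intro g_in_B) linarith
  then show ?case using mono xB tot by simp
qed

text \<open>Each step above the threshold uses up at least the fixed amount \<open>c\<close> of the
  finite supply \<open>\<Phi> \<xi>\<^sub>0\<close>.\<close>

lemma ex_discrepancy: "\<exists>n. norm (r n) \<le> \<tau> * \<delta>"
proof (rule ccontr)
  assume "\<not> ?thesis"
  then have all: "\<tau> * \<delta> < norm (r n)" for n by (simp add: not_le)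
  have td: "0 < \<tau> * \<delta>" using tau delta by simp
  define c where "c = \<kappa> * (m * (\<tau> * \<delta>) powr p)"
  have c: "c > 0" using \<kappa>_pos m_pos tau delta by (simp add: c_def)
  have "real n * c \<le> \<Phi> \<xi>\<^sub>0" for n
  proof -
    have r0: "r k \<noteq> 0" for k using all[of k] td by auto
    have "m * (\<tau> * \<delta>) powr p \<le> norm (W (r k) (z k)) * norm (r k)" for k
    proof -
      have "m * (\<tau> * \<delta>) powr p \<le> m * norm (r k) powr p"
        using all[of k] td m_pos p by (intro mult_left_mono powr_mono2) auto
      also have "\<dots> \<le> norm (W (r k) (z k)) * norm (r k)"
        using invariants[of k] all by (intro W_bounds(1) r0) auto
      finally show ?thesis .
    qed
    then have "(\<Sum>k<n. m * (\<tau> * \<delta>) powr p) \<le> (\<Sum>k<n. norm (W (r k) (z k)) * norm (r k))"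
      by (intro sum_mono)
    then have "\<kappa> * (\<Sum>k<n. m * (\<tau> * \<delta>) powr p) \<le> \<kappa> * (\<Sum>k<n. norm (W (r k) (z k)) * norm (r k))"
      using \<kappa>_pos by (intro mult_left_mono) auto
    also have "\<dots> \<le> \<Phi> \<xi>\<^sub>0"
      using invariants[of n] all D_nonneg[OF xdag_dom, of "\<xi> n"] by fastforce
    finally show ?thesis by (simp add: c_def algebra_simps)
  qed
  then show False using reals_Archimedean3[OF c] by (meson not_less)
qed

lemma discrepancy_index_run:
  defines "N \<equiv> discrepancy_index F \<tau> \<delta> v z"
  shows "noisy_run \<delta> v N \<xi> \<zeta> lam"
proof -
  define N' where "N' = (LEAST n. norm (r n) \<le> \<tau> * \<delta>)"
  have N': "norm (r N') \<le> \<tau> * \<delta>" unfolding N'_def using ex_discrepancy by (rule LeastI_ex)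
  have less: "\<tau> * \<delta> < norm (r n)" if "n < N'" for n
    using not_less_Least[of n "\<lambda>n. norm (r n) \<le> \<tau> * \<delta>"] that by (simp add: N'_def not_le)
  have "N = N'" unfolding N_def discrepancy_index_def
  proof (rule the_equality)
    fix n assume "norm (r n) \<le> \<tau> * \<delta> \<and> (\<forall>k<n. \<tau> * \<delta> < norm (r k))"
    then show "n = N'" using N' less by (metis linorder_neqE_nat not_le)
  qed (use N' less in auto)
  have inv: "\<Phi> (\<xi> n) \<le> \<Phi> (\<xi> (n - 1)) \<and> x n \<in> B \<and> z n \<in> B \<and>
    \<Phi> (\<xi> n) + \<kappa> * (\<Sum>k<n. norm (W (r k) (z k)) * norm (r k)) \<le> \<Phi> \<xi>\<^sub>0" if "n \<le> N'" for n
    using invariants[of n] less that by auto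
  have "noisy_run \<delta> v N' \<xi> \<zeta> lam"
    unfolding noisy_run_def z_eq[symmetric] x_eq[symmetric]
  proof (intro conjI allI impI)
    fix n assume n: "n < N'"
    show "\<xi> (Suc n) = \<zeta> n - (W (r n) (z n) o\<^sub>L L (z n))"
      by (simp add: xi_Suc step_W[OF less[OF n]])
    show "(lam n * d n) powr ps \<le> \<gamma>\<^sub>1 * (norm (W (r n) (z n)) * norm (r n))"
      using momentum_descent[OF less[OF n]] momentum_powr_le[of n] inv[of n] n by simp
    show "\<Phi> (\<xi> (Suc n)) \<le> \<Phi> (\<xi> n)" using inv[of "Suc n"] n by simp
  next
    fix n assume "n \<le> N'"
    then show "\<kappa> * (\<Sum>k<n. norm (W (r k) (z k)) * norm (r k)) \<le> \<Phi> \<xi>\<^sub>0"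
      using inv[of n] D_nonneg[OF xdag_dom, of "\<xi> n"] by simp
  qed (use xi_0 zeta lam_bounds inv less N' momentum_sum momentum_le_err in auto)
  then show ?thesis using \<open>N = N'\<close> by simp
qed

end

section \<open>The exact limit iteration\<close>

text \<open>The first index at which \<open>f\<close> falls below its positive minimum over
  \<open>{..N}\<close> is a record, and it lies beyond \<open>N\<close>.\<close>

lemma finite_minimum_records:
  fixes f :: "nat \<Rightarrow> real"
  assumes f: "f \<longlonglongrightarrow> 0" and pos: "\<And>n. f n > 0"
  shows "infinite {n. \<forall>k\<le>n. f n \<le> f k}"
  unfolding infinite_nat_iff_unbounded_le
proof
  fix N
  define e where "e = Min (f ` {..N})"
  have e: "e > 0" unfolding e_def using pos by (subst Min_gr_iff) auto
  have le: "e \<le> f k" if "k \<le> N" for k unfolding e_def using that by (intro Min_le) auto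
  have ex: "\<exists>n. f n < e"
    using order_tendstoD(2)[OF f e] by (auto simp: eventually_sequentially)
  define n where "n = (LEAST n. f n < e)"
  have n: "f n < e" unfolding n_def using ex by (rule LeastI_ex)
  have less: "e \<le> f k" if "k < n" for k
    using not_less_Least[of k "\<lambda>n. f n < e"] that by (simp add: n_def not_less)
  have "N < n" using le[of n] n by (meson not_le)
  moreover have "f n \<le> f k" if "k \<le> n" for k
    using less[of k] n that by (cases "k = n") auto
  ultimately show "\<exists>n\<ge>N. n \<in> {n. \<forall>k\<le>n. f n \<le> f k}" by (intro exI[of _ n]) auto
qed

context tpg_problem
begin

text \<open>No rule for \<open>l\<close> is assumed, only relations inherited from the noisy runs.
  If the distances stayed above \<open>e\<close>, no residual could vanish, the record indices would
  give a limit solution \<open>u\<close>, and \<open>u\<close> would be strictly closer to the start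
  than \<open>xdag\<close>.\<close>

lemma exact_iteration_converges:
  fixes X Z :: "nat \<Rightarrow> 'a \<Rightarrow>\<^sub>L real" and l :: "nat \<Rightarrow> real"
  defines "R \<equiv> \<lambda>n. F (g (Z n)) - y"
  defines "w \<equiv> \<lambda>n. W (R n) (g (Z n))"
  assumes l: "\<And>n. 0 \<le> l n" and Z: "\<And>n. Z n = X n + l n *\<^sub>R (X n - X (n - 1))"
    and XB: "\<And>n. g (X n) \<in> B" and ZB: "\<And>n. g (Z n) \<in> B"
    and X_Suc: "\<And>n. X (Suc n) = Z n - (w n o\<^sub>L L (g (Z n)))"
    and desc: "\<And>n. (l n * norm (X n - X (n - 1))) powr ps \<le> \<gamma>\<^sub>1 * (norm (w n) * norm (R n))"
    and mono: "\<And>n. \<Phi> (X (Suc n)) \<le> \<Phi> (X n)"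
    and sum1: "\<And>n. \<kappa> * (\<Sum>k<n. norm (w k) * norm (R k)) \<le> \<Phi> \<xi>\<^sub>0"
    and sum2: "\<And>n. (\<Sum>k<n. l k * norm (X k - X (k - 1))) \<le> suminf q"
    and ann: "\<And>n v. blinfun_apply (L xdag) v = 0 \<Longrightarrow> blinfun_apply (X n - \<xi>\<^sub>0) v = 0"
    and e: "e > 0"
  shows "\<exists>n. \<Phi> (X n) < e"
proof (rule ccontr)
  assume "\<not> ?thesis"
  then have ge: "e \<le> \<Phi> (X n)" for n by (simp add: not_less)
  define d where "d = (\<lambda>n. l n * norm (X n - X (n - 1)))"
  define a where "a = (\<lambda>n. norm (w n) * norm (R n))"
  have d0: "0 \<le> d n" for n using l by (simp add: d_def)
  have a0: "0 \<le> a n" for n by (simp add: a_def)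
  have pos: "p > 0" "ps > 0" using p ps_facts by auto
  \<comment> \<open>A zero residual forces zero momentum by \<open>desc\<close>. Then
    \<open>X n = Z n\<close> represents a solution, and \<open>solution_D_le_0\<close> contradicts
    the lower bound \<open>e\<close>.\<close>
  have R0: "R n \<noteq> 0" for n
  proof
    assume "R n = 0"
    then have "d n powr ps \<le> 0" using desc[of n] by (simp add: d_def)
    then have "d n powr ps = 0" using powr_ge_zero[of "d n" ps] by linarith
    then have "l n *\<^sub>R (X n - X (n - 1)) = 0" by (auto simp: d_def)
    then have "Z n = X n" using Z[of n] by simp
    then have "\<Phi> (X n) \<le> 0" using solution_D_le_0[OF XB _ ann] \<open>R n = 0\<close> by (simp add: R_def)
    then show False using ge[of n] e by simp
  qed
  have a_lower: "m * norm (R n) powr p \<le> a n" and a_upper: "a n \<le> \<mu>\<^sub>1 * norm (R n) powr p" for n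
    using W_bounds[OF R0 ZB, of n n] by (simp_all add: a_def w_def)
  \<comment> \<open>The records concern residuals at \<open>g (Z n)\<close>, the Cauchy argument
    concerns \<open>g (X n)\<close>. The momentum is of order
    \<open>norm (R n) powr (p / ps)\<close>; since \<open>p / ps * (ps - 1) = 1\<close>, the Hoelder
    bound makes the distance of the two points linear in \<open>norm (R n)\<close>.\<close>
  define C1 where "C1 = ((\<gamma>\<^sub>1 * \<mu>\<^sub>1) powr (1 / ps) / (2 * c\<^sub>0)) powr (ps - 1)"
  define C2 where "C2 = 1 + C\<^sub>0 / (1 - \<eta>) * C1"
  have C2: "norm (F (g (X n)) - y) \<le> C2 * norm (R n)" for n
  proof -
    define t where "t = norm (R n)"
    have t: "t > 0" using R0 by (simp add: t_def)
    have "d n powr ps \<le> \<gamma>\<^sub>1 * a n" using desc[of n] by (simp add: d_def a_def)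
    also have "\<dots> \<le> \<gamma>\<^sub>1 * (\<mu>\<^sub>1 * t powr p)"
      using a_upper[of n] \<gamma>1_pos by (intro mult_left_mono) (auto simp: t_def)
    finally have "d n powr ps \<le> \<gamma>\<^sub>1 * (\<mu>\<^sub>1 * t powr p)" .
    then have "(d n powr ps) powr (1 / ps) \<le> (\<gamma>\<^sub>1 * \<mu>\<^sub>1 * t powr p) powr (1 / ps)"
      using pos by (intro powr_mono2) auto
    then have dn: "d n \<le> (\<gamma>\<^sub>1 * \<mu>\<^sub>1) powr (1 / ps) * t powr (p / ps)"
      using d0 pos \<gamma>1_pos mu by (simp add: powr_powr powr_mult)
    have "norm (g (Z n) - g (X n)) \<le> (norm (Z n - X n) / (2 * c\<^sub>0)) powr (ps - 1)"
      by (rule g_dist)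
    also have "norm (Z n - X n) = d n" using l by (simp add: Z[of n] d_def)
    also have "(d n / (2 * c\<^sub>0)) powr (ps - 1)
        \<le> ((\<gamma>\<^sub>1 * \<mu>\<^sub>1) powr (1 / ps) * t powr (p / ps) / (2 * c\<^sub>0)) powr (ps - 1)"
      using dn d0 c0 ps_facts by (intro powr_mono2 divide_right_mono) auto
    also have "\<dots> = C1 * (t powr (p / ps)) powr (ps - 1)"
    proof -
      have "(\<gamma>\<^sub>1 * \<mu>\<^sub>1) powr (1 / ps) * t powr (p / ps) / (2 * c\<^sub>0)
          = (\<gamma>\<^sub>1 * \<mu>\<^sub>1) powr (1 / ps) / (2 * c\<^sub>0) * t powr (p / ps)" by simp
      then show ?thesis unfolding C1_def using c0 by (simp only: powr_mult[of _ "t powr (p / ps)"])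
    qed
    also have "(t powr (p / ps)) powr (ps - 1) = t"
    proof -
      have "p / ps * (ps - 1) = 1" using ps_facts pos by simp
      then show ?thesis using t by (simp add: powr_powr)
    qed
    finally have gg: "norm (g (X n) - g (Z n)) \<le> C1 * t" by (simp add: norm_minus_commute)
    have "norm (F (g (X n)) - y) \<le> norm (F (g (X n)) - F (g (Z n))) + t"
      using norm_triangle_ineq[of "F (g (X n)) - F (g (Z n))" "R n"] by (simp add: R_def t_def)
    also have "norm (F (g (X n)) - F (g (Z n))) \<le> C\<^sub>0 / (1 - \<eta>) * norm (g (X n) - g (Z n))"
      by (rule F_lipschitz[OF XB ZB])
    also have "\<dots> \<le> C\<^sub>0 / (1 - \<eta>) * (C1 * t)"
      using gg C0 eta by (intro mult_left_mono) auto
    finally show ?thesis by (simp add: C2_def t_def algebra_simps)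
  qed
  have sa: "summable a"
  proof (rule summableI_nonneg_bounded[OF a0])
    fix n show "(\<Sum>k<n. a k) \<le> \<Phi> \<xi>\<^sub>0 / \<kappa>"
      using sum1[of n] \<kappa>_pos by (simp add: a_def field_simps)
  qed
  have sd: "summable d"
    by (rule summableI_nonneg_bounded[OF d0]) (use sum2 in \<open>simp add: d_def\<close>)
  have Rlim: "(\<lambda>n. norm (R n)) \<longlonglongrightarrow> 0"
  proof -
    have "(\<lambda>n. a n / m) \<longlonglongrightarrow> 0 / m"
      by (intro tendsto_intros summable_LIMSEQ_zero[OF sa]) (use m_pos in auto)
    then have "(\<lambda>n. a n / m) \<longlonglongrightarrow> 0" by simp
    then have "(\<lambda>n. norm (R n) powr p) \<longlonglongrightarrow> 0"
      by (rule Lim_null_comparison[rotated]) (use a_lower m_pos in \<open>auto simp: field_simps\<close>)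
    then have "(\<lambda>n. (norm (R n) powr p) powr (1 / p)) \<longlonglongrightarrow> 0"
      by (rule tendsto_zero_powrI[OF _ tendsto_const]) (use pos in auto)
    then show ?thesis using pos R0 by (simp add: powr_powr)
  qed
  obtain r :: "nat \<Rightarrow> nat" where r: "strict_mono r" "\<And>k. \<forall>j\<le>r k. norm (R (r k)) \<le> norm (R j)"
    using infinite_enumerate[OF finite_minimum_records[OF Rlim]] R0 by auto
  define S where "S = (\<lambda>n. \<Sum>k<n. d k + a k)"
  have S: "convergent S"
    using summable_add[OF sd sa] unfolding S_def summable_iff_convergent .
  \<comment> \<open>\<open>6 * \<rho>\<close> bounds the distance of two points of the ball and
    multiplies the momentum; \<open>(1 + \<eta>) * (C2 + 2)\<close> multiplies the residual
    terms.\<close>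
  define C3 where "C3 = 6 * \<rho> + (1 + \<eta>) * (C2 + 2)"
  have C2pos: "C2 \<ge> 0" using C0 eta by (simp add: C2_def C1_def)
  have C3: "C3 > 0" using rho eta C2pos by (simp add: C3_def add_pos_nonneg)
  text \<open>A record index \<open>b\<close> of the residuals dominates all earlier ones, which makes the
    increments of \<open>X\<close> up to \<open>b\<close> summable against \<open>g (X b) - xdag\<close>.\<close>
  have inc: "\<bar>blinfun_apply (X b - X n) (g (X b) - xdag)\<bar> \<le> C3 * (S b - S n)"
    if b: "\<forall>j\<le>b. norm (R b) \<le> norm (R j)" and "n \<le> b" for n b
  proof -
    define u where "u = g (X b) - xdag"
    have nu: "norm u \<le> 6 * \<rho>"
      using XB[of b] xdag_B norm_triangle_ineq4[of "g (X b) - x\<^sub>0" "xdag - x\<^sub>0"]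
      by (simp add: u_def dist_norm norm_minus_commute)
    have step: "\<bar>blinfun_apply (X (Suc k) - X k) u\<bar> \<le> C3 * (d k + a k)" if "k < b" for k
    proof -
      have "X (Suc k) - X k = l k *\<^sub>R (X k - X (k - 1)) - (w k o\<^sub>L L (g (Z k)))"
        by (simp add: X_Suc Z[of k])
      then have "blinfun_apply (X (Suc k) - X k) u
          = l k * blinfun_apply (X k - X (k - 1)) u - blinfun_apply (w k) (blinfun_apply (L (g (Z k))) u)"
        by (simp add: blinfun.diff_left scaleR_blinfun.rep_eq)
      then have "\<bar>blinfun_apply (X (Suc k) - X k) u\<bar>
          \<le> \<bar>l k * blinfun_apply (X k - X (k - 1)) u\<bar> + \<bar>blinfun_apply (w k) (blinfun_apply (L (g (Z k))) u)\<bar>"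
        using abs_triangle_ineq4 by metis
      moreover have "\<bar>l k * blinfun_apply (X k - X (k - 1)) u\<bar> \<le> d k * (6 * \<rho>)"
      proof -
        have "\<bar>blinfun_apply (X k - X (k - 1)) u\<bar> \<le> norm (X k - X (k - 1)) * norm u"
          using norm_blinfun[of "X k - X (k - 1)" u] by simp
        also have "\<dots> \<le> norm (X k - X (k - 1)) * (6 * \<rho>)" using nu by (rule mult_left_mono) simp
        finally have "l k * \<bar>blinfun_apply (X k - X (k - 1)) u\<bar> \<le> l k * (norm (X k - X (k - 1)) * (6 * \<rho>))"
          using l by (rule mult_left_mono)
        then show ?thesis using l by (simp add: d_def abs_mult)
      qed
      moreover have "\<bar>blinfun_apply (w k) (blinfun_apply (L (g (Z k))) u)\<bar> \<le> a k * ((1 + \<eta>) * (C2 + 2))"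
      proof -
        let ?z = "g (Z k)"
        have "blinfun_apply (L ?z) u = blinfun_apply (L ?z) (g (X b) - ?z) - blinfun_apply (L ?z) (xdag - ?z)"
          by (simp add: u_def blinfun.diff_right)
        then have "norm (blinfun_apply (L ?z) u)
            \<le> norm (blinfun_apply (L ?z) (g (X b) - ?z)) + norm (blinfun_apply (L ?z) (xdag - ?z))"
          using norm_triangle_ineq4 by metis
        also have "\<dots> \<le> (1 + \<eta>) * norm (F (g (X b)) - F ?z) + (1 + \<eta>) * norm (F xdag - F ?z)"
          by (intro add_mono L_le XB xdag_B ZB)
        also have "\<dots> = (1 + \<eta>) * (norm (F (g (X b)) - F ?z) + norm (R k))"
          by (simp add: R_def F_xdag norm_minus_commute algebra_simps)
        also have "\<dots> \<le> (1 + \<eta>) * ((C2 + 2) * norm (R k))"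
        proof (intro mult_left_mono)
          have "norm (F (g (X b)) - F ?z) \<le> norm (F (g (X b)) - y) + norm (R k)"
            using norm_triangle_ineq4[of "F (g (X b)) - y" "R k"] by (simp add: R_def)
          also have "norm (F (g (X b)) - y) \<le> C2 * norm (R k)"
            using C2[of b] mult_left_mono[of "norm (R b)" "norm (R k)" C2] b C2pos \<open>k < b\<close> by force
          finally show "norm (F (g (X b)) - F ?z) + norm (R k) \<le> (C2 + 2) * norm (R k)"
            by (simp add: algebra_simps)
        qed (use eta in simp)
        finally have "norm (w k) * norm (blinfun_apply (L ?z) u) \<le> norm (w k) * ((1 + \<eta>) * ((C2 + 2) * norm (R k)))"
          by (rule mult_left_mono) simp
        then show ?thesis
          using norm_blinfun[of "w k" "blinfun_apply (L ?z) u"] by (simp add: a_def algebra_simps)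
      qed
      moreover have "d k * (6 * \<rho>) + a k * ((1 + \<eta>) * (C2 + 2)) \<le> C3 * (d k + a k)"
        using mult_nonneg_nonneg[OF a0[of k], of "6 * \<rho>"] rho
          mult_nonneg_nonneg[OF d0[of k], of "(1 + \<eta>) * (C2 + 2)"] eta C2pos
        by (simp add: C3_def algebra_simps)
      ultimately show ?thesis by linarith
    qed
    have "\<bar>blinfun_apply (X (n + k) - X n) u\<bar> \<le> C3 * (S (n + k) - S n)" if "n + k \<le> b" for k
      using that
    proof (induction k)
      case (Suc k)
      have "blinfun_apply (X (n + Suc k) - X n) u
          = blinfun_apply (X (Suc (n + k)) - X (n + k)) u + blinfun_apply (X (n + k) - X n) u"
        by (simp add: blinfun.diff_left)
      moreover have "S (n + Suc k) = S (n + k) + (d (n + k) + a (n + k))" by (simp add: S_def)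
      ultimately show ?case using step[of "n + k"] Suc by (simp add: algebra_simps)
    qed simp
    from this[of "b - n"] show ?thesis using \<open>n \<le> b\<close> by (simp add: u_def)
  qed
  have "decseq (\<lambda>n. \<Phi> (X n))" by (rule decseq_SucI) (rule mono)
  then have "convergent (\<lambda>n. \<Phi> (X n))"
    by (rule decseq_convergent[of _ 0])
      (use D_nonneg[OF xdag_dom] in \<open>auto simp: convergent_def\<close>)
  then obtain \<Phi>' where \<Phi>': "(\<lambda>n. \<Phi> (X n)) \<longlonglongrightarrow> \<Phi>'" by (auto simp: convergent_def)
  obtain S' where S': "S \<longlonglongrightarrow> S'" using S by (auto simp: convergent_def)
  \<comment> \<open>The correction by \<open>S\<close> absorbs the inner products bounded by
    \<open>inc\<close>, so that Bregman distances to record iterates are at most differences of a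
    Cauchy sequence.\<close>
  define E where "E = (\<lambda>n. \<Phi> (X n) - C3 * S n)"
  have E: "Cauchy E"
  proof (rule LIMSEQ_imp_Cauchy)
    show "E \<longlonglongrightarrow> \<Phi>' - C3 * S'" unfolding E_def by (intro tendsto_intros \<Phi>' S')
  qed
  have dist_le: "c\<^sub>0 * norm (g (X (r k)) - g (X n)) powr p \<le> E n - E (r k)" if "n \<le> r k" for k n
  proof -
    let ?b = "r k"
    have "c\<^sub>0 * norm (g (X ?b) - g (X n)) powr p \<le> D (g (X ?b)) (X n)"
      by (rule D_lower[OF g_dom])
    \<comment> \<open>The three-point identity for Bregman distances.\<close>
    also have "\<dots> = \<Phi> (X n) - \<Phi> (X ?b) + blinfun_apply (X ?b - X n) (g (X ?b) - xdag)"
      by (simp add: D_def h_def[of "X ?b"] blinfun.diff_left blinfun.diff_right)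
    also have "\<dots> \<le> E n - E ?b"
      using inc[OF r(2) that] by (simp add: E_def algebra_simps)
    finally show ?thesis .
  qed
  have "Cauchy (\<lambda>k. g (X (r k)))"
  proof (rule CauchyI')
    fix t :: real assume t: "t > 0"
    then have "c\<^sub>0 * t powr p > 0" using c0 by simp
    then obtain N where N: "\<And>n k. n \<ge> N \<Longrightarrow> k \<ge> N \<Longrightarrow> dist (E n) (E k) < c\<^sub>0 * t powr p"
      using metric_CauchyD[OF E] by blast
    have "dist (g (X (r k))) (g (X (r j))) < t" if "k \<ge> N" "j > k" for k j
    proof -
      have rk: "r k \<ge> N" "r j \<ge> N" "r k \<le> r j"
        using seq_suble[OF r(1), of k] seq_suble[OF r(1), of j] strict_monoD[OF r(1), of k j] that by auto
      have "c\<^sub>0 * norm (g (X (r j)) - g (X (r k))) powr p \<le> E (r k) - E (r j)"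
        by (rule dist_le[OF rk(3)])
      also have "\<dots> < c\<^sub>0 * t powr p" using N[OF rk(1,2)] by (simp add: dist_real_def)
      finally have lt: "norm (g (X (r j)) - g (X (r k))) powr p < t powr p" using c0 by simp
      have "norm (g (X (r j)) - g (X (r k))) < t"
      proof (rule ccontr)
        assume "\<not> ?thesis"
        then have "t powr p \<le> norm (g (X (r j)) - g (X (r k))) powr p"
          using t pos by (intro powr_mono2) auto
        then show False using lt by simp
      qed
      then show ?thesis by (simp add: dist_norm norm_minus_commute)
    qed
    then show "\<exists>M. \<forall>k\<ge>M. \<forall>j>k. dist (g (X (r k))) (g (X (r j))) < t" by blast
  qed
  then obtain u where u: "(\<lambda>k. g (X (r k))) \<longlonglongrightarrow> u" using Cauchy_convergent convergent_def by blast
  have uB: "u \<in> B" by (rule closed_sequentially[OF closed_cball _ u]) (use XB in simp)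
  have Fu: "F u = y"
  proof (rule LIMSEQ_unique)
    show "(\<lambda>k. F (g (X (r k)))) \<longlonglongrightarrow> F u"
      by (rule tendsto_F[OF u _ uB]) (use XB in simp)
    have "(\<lambda>n. C2 * norm (R n)) \<longlonglongrightarrow> C2 * 0" by (intro tendsto_intros Rlim)
    then have "(\<lambda>n. C2 * norm (R n)) \<longlonglongrightarrow> 0" by simp
    then have "(\<lambda>n. F (g (X n)) - y) \<longlonglongrightarrow> 0"
      by (rule Lim_null_comparison[rotated]) (use C2 in simp)
    then have "(\<lambda>n. F (g (X n))) \<longlonglongrightarrow> y" by (rule LIM_zero_cancel)
    then show "(\<lambda>k. F (g (X (r k)))) \<longlonglongrightarrow> y"
      using LIMSEQ_subseq_LIMSEQ[OF _ r(1)] by (auto simp: o_def)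
  qed
  have "norm (blinfun_apply (L xdag) (u - xdag)) \<le> 0"
    using L_le[OF uB xdag_B] Fu F_xdag by simp
  then have ann_u: "blinfun_apply (X n - \<xi>\<^sub>0) (u - xdag) = 0" for n by (intro ann) simp
  have "Cauchy S" using S by (rule convergent_Cauchy)
  moreover have "e / (4 * C3) > 0" using e C3 by simp
  ultimately obtain N where N: "\<And>n k. n \<ge> N \<Longrightarrow> k \<ge> N \<Longrightarrow> dist (S n) (S k) < e / (4 * C3)"
    using metric_CauchyD by blast
  \<comment> \<open>In \<open>X (r k) = (X (r k) - X N) + (X N - \<xi>\<^sub>0) +
    \<xi>\<^sub>0\<close>, the first part contributes at most \<open>e / 4\<close> by
    \<open>inc\<close>, and the second vanishes in the limit because it annihilates
    \<open>u - xdag\<close>. Of the gap \<open>e\<close> at least \<open>e / 2\<close> thus survives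
    the passage to \<open>u\<close>.\<close>
  define c where "c = \<theta> xdag - e / 2 + blinfun_apply \<xi>\<^sub>0 (u - xdag)"
  have "u \<in> dom\<Theta> \<and> \<theta> u \<le> c"
  proof (rule lsc[OF u])
    define A where "A = (\<lambda>k. \<theta> xdag - e + blinfun_apply \<xi>\<^sub>0 (g (X (r k)) - xdag)
        + blinfun_apply (X N - \<xi>\<^sub>0) (g (X (r k)) - xdag) + e / 4)"
    have "A \<longlonglongrightarrow> \<theta> xdag - e + blinfun_apply \<xi>\<^sub>0 (u - xdag) + blinfun_apply (X N - \<xi>\<^sub>0) (u - xdag) + e / 4"
      unfolding A_def by (intro tendsto_intros blinfun.tendsto u)
    then have ev: "eventually (\<lambda>k. A k < c) sequentially"
      by (rule order_tendstoD) (use e ann_u in \<open>simp add: c_def\<close>)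
    have le: "\<theta> (g (X (r k))) \<le> A k" if "k \<ge> N" for k
    proof -
      have rk: "r k \<ge> N" using seq_suble[OF r(1), of k] that by simp
      have "\<bar>blinfun_apply (X (r k) - X N) (g (X (r k)) - xdag)\<bar> \<le> C3 * (S (r k) - S N)"
        by (rule inc[OF r(2) rk])
      also have "\<dots> \<le> C3 * (e / (4 * C3))"
        using N[OF rk order_refl] C3 by (intro mult_left_mono) (auto simp: dist_real_def)
      also have "\<dots> = e / 4" using C3 by simp
      finally have "blinfun_apply (X (r k) - X N) (g (X (r k)) - xdag) \<le> e / 4" by simp
      then show ?thesis using ge[of "r k"]
        by (simp add: A_def D_def h_def[of "X (r k)"] blinfun.diff_left blinfun.diff_right)
    qed
    show "eventually (\<lambda>k. g (X (r k)) \<in> dom\<Theta> \<and> \<theta> (g (X (r k))) \<le> c) sequentially"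
      using ev eventually_ge_at_top[of N]
    proof eventually_elim
      case (elim k)
      then show ?case using le[of k] g_dom by simp
    qed
  qed
  then have "D u \<xi>\<^sub>0 < \<Phi> \<xi>\<^sub>0" using e by (simp add: D_def c_def blinfun.diff_right)
  moreover have "\<Phi> \<xi>\<^sub>0 \<le> D u \<xi>\<^sub>0"
    using \<open>u \<in> dom\<Theta> \<and> \<theta> u \<le> c\<close> uB ball Fu by (intro xdag_min) auto
  ultimately show False by simp
qed

end

section \<open>Passing to the limit in the noise level\<close>

text \<open>The countable product of intervals is compact by Tychonoff's theorem and metrizable, so
  a single subsequence serves all coordinates; this replaces a diagonal argument.\<close>

lemma unit_interval_diagonal:
  fixes f :: "nat \<Rightarrow> nat \<Rightarrow> real"
  assumes "\<And>k n. 0 \<le> f k n \<and> f k n \<le> 1"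
  obtains r :: "nat \<Rightarrow> nat" and l where "strict_mono r" and "\<And>n. (\<lambda>k. f (r k) n) \<longlonglongrightarrow> l n"
proof -
  have "compactin (product_topology (\<lambda>n::nat. euclidean) UNIV) (PiE UNIV (\<lambda>n. {0..1::real}))"
    by (simp add: compactin_PiE)
  then have "compact (PiE UNIV (\<lambda>n::nat. {0..1::real}))"
    by (simp add: euclidean_product_topology)
  then have "seq_compact (PiE UNIV (\<lambda>n::nat. {0..1::real}))"
    by (simp add: compact_eq_seq_compact_metric)
  moreover have "\<And>k. f k \<in> PiE UNIV (\<lambda>n. {0..1})" using assms by auto
  ultimately obtain l r where r: "strict_mono r" "(f \<circ> r) \<longlonglongrightarrow> l"
    unfolding seq_compact_def by blast
  have "(\<lambda>k. f (r k) n) \<longlonglongrightarrow> l n" for n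
    using continuous_on_tendsto_compose[OF continuous_on_product_coordinates r(2)] by (simp add: o_def)
  then show ?thesis using that r(1) by blast
qed

context tpg_problem
begin

lemma W_zero: "W 0 z = 0"
proof -
  have "J 0 = 0" using norm_duality_map[OF us s, of 0] s by simp
  then show ?thesis by (simp add: W_def)
qed

text \<open>At \<open>R = 0\<close> neither the step size nor the normalisation behind
  \<open>J\<close> need converge, but
  \<open>norm (W a b) \<le> \<mu>\<^sub>1 * norm a powr (p - 1)\<close> suffices. Elsewhere all
  ingredients are continuous, the \<open>max\<close> in \<open>\<sigma>\<close> being
  positive.\<close>

lemma tendsto_W:
  assumes r: "(r \<longlongrightarrow> R) Fl" and z: "(z \<longlongrightarrow> Z) Fl" and ev: "eventually (\<lambda>k. z k \<in> B \<and> r k \<noteq> 0) Fl"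
    and ZB: "Z \<in> B"
  shows "((\<lambda>k. W (r k) (z k)) \<longlongrightarrow> W R Z) Fl"
proof (cases "R = 0")
  case True
  have bound: "norm (W a b) \<le> \<mu>\<^sub>1 * norm a powr (p - 1)" if "a \<noteq> 0" "b \<in> B" for a b
  proof -
    have "norm (W a b) * norm a \<le> \<mu>\<^sub>1 * norm a powr (p - 1) * norm a"
      using W_bounds(2)[OF that] that(1) by (simp add: powr_diff)
    then show ?thesis using that(1) by simp
  qed
  have "((\<lambda>k. norm (r k)) \<longlongrightarrow> 0) Fl" using tendsto_norm[OF r] True by simp
  then have "((\<lambda>k. norm (r k) powr (p - 1)) \<longlongrightarrow> 0) Fl"
    by (rule tendsto_zero_powrI[OF _ tendsto_const]) (use p in auto)
  from tendsto_mult_right_zero[OF this, of \<mu>\<^sub>1]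
  have "((\<lambda>k. W (r k) (z k)) \<longlongrightarrow> 0) Fl"
    by (rule Lim_null_comparison[rotated]) (use ev in \<open>auto elim!: eventually_mono simp: bound\<close>)
  then show ?thesis using True by (simp add: W_zero)
next
  case False
  have Jr: "((\<lambda>k. J (r k)) \<longlongrightarrow> J R) Fl"
    by (rule tendsto_duality_map[OF us s r False])
  have "((\<lambda>k. L (z k)) \<longlongrightarrow> L Z) Fl"
    by (rule continuous_on_tendsto_compose[OF L_cont z ZB]) (use ev in \<open>auto elim: eventually_mono\<close>)
  then have JL: "((\<lambda>k. J (r k) o\<^sub>L L (z k)) \<longlongrightarrow> J R o\<^sub>L L Z) Fl"
    by (rule bounded_bilinear.tendsto[OF bounded_bilinear_blinfun_compose Jr])
  have "\<mu>\<^sub>0 * norm R powr (p * (s - 1)) / \<mu>\<^sub>1 > 0" using False mu by simp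
  then have mx: "max (norm (J R o\<^sub>L L Z) powr p) (\<mu>\<^sub>0 * norm R powr (p * (s - 1)) / \<mu>\<^sub>1) \<noteq> 0"
    by linarith
  have "((\<lambda>k. \<sigma> (r k) (z k)) \<longlongrightarrow> \<sigma> R Z) Fl"
    unfolding \<sigma>_def
    by (intro tendsto_intros tendsto_max r JL mx) (use False p mu in auto)
  then show ?thesis unfolding W_def
    by (intro tendsto_intros r Jr) (use False in auto)
qed

lemma err_tendsto_0:
  assumes "(\<delta> \<longlongrightarrow> 0) Fl" "eventually (\<lambda>k. \<delta> k \<ge> 0) Fl"
  shows "((\<lambda>k. err (\<delta> k)) \<longlongrightarrow> 0) Fl"
proof -
  have "((\<lambda>k. \<delta> k powr p) \<longlongrightarrow> 0) Fl"
    by (rule tendsto_zero_powrI[OF assms(1) tendsto_const assms(2)]) (use p in simp)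
  from tendsto_mult_right_zero[OF this, of "2 * \<gamma>\<^sub>0"] show ?thesis
    unfolding err_def
    by (rule tendsto_zero_powrI[OF _ tendsto_const]) (use \<gamma>0_pos ps_facts in auto)
qed

end

locale tpg_limit = tpg_problem \<Theta> p ps c\<^sub>0 x\<^sub>0 \<xi>\<^sub>0 F DF L y xdag \<rho> \<eta> C\<^sub>0 s \<tau> \<mu>\<^sub>0 \<mu>\<^sub>1 \<nu> \<alpha> c\<^sub>1 \<gamma>\<^sub>0 \<gamma>\<^sub>1 M q jmax
  for \<Theta> :: "'a::banach \<Rightarrow> ereal" and p ps c\<^sub>0 :: real and x\<^sub>0 :: 'a and \<xi>\<^sub>0 :: "'a \<Rightarrow>\<^sub>L real"
    and F :: "'a \<Rightarrow> 'b::banach" and DF :: "'a set" and L :: "'a \<Rightarrow> 'a \<Rightarrow>\<^sub>L 'b"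
    and y :: 'b and xdag :: 'a and \<rho> \<eta> C\<^sub>0 s \<tau> \<mu>\<^sub>0 \<mu>\<^sub>1 \<nu> \<alpha> c\<^sub>1 \<gamma>\<^sub>0 \<gamma>\<^sub>1 M :: real
    and q :: "nat \<Rightarrow> real" and jmax :: nat +
  fixes \<delta> :: "nat \<Rightarrow> real" and v :: "nat \<Rightarrow> 'b" and N :: "nat \<Rightarrow> nat"
    and \<xi> \<zeta> :: "nat \<Rightarrow> nat \<Rightarrow> 'a \<Rightarrow>\<^sub>L real" and lam :: "nat \<Rightarrow> nat \<Rightarrow> real" and l :: "nat \<Rightarrow> real"
  assumes delta: "\<And>k. \<delta> k > 0" "\<delta> \<longlonglongrightarrow> 0" and v: "\<And>k. norm (v k - y) \<le> \<delta> k"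
    and run: "\<And>k. noisy_run (\<delta> k) (v k) (N k) (\<xi> k) (\<zeta> k) (lam k)"
    and lam_lim: "\<And>n. (\<lambda>k. lam k n) \<longlonglongrightarrow> l n"
begin

abbreviation reached :: "nat \<Rightarrow> bool" where "reached n \<equiv> eventually (\<lambda>k. n \<le> N k) sequentially"

text \<open>\<open>lim\<close> has content only for indices that almost all runs reach before
  stopping; hence the assumption \<open>reached\<close> in the facts below.\<close>

definition X :: "nat \<Rightarrow> 'a \<Rightarrow>\<^sub>L real" where "X n = lim (\<lambda>k. \<xi> k n)"
definition Z :: "nat \<Rightarrow> 'a \<Rightarrow>\<^sub>L real" where "Z n = X n + l n *\<^sub>R (X n - X (n - 1))"
definition R :: "nat \<Rightarrow> 'b" where "R n = F (g (Z n)) - y"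
definition w :: "nat \<Rightarrow> 'b \<Rightarrow>\<^sub>L real" where "w n = W (R n) (g (Z n))"
abbreviation rk :: "nat \<Rightarrow> nat \<Rightarrow> 'b" where "rk k n \<equiv> F (g (\<zeta> k n)) - v k"
abbreviation wk :: "nat \<Rightarrow> nat \<Rightarrow> 'b \<Rightarrow>\<^sub>L real" where "wk k n \<equiv> W (rk k n) (g (\<zeta> k n))"

lemma reached_mono: "reached n \<Longrightarrow> j \<le> n \<Longrightarrow> reached j"
  by (auto elim: eventually_mono)

lemma run_facts:
  shows "\<xi> k 0 = \<xi>\<^sub>0" "0 \<le> lam k n" "\<zeta> k n = \<xi> k n + lam k n *\<^sub>R (\<xi> k n - \<xi> k (n - 1))"
    and "n \<le> N k \<Longrightarrow> g (\<xi> k n) \<in> B" "n \<le> N k \<Longrightarrow> g (\<zeta> k n) \<in> B"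
    and "n < N k \<Longrightarrow> \<tau> * \<delta> k < norm (rk k n)" "norm (rk k (N k)) \<le> \<tau> * \<delta> k"
    and "n < N k \<Longrightarrow> \<xi> k (Suc n) = \<zeta> k n - (wk k n o\<^sub>L L (g (\<zeta> k n)))"
    and "n < N k \<Longrightarrow> (lam k n * norm (\<xi> k n - \<xi> k (n - 1))) powr ps \<le> \<gamma>\<^sub>1 * (norm (wk k n) * norm (rk k n))"
    and "n < N k \<Longrightarrow> \<Phi> (\<xi> k (Suc n)) \<le> \<Phi> (\<xi> k n)"
    and "n \<le> N k \<Longrightarrow> \<kappa> * (\<Sum>j<n. norm (wk k j) * norm (rk k j)) \<le> \<Phi> \<xi>\<^sub>0"
    and "(\<Sum>j<n. lam k j * norm (\<xi> k j - \<xi> k (j - 1))) \<le> suminf q + real n * err (\<delta> k)"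
    and "lam k (N k) * norm (\<xi> k (N k) - \<xi> k (N k - 1)) \<le> err (\<delta> k)"
  using run[of k] unfolding noisy_run_def by blast+

lemma v_lim: "v \<longlonglongrightarrow> y"
  by (rule LIM_zero_cancel, rule Lim_null_comparison[OF _ delta(2)]) (use v in simp)

lemma err_lim: "(\<lambda>k. err (\<delta> k)) \<longlonglongrightarrow> 0"
  by (rule err_tendsto_0[OF delta(2) always_eventually]) (use less_imp_le[OF delta(1)] in simp)

lemma limits_of_xi:
  assumes reach: "reached n" and xi: "(\<lambda>k. \<xi> k n) \<longlonglongrightarrow> X n" "(\<lambda>k. \<xi> k (n - 1)) \<longlonglongrightarrow> X (n - 1)"
  shows "(\<lambda>k. \<zeta> k n) \<longlonglongrightarrow> Z n" "g (Z n) \<in> B" "(\<lambda>k. rk k n) \<longlonglongrightarrow> R n"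
    "(\<lambda>k. g (\<zeta> k n)) \<longlonglongrightarrow> g (Z n)"
proof -
  have "(\<lambda>k. \<xi> k n + lam k n *\<^sub>R (\<xi> k n - \<xi> k (n - 1))) \<longlonglongrightarrow> Z n"
    unfolding Z_def by (intro tendsto_intros xi lam_lim)
  then show zeta: "(\<lambda>k. \<zeta> k n) \<longlonglongrightarrow> Z n" by (simp only: run_facts(3)[symmetric])
  show gz: "(\<lambda>k. g (\<zeta> k n)) \<longlonglongrightarrow> g (Z n)" by (rule tendsto_g[OF zeta])
  have ev: "eventually (\<lambda>k. g (\<zeta> k n) \<in> B) sequentially"
    using reach by eventually_elim (rule run_facts(5))
  show gB: "g (Z n) \<in> B"
    by (rule Lim_in_closed_set[OF closed_cball ev _ gz]) simp
  show "(\<lambda>k. rk k n) \<longlonglongrightarrow> R n"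
    unfolding R_def by (intro tendsto_intros tendsto_F[OF gz ev gB] v_lim)
qed

text \<open>\<open>reached (Suc n)\<close>, not \<open>reached n\<close>: step \<open>n\<close> is
  then taken with a residual above the threshold, which is nonzero as \<open>tendsto_W\<close>
  requires. In the limit it may vanish.\<close>

lemma limit_of_w:
  assumes reach: "reached (Suc n)" and xi: "(\<lambda>k. \<xi> k n) \<longlonglongrightarrow> X n" "(\<lambda>k. \<xi> k (n - 1)) \<longlonglongrightarrow> X (n - 1)"
  shows "(\<lambda>k. wk k n) \<longlonglongrightarrow> w n"
    and "(\<lambda>k. \<xi> k (Suc n)) \<longlonglongrightarrow> Z n - (w n o\<^sub>L L (g (Z n)))"
proof -
  note lims = limits_of_xi[OF reached_mono[OF reach le_SucI[OF order_refl]] xi]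
  have ev: "eventually (\<lambda>k. g (\<zeta> k n) \<in> B \<and> rk k n \<noteq> 0) sequentially"
    using reach
  proof eventually_elim
    case (elim k)
    have "0 < \<tau> * \<delta> k" using tau delta(1) by simp
    then show ?case using run_facts(5,6)[of n k] elim by fastforce
  qed
  show w: "(\<lambda>k. wk k n) \<longlonglongrightarrow> w n"
    unfolding w_def by (rule tendsto_W[OF lims(3,4) ev lims(2)])
  have "(\<lambda>k. L (g (\<zeta> k n))) \<longlonglongrightarrow> L (g (Z n))"
    by (rule continuous_on_tendsto_compose[OF L_cont lims(4,2)]) (use ev in \<open>auto elim: eventually_mono\<close>)
  then have "(\<lambda>k. \<zeta> k n - (wk k n o\<^sub>L L (g (\<zeta> k n)))) \<longlonglongrightarrow> Z n - (w n o\<^sub>L L (g (Z n)))"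
    by (intro tendsto_intros lims(1) bounded_bilinear.tendsto[OF bounded_bilinear_blinfun_compose w])
  moreover have "eventually (\<lambda>k. \<zeta> k n - (wk k n o\<^sub>L L (g (\<zeta> k n))) = \<xi> k (Suc n)) sequentially"
    using reach by eventually_elim (simp add: run_facts(8))
  ultimately show "(\<lambda>k. \<xi> k (Suc n)) \<longlonglongrightarrow> Z n - (w n o\<^sub>L L (g (Z n)))"
    by (rule Lim_transform_eventually)
qed

text \<open>The induction is strong because the momentum involves the two preceding
  iterates.\<close>

lemma xi_lim: "reached n \<Longrightarrow> (\<lambda>k. \<xi> k n) \<longlonglongrightarrow> X n"
proof (induction n rule: less_induct)
  case (less n)
  show ?case
  proof (cases n)
    case 0
    have "(\<lambda>k. \<xi> k 0) = (\<lambda>k. \<xi>\<^sub>0)" by (simp add: run_facts(1))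
    then show ?thesis using 0 by (simp add: X_def)
  next
    case (Suc j)
    have "(\<lambda>k. \<xi> k j) \<longlonglongrightarrow> X j" "(\<lambda>k. \<xi> k (j - 1)) \<longlonglongrightarrow> X (j - 1)"
      using less.IH[of j] less.IH[of "j - 1"] reached_mono[OF less.prems] Suc by auto
    from limit_of_w(2)[OF _ this] less.prems Suc
    have "(\<lambda>k. \<xi> k n) \<longlonglongrightarrow> Z j - (w j o\<^sub>L L (g (Z j)))" by simp
    then show ?thesis unfolding X_def by (simp add: limI)
  qed
qed

lemma limit_facts:
  assumes "reached n"
  shows "X 0 = \<xi>\<^sub>0" and "g (X n) \<in> B" and "g (Z n) \<in> B" and "(\<lambda>k. rk k n) \<longlonglongrightarrow> R n"
    and "(\<lambda>k. lam k n * norm (\<xi> k n - \<xi> k (n - 1))) \<longlonglongrightarrow> l n * norm (X n - X (n - 1))"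
    and "(\<lambda>k. \<Phi> (\<xi> k n)) \<longlonglongrightarrow> \<Phi> (X n)"
proof -
  have "(\<lambda>k. \<xi> k 0) = (\<lambda>k. \<xi>\<^sub>0)" by (simp add: run_facts(1))
  then show "X 0 = \<xi>\<^sub>0" by (simp add: X_def)
  note xi = xi_lim[OF assms] xi_lim[OF reached_mono[OF assms, of "n - 1"]]
  show "g (X n) \<in> B"
    by (rule Lim_in_closed_set[OF closed_cball _ _ tendsto_g[OF xi(1)]])
      (use assms in \<open>auto elim!: eventually_mono simp del: mem_cball simp: run_facts\<close>)
  show "g (Z n) \<in> B" "(\<lambda>k. rk k n) \<longlonglongrightarrow> R n"
    using limits_of_xi[OF assms] xi by auto
  show "(\<lambda>k. lam k n * norm (\<xi> k n - \<xi> k (n - 1))) \<longlonglongrightarrow> l n * norm (X n - X (n - 1))"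
    using xi by (intro tendsto_intros lam_lim) auto
  show "(\<lambda>k. \<Phi> (\<xi> k n)) \<longlonglongrightarrow> \<Phi> (X n)" by (rule tendsto_D[OF xi(1)])
qed

lemma limit_step:
  assumes "reached (Suc n)"
  shows "X (Suc n) = Z n - (w n o\<^sub>L L (g (Z n)))" and "(\<lambda>k. wk k n) \<longlonglongrightarrow> w n"
proof -
  have n: "reached n" "reached (n - 1)" by (auto intro: reached_mono[OF assms])
  show "X (Suc n) = Z n - (w n o\<^sub>L L (g (Z n)))"
    using LIMSEQ_unique[OF xi_lim[OF assms] limit_of_w(2)[OF assms xi_lim[OF n(1)] xi_lim[OF n(2)]]] .
  show "(\<lambda>k. wk k n) \<longlonglongrightarrow> w n"
    by (rule limit_of_w(1)[OF assms xi_lim[OF n(1)] xi_lim[OF n(2)]])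
qed

text \<open>Momentum only recombines earlier iterates, and a gradient step adds a functional that
  factors through \<open>L (g (Z j))\<close>, whose null space contains that of
  \<open>L xdag\<close>.\<close>

lemma limit_annihilator:
  assumes "reached n" and u: "blinfun_apply (L xdag) u = 0"
  shows "blinfun_apply (X n - \<xi>\<^sub>0) u = 0"
  using assms(1)
proof (induction n rule: less_induct)
  case (less n)
  show ?case
  proof (cases n)
    case 0
    then show ?thesis using limit_facts(1)[OF less.prems] by simp
  next
    case (Suc j)
    have j: "reached j" "reached (j - 1)" by (auto intro: reached_mono[OF less.prems] simp: Suc)
    have "blinfun_apply (X j - \<xi>\<^sub>0) u = 0" "blinfun_apply (X (j - 1) - \<xi>\<^sub>0) u = 0"
      using less.IH[of j] less.IH[of "j - 1"] j Suc by auto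
    moreover have "blinfun_apply (L (g (Z j))) u = 0"
      by (rule null[OF limit_facts(3)[OF j(1)] u])
    ultimately show ?thesis
      using limit_step(1)[of j] less.prems Suc
      by (simp add: Z_def blinfun.diff_left blinfun.add_left scaleR_blinfun.rep_eq)
  qed
qed

text \<open>If the stopping index stays constant, the limit iteration stops at a solution; otherwise it is
  an infinite iteration with exact data.\<close>

lemma stopped_small:
  assumes N: "\<And>k. N k = n" and e: "e > 0"
  shows "\<exists>k. \<Phi> (\<xi> k (N k)) < e"
proof -
  have n: "reached n" using N by simp
  note facts = limit_facts[OF n]
  \<comment> \<open>At the stopping index the momentum is at most \<open>err (\<delta> k)\<close>,
    so it disappears in the limit, and the small residual at \<open>Z n\<close> becomes a zero
    residual at \<open>X n\<close>.\<close>
  have "l n * norm (X n - X (n - 1)) \<le> 0"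
    by (rule LIMSEQ_le[OF facts(5) err_lim]) (use run_facts(13) N in auto)
  moreover have "0 \<le> l n"
    by (rule LIMSEQ_le_const[OF lam_lim]) (use run_facts(2) in auto)
  ultimately have "l n = 0 \<or> X n - X (n - 1) = 0"
    by (metis less_le_not_le mult_pos_pos norm_eq_zero norm_ge_zero less_eq_real_def)
  then have ZX: "Z n = X n" by (auto simp: Z_def)
  have "norm (R n) \<le> \<tau> * 0"
  proof (rule LIMSEQ_le[OF tendsto_norm[OF facts(4)]])
    show "(\<lambda>k. \<tau> * \<delta> k) \<longlonglongrightarrow> \<tau> * 0" by (intro tendsto_intros delta)
  qed (use run_facts(7) N in auto)
  then have "F (g (X n)) = y" using ZX by (simp add: R_def)
  then have "\<Phi> (X n) \<le> 0"
    by (rule solution_D_le_0[OF facts(2) _ limit_annihilator[OF n]])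
  then have "\<Phi> (X n) < e" using e by simp
  from order_tendstoD(2)[OF facts(6) this] have "eventually (\<lambda>k. \<Phi> (\<xi> k n) < e) sequentially" .
  then show ?thesis using N by (auto simp: eventually_sequentially)
qed

lemma unstopped_small:
  assumes reach: "\<And>n. reached n" and e: "e > 0"
  shows "\<exists>k. \<Phi> (\<xi> k (N k)) < e"
proof -
  have wlim: "(\<lambda>k. norm (wk k n) * norm (rk k n)) \<longlonglongrightarrow> norm (w n) * norm (R n)" for n
    by (intro tendsto_intros limit_step(2) limit_facts(4) reach)
  have dlim: "(\<lambda>k. lam k n * norm (\<xi> k n - \<xi> k (n - 1))) \<longlonglongrightarrow> l n * norm (X n - X (n - 1))" for n
    by (rule limit_facts(5)[OF reach])
  have ev: "eventually (\<lambda>k. n < N k) sequentially" for n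
    using reach[of "Suc n"] by eventually_elim simp
  have l0: "0 \<le> l n" for n by (rule LIMSEQ_le_const[OF lam_lim]) (use run_facts(2) in auto)
  have "\<exists>n. \<Phi> (X n) < e"
  proof (rule exact_iteration_converges[where Z = Z and l = l, folded R_def, folded w_def])
    fix n
    show "(l n * norm (X n - X (n - 1))) powr ps \<le> \<gamma>\<^sub>1 * (norm (w n) * norm (R n))"
    proof (rule tendsto_le[OF sequentially_bot])
      show "(\<lambda>k. \<gamma>\<^sub>1 * (norm (wk k n) * norm (rk k n))) \<longlonglongrightarrow> \<gamma>\<^sub>1 * (norm (w n) * norm (R n))"
        by (intro tendsto_mult_left wlim)
      show "(\<lambda>k. (lam k n * norm (\<xi> k n - \<xi> k (n - 1))) powr ps) \<longlonglongrightarrow> (l n * norm (X n - X (n - 1))) powr ps"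
        using ps_facts run_facts(2) by (intro tendsto_powr' dlim tendsto_const) auto
    qed (rule eventually_mono[OF ev[of n] run_facts(9)])
    show "\<Phi> (X (Suc n)) \<le> \<Phi> (X n)"
      by (rule tendsto_le[OF sequentially_bot limit_facts(6)[OF reach] limit_facts(6)[OF reach]])
        (rule eventually_mono[OF ev[of n] run_facts(10)])
    show "\<kappa> * (\<Sum>k<n. norm (w k) * norm (R k)) \<le> \<Phi> \<xi>\<^sub>0"
    proof (rule tendsto_upperbound)
      show "(\<lambda>k. \<kappa> * (\<Sum>j<n. norm (wk k j) * norm (rk k j))) \<longlonglongrightarrow> \<kappa> * (\<Sum>j<n. norm (w j) * norm (R j))"
        by (intro tendsto_mult_left tendsto_sum wlim)
    qed (use reach[of n] in \<open>auto elim!: eventually_mono intro: run_facts(11)\<close>)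
    show "(\<Sum>k<n. l k * norm (X k - X (k - 1))) \<le> suminf q"
    proof (rule LIMSEQ_le)
      show "(\<lambda>k. \<Sum>j<n. lam k j * norm (\<xi> k j - \<xi> k (j - 1))) \<longlonglongrightarrow> (\<Sum>k<n. l k * norm (X k - X (k - 1)))"
        by (intro tendsto_sum dlim)
      \<comment> \<open>Here \<open>n\<close> is fixed while the noise level tends to 0, so the
        \<open>n\<close> possible failed searches contribute nothing in the limit.\<close>
      have "(\<lambda>k. suminf q + real n * err (\<delta> k)) \<longlonglongrightarrow> suminf q + real n * 0"
        by (intro tendsto_intros err_lim)
      then show "(\<lambda>k. suminf q + real n * err (\<delta> k)) \<longlonglongrightarrow> suminf q" by simp
    qed (use run_facts(12) in auto)
  qed (use l0 Z_def limit_facts(2,3) limit_step(1) limit_annihilator reach e in auto)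
  then obtain n where n: "\<Phi> (X n) < e" by blast
  have "eventually (\<lambda>k. \<Phi> (\<xi> k n) < e) sequentially"
    using order_tendstoD(2)[OF limit_facts(6)[OF reach] n] .
  then have "eventually (\<lambda>k. \<Phi> (\<xi> k n) < e \<and> n \<le> N k) sequentially"
    using reach by (rule eventually_conj)
  then obtain k where k: "\<Phi> (\<xi> k n) < e" "n \<le> N k" by (auto simp: eventually_sequentially)
  \<comment> \<open>Smallness at the fixed index \<open>n\<close> is carried to the stopping index
    \<open>N k \<ge> n\<close> by monotonicity.\<close>
  have "\<Phi> (\<xi> k (n + j)) \<le> \<Phi> (\<xi> k n)" if "n + j \<le> N k" for j
    using that
  proof (induction j)
    case (Suc j)
    then show ?case using run_facts(10)[of "n + j" k] by simp
  qed simp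
  from this[of "N k - n"] show ?thesis using k by (intro exI[of _ k]) auto
qed

end

context tpg_problem
begin

text \<open>Along the subsequence with convergent parameters, either some stopping index recurs
  infinitely often or the stopping indices tend to infinity; these are the two cases treated
  above.\<close>

lemma noisy_runs_small:
  fixes \<delta> :: "nat \<Rightarrow> real" and v :: "nat \<Rightarrow> 'b" and N :: "nat \<Rightarrow> nat"
    and \<xi> \<zeta> :: "nat \<Rightarrow> nat \<Rightarrow> 'a \<Rightarrow>\<^sub>L real" and lam :: "nat \<Rightarrow> nat \<Rightarrow> real"
  assumes delta: "\<And>k. \<delta> k > 0" "\<delta> \<longlonglongrightarrow> 0" and v: "\<And>k. norm (v k - y) \<le> \<delta> k"
    and run: "\<And>k. noisy_run (\<delta> k) (v k) (N k) (\<xi> k) (\<zeta> k) (lam k)" and e: "e > 0"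
  shows "\<exists>k. \<Phi> (\<xi> k (N k)) < e"
proof -
  have "0 \<le> lam k n \<and> lam k n \<le> 1" for k n using run[of k] by (simp add: noisy_run_def)
  then obtain r l where r: "strict_mono r" and lim: "\<And>n. (\<lambda>k. lam (r k) n) \<longlonglongrightarrow> l n"
    using unit_interval_diagonal[of lam] by blast
  \<comment> \<open>Both \<open>r\<close> and its further subsequences are needed: the first case
    thins out once more to make the stopping index constant.\<close>
  have sub: "tpg_limit \<Theta> p ps c\<^sub>0 x\<^sub>0 \<xi>\<^sub>0 F DF L y xdag \<rho> \<eta> C\<^sub>0 s \<tau> \<mu>\<^sub>0 \<mu>\<^sub>1 \<nu> \<alpha> c\<^sub>1 \<gamma>\<^sub>0 \<gamma>\<^sub>1 M q jmax
      (\<lambda>k. \<delta> (t k)) (\<lambda>k. v (t k)) (\<lambda>k. N (t k)) (\<lambda>k. \<xi> (t k)) (\<lambda>k. \<zeta> (t k)) (\<lambda>k. lam (t k)) l"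
    if t: "t = r \<or> (\<exists>t'. strict_mono t' \<and> t = r \<circ> t')" for t
  proof unfold_locales
    have "strict_mono t" using t r strict_mono_o by blast
    then show "(\<lambda>k. \<delta> (t k)) \<longlonglongrightarrow> 0"
      using LIMSEQ_subseq_LIMSEQ[OF delta(2)] by (auto simp: o_def)
    show "(\<lambda>k. lam (t k) n) \<longlonglongrightarrow> l n" for n
      using t lim LIMSEQ_subseq_LIMSEQ[OF lim] by (auto simp: o_def)
  qed (use delta v run in auto)
  show ?thesis
  proof (cases "\<exists>n. infinite {k. N (r k) = n}")
    case True
    then obtain n where "infinite {k. N (r k) = n}" by blast
    then obtain t :: "nat \<Rightarrow> nat" where t: "strict_mono t" "\<And>k. N (r (t k)) = n"
      using infinite_enumerate[of "{k. N (r k) = n}"] by auto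
    interpret tpg_limit \<Theta> p ps c\<^sub>0 x\<^sub>0 \<xi>\<^sub>0 F DF L y xdag \<rho> \<eta> C\<^sub>0 s \<tau> \<mu>\<^sub>0 \<mu>\<^sub>1 \<nu> \<alpha> c\<^sub>1 \<gamma>\<^sub>0 \<gamma>\<^sub>1 M q jmax
      "\<lambda>k. \<delta> ((r \<circ> t) k)" "\<lambda>k. v ((r \<circ> t) k)" "\<lambda>k. N ((r \<circ> t) k)" "\<lambda>k. \<xi> ((r \<circ> t) k)"
      "\<lambda>k. \<zeta> ((r \<circ> t) k)" "\<lambda>k. lam ((r \<circ> t) k)" l
      by (rule sub) (use t(1) in blast)
    obtain k where "\<Phi> (\<xi> ((r \<circ> t) k) (N ((r \<circ> t) k))) < e"
      using stopped_small[of n e] t(2) e by auto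
    then show ?thesis by blast
  next
    case False
    interpret tpg_limit \<Theta> p ps c\<^sub>0 x\<^sub>0 \<xi>\<^sub>0 F DF L y xdag \<rho> \<eta> C\<^sub>0 s \<tau> \<mu>\<^sub>0 \<mu>\<^sub>1 \<nu> \<alpha> c\<^sub>1 \<gamma>\<^sub>0 \<gamma>\<^sub>1 M q jmax
      "\<lambda>k. \<delta> (r k)" "\<lambda>k. v (r k)" "\<lambda>k. N (r k)" "\<lambda>k. \<xi> (r k)" "\<lambda>k. \<zeta> (r k)" "\<lambda>k. lam (r k)" l
      by (rule sub) simp
    have "eventually (\<lambda>k. n \<le> N (r k)) sequentially" for n
    proof -
      \<comment> \<open>If each value is taken only finitely often, so are all values below
        \<open>n\<close> together.\<close>
      have "{k. \<not> n \<le> N (r k)} = (\<Union>j<n. {k. N (r k) = j})" by auto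
      then have "finite {k. \<not> n \<le> N (r k)}" using False by simp
      then show ?thesis by (simp add: eventually_cofinite flip: cofinite_eq_sequentially)
    qed
    then show ?thesis using unstopped_small[OF _ e] by blast
  qed
qed

section \<open>Convergence as the noise level tends to zero\<close>

context
  fixes yd :: "real \<Rightarrow> 'b" and \<xi> \<zeta> :: "real \<Rightarrow> nat \<Rightarrow> 'a \<Rightarrow>\<^sub>L real" and x z :: "real \<Rightarrow> nat \<Rightarrow> 'a"
    and lam :: "real \<Rightarrow> nat \<Rightarrow> real" and i :: "real \<Rightarrow> nat \<Rightarrow> nat" and nd :: "real \<Rightarrow> nat"
  assumes yd: "\<And>\<delta>. \<delta> > 0 \<Longrightarrow> norm (yd \<delta> - y) \<le> \<delta>"
    and tpg: "\<And>\<delta>. \<delta> > 0 \<Longrightarrow>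
           two_point_gradient \<Theta> F L p s \<tau> \<mu>\<^sub>0 \<mu>\<^sub>1 \<delta> (yd \<delta>) x\<^sub>0 \<xi>\<^sub>0 (lam \<delta>) (\<xi> \<delta>) (x \<delta>) (\<zeta> \<delta>) (z \<delta>)"
    and dbts: "\<And>\<delta>. \<delta> > 0 \<Longrightarrow>
           dbts \<Theta> F L p c\<^sub>0 s \<tau> \<mu>\<^sub>0 \<mu>\<^sub>1 \<rho> \<gamma>\<^sub>0 \<gamma>\<^sub>1 \<alpha> q jmax \<delta> (yd \<delta>) (\<xi> \<delta>) (lam \<delta>) (i \<delta>)"
    and nd: "\<And>\<delta>. nd \<delta> = discrepancy_index F \<tau> \<delta> (yd \<delta>) (z \<delta>)"
begin

lemma eventually_noisy_run:
  "eventually (\<lambda>\<delta>. noisy_run \<delta> (yd \<delta>) (nd \<delta>) (\<xi> \<delta>) (\<zeta> \<delta>) (lam \<delta>)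
     \<and> x \<delta> (nd \<delta>) = g (\<xi> \<delta> (nd \<delta>))) (at_right 0)"
proof -
  have "((\<lambda>\<delta>::real. \<delta> powr p) \<longlongrightarrow> 0) (at_right 0)"
    by (rule tendsto_zero_powrI[OF tendsto_ident_at tendsto_const])
      (use p eventually_at_right_less[of 0] in \<open>auto elim: eventually_mono\<close>)
  from tendsto_mult_right_zero[OF this, of "2 * \<gamma>\<^sub>0"]
  have "eventually (\<lambda>\<delta>. 2 * \<gamma>\<^sub>0 * \<delta> powr p < c\<^sub>0 * \<rho> powr p * K0) (at_right 0)"
    by (rule order_tendstoD) (use c0 rho K0_pos in simp)
  with eventually_at_right_less[of 0] show ?thesis
  proof eventually_elim
    case (elim \<delta>)
    interpret tpg_run \<Theta> p ps c\<^sub>0 x\<^sub>0 \<xi>\<^sub>0 F DF L y xdag \<rho> \<eta> C\<^sub>0 s \<tau> \<mu>\<^sub>0 \<mu>\<^sub>1 \<nu> \<alpha> c\<^sub>1 \<gamma>\<^sub>0 \<gamma>\<^sub>1 M q jmax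
      \<delta> "yd \<delta>" "\<xi> \<delta>" "\<zeta> \<delta>" "x \<delta>" "z \<delta>" "lam \<delta>" "i \<delta>"
      by unfold_locales (use elim yd tpg dbts in auto)
    show ?case using discrepancy_index_run x_eq nd by simp
  qed
qed

lemma bregman_distance_tendsto_0: "((\<lambda>\<delta>. \<Phi> (\<xi> \<delta> (nd \<delta>))) \<longlongrightarrow> 0) (at_right 0)"
proof (rule tendstoI)
  fix e :: real assume e: "e > 0"
  have "eventually (\<lambda>\<delta>. \<Phi> (\<xi> \<delta> (nd \<delta>)) < e) (at_right 0)"
  proof (rule ccontr)
    assume neg: "\<not> ?thesis"
    obtain b where b: "b > 0" and
      run: "\<And>\<delta>. 0 < \<delta> \<Longrightarrow> \<delta> < b \<Longrightarrow> noisy_run \<delta> (yd \<delta>) (nd \<delta>) (\<xi> \<delta>) (\<zeta> \<delta>) (lam \<delta>)"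
      using eventually_noisy_run by (auto simp: eventually_at_right_field)
    \<comment> \<open>The negated claim is turned into a sequence of noise levels along which every
      stopped run has distance at least \<open>e\<close>, while \<open>noisy_runs_small\<close>
      provides one that does not.\<close>
    have "\<exists>\<delta>. 0 < \<delta> \<and> \<delta> < b \<and> \<delta> \<le> inverse (real (Suc k)) \<and> e \<le> \<Phi> (\<xi> \<delta> (nd \<delta>))" for k
    proof -
      have "min b (inverse (real (Suc k))) > 0" using b by simp
      then obtain \<delta> where "0 < \<delta>" "\<delta> < min b (inverse (real (Suc k)))" "\<not> \<Phi> (\<xi> \<delta> (nd \<delta>)) < e"
        using neg unfolding eventually_at_right_field by blast
      then show ?thesis by (intro exI[of _ \<delta>]) auto
    qed
    then obtain \<delta> where \<delta>: "\<And>k. 0 < \<delta> k" "\<And>k. \<delta> k < b" "\<And>k. \<delta> k \<le> inverse (real (Suc k))"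
      and ge: "\<And>k. e \<le> \<Phi> (\<xi> (\<delta> k) (nd (\<delta> k)))" by metis
    have "\<delta> \<longlonglongrightarrow> 0"
      by (rule Lim_null_comparison[OF _ LIMSEQ_inverse_real_of_nat])
        (use \<delta>(1,3) in \<open>auto simp: less_imp_le abs_of_pos\<close>)
    from noisy_runs_small[OF \<delta>(1) this yd[OF \<delta>(1)] run[OF \<delta>(1,2)] e]
    obtain k where "\<Phi> (\<xi> (\<delta> k) (nd (\<delta> k))) < e" by blast
    then show False using ge[of k] by simp
  qed
  then show "eventually (\<lambda>\<delta>. dist (\<Phi> (\<xi> \<delta> (nd \<delta>))) 0 < e) (at_right 0)"
    by (rule eventually_mono) (use D_nonneg[OF xdag_dom] in simp)
qed

lemma tpg_dbts_convergence:
  "((\<lambda>\<delta>. norm (x \<delta> (nd \<delta>) - xdag)) \<longlongrightarrow> 0) (at_right 0)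
   \<and> ((\<lambda>\<delta>. bregman \<Theta> (\<xi> \<delta> (nd \<delta>)) xdag (x \<delta> (nd \<delta>))) \<longlongrightarrow> 0) (at_right 0)"
proof
  let ?f = "\<lambda>\<delta>. \<Phi> (\<xi> \<delta> (nd \<delta>))"
  have "((\<lambda>\<delta>. ?f \<delta> / c\<^sub>0) \<longlongrightarrow> 0 / c\<^sub>0) (at_right 0)"
    by (intro tendsto_intros bregman_distance_tendsto_0) (use c0 in simp)
  then have "((\<lambda>\<delta>. ?f \<delta> / c\<^sub>0) \<longlongrightarrow> 0) (at_right 0)" by simp
  then have lim: "((\<lambda>\<delta>. (?f \<delta> / c\<^sub>0) powr (1 / p)) \<longlongrightarrow> 0) (at_right 0)"
    by (rule tendsto_zero_powrI[OF _ tendsto_const]) (use p c0 D_nonneg[OF xdag_dom] in auto)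
  have bound: "norm (g \<xi>' - xdag) \<le> (\<Phi> \<xi>' / c\<^sub>0) powr (1 / p)" for \<xi>'
  proof -
    have "norm (xdag - g \<xi>') powr p \<le> \<Phi> \<xi>' / c\<^sub>0"
      using D_lower[OF xdag_dom, of \<xi>'] c0 by (simp add: field_simps)
    then have "(norm (xdag - g \<xi>') powr p) powr (1 / p) \<le> (\<Phi> \<xi>' / c\<^sub>0) powr (1 / p)"
      using p by (intro powr_mono2) auto
    then show ?thesis using p by (simp add: powr_powr norm_minus_commute)
  qed
  show "((\<lambda>\<delta>. norm (x \<delta> (nd \<delta>) - xdag)) \<longlongrightarrow> 0) (at_right 0)"
    by (rule Lim_null_comparison[OF _ lim])
      (use eventually_noisy_run in \<open>auto elim!: eventually_mono simp: bound\<close>)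
  have "((\<lambda>\<delta>. ereal (?f \<delta>)) \<longlongrightarrow> ereal 0) (at_right 0)"
    using bregman_distance_tendsto_0 by simp
  moreover have "eventually (\<lambda>\<delta>. ereal (?f \<delta>) = bregman \<Theta> (\<xi> \<delta> (nd \<delta>)) xdag (x \<delta> (nd \<delta>))) (at_right 0)"
    using eventually_noisy_run by eventually_elim (simp add: bregman_eq_D[OF xdag_dom])
  ultimately show "((\<lambda>\<delta>. bregman \<Theta> (\<xi> \<delta> (nd \<delta>)) xdag (x \<delta> (nd \<delta>))) \<longlongrightarrow> 0) (at_right 0)"
    unfolding zero_ereal_def by (rule Lim_transform_eventually)
qed

end

end

theorem theorem3p14:
  fixes \<Theta> :: "'a::banach \<Rightarrow> ereal"
    and F :: "'a \<Rightarrow> 'b::banach" and DF :: "'a set"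
    and L :: "'a \<Rightarrow> 'a \<Rightarrow>\<^sub>L 'b"
    and y :: 'b and x\<^sub>0 xs xdag :: 'a and \<xi>\<^sub>0 :: "'a \<Rightarrow>\<^sub>L real"
    and p ps c\<^sub>0 \<rho> \<eta> C\<^sub>0 s \<tau> \<mu>\<^sub>0 \<mu>\<^sub>1 \<nu> \<alpha> c\<^sub>1 \<gamma>\<^sub>0 \<gamma>\<^sub>1 M :: real
    and q :: "nat \<Rightarrow> real" and jmax :: nat
    and yd :: "real \<Rightarrow> 'b"
    and \<xi> \<zeta> :: "real \<Rightarrow> nat \<Rightarrow> 'a \<Rightarrow>\<^sub>L real" and x z :: "real \<Rightarrow> nat \<Rightarrow> 'a"
    and lam :: "real \<Rightarrow> nat \<Rightarrow> real" and i :: "real \<Rightarrow> nat \<Rightarrow> nat"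
  assumes "reflexive_space TYPE('a)" and "uniformly_smooth TYPE('b)"
    \<comment> \<open>the functional \<open>\<Theta>\<close>\<close>
    and "p \<ge> 2" and "ps = p / (p - 1)" and "c\<^sub>0 > 0"
    and "proper_fun \<Theta>" and "convex_fun \<Theta>" and "weakly_lsc \<Theta>" and "p_convex \<Theta> p c\<^sub>0"
    \<comment> \<open>the operator \<open>F\<close>\<close>
    and "\<rho> > 0" and "\<xi>\<^sub>0 \<in> subdifferential \<Theta> x\<^sub>0" and "cball x\<^sub>0 (3 * \<rho>) \<subseteq> DF"
    and "xs \<in> DF" and "F xs = y" and "\<Theta> xs < \<infinity>"
    and "bregman \<Theta> \<xi>\<^sub>0 xs x\<^sub>0 \<le> ereal (c\<^sub>0 * \<rho> powr p)"
    and "\<And>u a v. (\<And>n::nat. u n \<in> DF) \<Longrightarrow> weakly_conv u a \<Longrightarrow> weakly_conv (\<lambda>n. F (u n)) v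
           \<Longrightarrow> a \<in> DF \<and> F a = v"
    and "continuous_on (cball x\<^sub>0 (3 * \<rho>)) L"
    and "0 \<le> \<eta>" and "\<eta> < 1"
    and "\<And>a b. a \<in> cball x\<^sub>0 (3 * \<rho>) \<Longrightarrow> b \<in> cball x\<^sub>0 (3 * \<rho>) \<Longrightarrow>
           norm (F a - F b - blinfun_apply (L b) (a - b)) \<le> \<eta> * norm (F a - F b)"
    and "C\<^sub>0 > 0" and "\<And>a. a \<in> cball x\<^sub>0 (3 * \<rho>) \<Longrightarrow> norm (L a) \<le> C\<^sub>0"
    \<comment> \<open>the solution of minimal Bregman distance to \<open>x\<^sub>0\<close>\<close>
    and "is_arg_min (\<lambda>a. bregman \<Theta> \<xi>\<^sub>0 a x\<^sub>0) (\<lambda>a. \<Theta> a < \<infinity> \<and> a \<in> DF \<and> F a = y) xdag"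
    \<comment> \<open>the parameters\<close>
    and "s > 1" and "\<tau> > 1" and "\<mu>\<^sub>0 > 0" and "\<mu>\<^sub>1 > 0"
    and "c\<^sub>1 = 1 - \<eta> - (1 + \<eta>) / \<tau> - 1 / ps * (\<mu>\<^sub>0 / (2 * c\<^sub>0)) powr (ps - 1)" and "c\<^sub>1 > 0"
    and "\<nu> > 1" and "\<alpha> \<ge> 3" and "jmax \<ge> 1"
    and "antimono q" and "\<And>k. q k \<ge> 0" and "summable q"
    and "\<gamma>\<^sub>1 = c\<^sub>1 * ps * (2 * c\<^sub>0) powr (ps - 1) / \<nu>"
    and "M = c\<^sub>1 / \<nu> * min (\<mu>\<^sub>0 / C\<^sub>0 powr p) \<mu>\<^sub>1"
    and "\<gamma>\<^sub>0 = 1 / 2 * (2 * c\<^sub>0) powr (ps - 1) * ps * M * \<tau> powr p"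
    \<comment> \<open>the noisy data and the iterates\<close>
    and "\<And>\<delta>. \<delta> > 0 \<Longrightarrow> norm (yd \<delta> - y) \<le> \<delta>"
    and "\<And>\<delta>. \<delta> > 0 \<Longrightarrow>
           two_point_gradient \<Theta> F L p s \<tau> \<mu>\<^sub>0 \<mu>\<^sub>1 \<delta> (yd \<delta>) x\<^sub>0 \<xi>\<^sub>0 (lam \<delta>) (\<xi> \<delta>) (x \<delta>) (\<zeta> \<delta>) (z \<delta>)"
    and "\<And>\<delta>. \<delta> > 0 \<Longrightarrow>
           dbts \<Theta> F L p c\<^sub>0 s \<tau> \<mu>\<^sub>0 \<mu>\<^sub>1 \<rho> \<gamma>\<^sub>0 \<gamma>\<^sub>1 \<alpha> q jmax \<delta> (yd \<delta>) (\<xi> \<delta>) (lam \<delta>) (i \<delta>)"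
    \<comment> \<open>the null space condition\<close>
    and "\<And>a. a \<in> cball x\<^sub>0 (3 * \<rho>) \<Longrightarrow>
           {v. blinfun_apply (L xdag) v = 0} \<subseteq> {v. blinfun_apply (L a) v = 0}"
  defines "nd \<equiv> \<lambda>\<delta>. discrepancy_index F \<tau> \<delta> (yd \<delta>) (z \<delta>)"
  shows "((\<lambda>\<delta>. norm (x \<delta> (nd \<delta>) - xdag)) \<longlongrightarrow> 0) (at_right 0)
       \<and> ((\<lambda>\<delta>. bregman \<Theta> (\<xi> \<delta> (nd \<delta>)) xdag (x \<delta> (nd \<delta>))) \<longlongrightarrow> 0) (at_right 0)"
proof -
  interpret p_convex_functional \<Theta> p ps c\<^sub>0 x\<^sub>0 \<xi>\<^sub>0
    by unfold_locales (rule assms)+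
  have x0: "x\<^sub>0 \<in> dom\<Theta>" using assms(11) by (simp add: subdifferential_iff)
  have breg: "bregman \<Theta> \<xi>\<^sub>0 a x\<^sub>0 = ereal (D a \<xi>\<^sub>0)" if "a \<in> dom\<Theta>" for a
    using bregman_eq_D[OF that, of \<xi>\<^sub>0] by (simp add: g_x0)
  have xdag: "xdag \<in> dom\<Theta>" "F xdag = y"
    using assms(24) by (auto simp: is_arg_min_def dom\<Theta>_def)
  have min: "D xdag \<xi>\<^sub>0 \<le> D a \<xi>\<^sub>0" if "a \<in> dom\<Theta>" "a \<in> DF" "F a = y" for a
    using assms(24) that breg[OF that(1)] breg[OF xdag(1)] by (auto simp: is_arg_min_def dom\<Theta>_def not_less)
  have xs: "xs \<in> dom\<Theta>" using assms(15) by (simp add: dom\<Theta>_def)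
  interpret tpg_problem \<Theta> p ps c\<^sub>0 x\<^sub>0 \<xi>\<^sub>0 F DF L y xdag \<rho> \<eta> C\<^sub>0 s \<tau> \<mu>\<^sub>0 \<mu>\<^sub>1 \<nu> \<alpha> c\<^sub>1 \<gamma>\<^sub>0 \<gamma>\<^sub>1 M q jmax
  proof unfold_locales
    \<comment> \<open>Being closest to the start, \<open>xdag\<close> inherits the bound assumed for
      the solution \<open>xs\<close>.\<close>
    show "D xdag \<xi>\<^sub>0 \<le> c\<^sub>0 * \<rho> powr p"
      using min[OF xs assms(13,14)] assms(16) breg[OF xs] by simp
    show "blinfun_apply (L a) v = 0"
      if "a \<in> cball x\<^sub>0 (3 * \<rho>)" "blinfun_apply (L xdag) v = 0" for a v
      using assms(43)[OF that(1)] that(2) by blast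
  qed (fact assms xdag | rule min assms; assumption)+
  show ?thesis
    by (rule tpg_dbts_convergence[OF assms(40,41,42)]) (simp_all add: nd_def)
qed

end
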